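(* Let $\mathrm{Alt}^{(2)}$ be the variety of alternative metabelian algebras over a field $F$ of characteristic $0$, i.e. the variety defined by $(x,x,y)=0$, $(x,y,y)=0$, $(xy)(zt)=0$. Then its basic spectrum is $$\mathrm{sp}_b(\mathrm{Alt}^{(2)})=\{(1,1),(0,3)\}.$$
   Context: All algebras are over a field $F$ of characteristic $0$ and are not assumed associative or unital. $(x,y,z)=(xy)z-x(yz)$ is the associator. A superalgebra is a $\mathbb Z_2$-graded algebra $\mathcal A=\mathcal A_0+\mathcal A_1$, $\mathcal A_i\mathcal A_j\subseteq\mathcal A_{i+j \bmod 2}$. $\mathrm G=\mathrm G_0+\mathrm G_1$ is the Grassmann algebra on countably many anticommuting generators $e_1,e_2,\dots$ ($\mathrm G_0$, $\mathrm G_1$ spanned by words of even, resp. odd, length). The Grassmann envelope of $\mathcal A$ is $\mathrm G(\mathcal A)=\mathrm G_0\otimes\mathcal A_0+\mathrm G_1\otimes\mathcal A_1\subseteq \mathrm G\otimes\mathcal A$. For a multilinear polynomial $f$, its superization $\tilde f$ is obtained by the Koszul sign rule (a sign $(-1)^{ij}$ whenever a variable of parity $i$ passes through one of parity $j$); $\mathcal A$ satisfies the superidentity $\tilde f=0$ if and only if $\mathrm G(\mathcal A)$ satisfies $f=0$. For a variety $\mathcal V$, a $\mathcal V$-superalgebra is a superalgebra $\mathcal A$ with $\mathrm G(\mathcal A)\in\mathcal V$; $\tilde{\mathcal V}$ is the class of all $\mathcal V$-superalgebras. The supervariety generated by a superalgebra $\mathcal B$ is the class of all superalgebras satisfying every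 superidentity $\tilde f=0$ ($f$ multilinear) satisfied by $\mathcal B$. For nonnegative integers $(r,s)\ne(0,0)$, $\mathcal V_{r,s}$ is the supervariety generated by the free $\mathcal V$-superalgebra on $r$ even and $s$ odd generators; $\mathcal V_{0,0}=\{\{0\}\}$. A pair $(r,s)$ is a basic superrank of $\mathcal V$ if $\mathcal V_{r,s}=\tilde{\mathcal V}$ and $(r,s)$ is minimal with this property, i.e. $\mathcal V_{r',s'}\ne\tilde{\mathcal V}$ for every $(r',s')\neq(r,s)$ with $r'\leqslant r$, $s'\leqslant s$. The basic spectrum $\mathrm{sp}_b(\mathcal V)$ is the set of all (finite) basic superranks of $\mathcal V$. *)

theory Defs
  imports
    "HOL-Algebra.Algebraic_Closure_Type"
    "HOL-Algebra.AbelCoset"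
    "HOL-Algebra.QuotRing"
    "HOL-Library.Poly_Mapping"
    "HOL-Library.Z2"
begin

section \<open>Nonassociative algebras and superalgebras\<close>

text \<open>
  The scalars are a type of class \<^class>\<open>field\<close>. An algebra is a record of type
  \<^typ>\<open>('f, 'a) module\<close>; its field \<^const>\<open>one\<close> carries no meaning, since algebras
  need not be unital.
\<close>

locale nonassoc_algebra = module "ring_of_type_algebra :: 'f::field ring" A
  for A :: "('f::field, 'a, 'm) module_scheme" (structure) +
  assumes mult_closed:
      "\<lbrakk>x \<in> carrier A; y \<in> carrier A\<rbrakk> \<Longrightarrow> x \<otimes> y \<in> carrier A"
    and mult_add_left:
      "\<lbrakk>x \<in> carrier A; y \<in> carrier A; z \<in> carrier A\<rbrakk> \<Longrightarrow> (x \<oplus> y) \<otimes> z = x \<otimes> z \<oplus> y \<otimes> z"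
    and mult_add_right:
      "\<lbrakk>x \<in> carrier A; y \<in> carrier A; z \<in> carrier A\<rbrakk> \<Longrightarrow> x \<otimes> (y \<oplus> z) = x \<otimes> y \<oplus> x \<otimes> z"
    and mult_smult_left:
      "\<lbrakk>x \<in> carrier A; y \<in> carrier A\<rbrakk> \<Longrightarrow> (c \<odot> x) \<otimes> y = c \<odot> (x \<otimes> y)"
    and mult_smult_right:
      "\<lbrakk>x \<in> carrier A; y \<in> carrier A\<rbrakk> \<Longrightarrow> x \<otimes> (c \<odot> y) = c \<odot> (x \<otimes> y)"

text \<open>Parities are elements of the two-element field \<^typ>\<open>bit\<close>.\<close>

record ('f, 'a) superalgebra = "('f, 'a) module" +
  homog :: "bit \<Rightarrow> 'a set"

locale is_superalgebra = nonassoc_algebra A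
  for A :: "('f::field, 'a, 'm) superalgebra_scheme" (structure) +
  assumes homog_submodule: "submodule (homog A i) (ring_of_type_algebra :: 'f ring) A"
    and homog_sum: "carrier A = homog A 0 <+> homog A 1"
    and homog_Int: "homog A 0 \<inter> homog A 1 = {\<zero>}"
    and homog_mult: "\<lbrakk>x \<in> homog A i; y \<in> homog A j\<rbrakk> \<Longrightarrow> x \<otimes> y \<in> homog A (i + j)"

text \<open>
  The Grassmann algebra has the basis \<open>e\<^sub>S = e\<^bsub>s1\<^esub> \<cdots> e\<^bsub>sk\<^esub>\<close>, where
  \<open>S = {s1 < \<dots> < sk}\<close> ranges over the finite sets of naturals (\<open>e\<^bsub>{}\<^esub> = 1\<close>), with
  \<open>e\<^sub>S e\<^sub>T = \<plusminus> e\<^bsub>S \<union> T\<^esub>\<close> for disjoint \<open>S\<close>, \<open>T\<close>, and \<open>0\<close> otherwise.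
\<close>

definition grassmann_sign :: "nat set \<Rightarrow> nat set \<Rightarrow> 'f::field" where
  "grassmann_sign S T = (- 1) ^ card {(s, t). s \<in> S \<and> t \<in> T \<and> t < s}"

text \<open>
  An element \<open>\<Sum> e\<^sub>S \<otimes> a\<^sub>S\<close> of the Grassmann envelope is represented by its family of
  coordinates \<open>S \<mapsto> a\<^sub>S\<close>, where \<open>a\<^sub>S\<close> has the parity of \<open>e\<^sub>S\<close>.
\<close>

definition grassmann_envelope ::
  "('f::field, 'a, 'm) superalgebra_scheme \<Rightarrow> ('f, nat set \<Rightarrow> 'a) module" where
  "grassmann_envelope A = \<lparr>
     carrier = {u. finite {S. u S \<noteq> \<zero>\<^bsub>A\<^esub>} \<and> (\<forall>S. infinite S \<longrightarrow> u S = \<zero>\<^bsub>A\<^esub>) \<and>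
                   (\<forall>S. finite S \<longrightarrow> u S \<in> homog A (of_nat (card S)))},
     monoid.mult = (\<lambda>u v U. \<Oplus>\<^bsub>A\<^esub>S\<in>Pow U.
        grassmann_sign S (U - S) \<odot>\<^bsub>A\<^esub> (u S \<otimes>\<^bsub>A\<^esub> v (U - S))),
     monoid.one = (\<lambda>_. \<zero>\<^bsub>A\<^esub>),
     ring.zero = (\<lambda>_. \<zero>\<^bsub>A\<^esub>),
     add = (\<lambda>u v S. u S \<oplus>\<^bsub>A\<^esub> v S),
     module.smult = (\<lambda>c u S. c \<odot>\<^bsub>A\<^esub> u S)\<rparr>"

section \<open>Nonassociative polynomials, identities and varieties\<close>

datatype 'x nword = Letter 'x | Juxt "'x nword" "'x nword"

primrec letters :: "'x nword \<Rightarrow> 'x list" where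
  "letters (Letter x) = [x]"
| "letters (Juxt u v) = letters u @ letters v"

type_synonym ('x, 'f) npoly = "'x nword \<Rightarrow>\<^sub>0 'f"

definition npoly_var :: "'x \<Rightarrow> ('x, 'f::field) npoly" where
  "npoly_var x = Poly_Mapping.single (Letter x) 1"

definition npoly_mult :: "('x, 'f::field) npoly \<Rightarrow> ('x, 'f) npoly \<Rightarrow> ('x, 'f) npoly"
  (infixl \<open>\<star>\<close> 70) where
  "p \<star> q = (\<Sum>u\<in>Poly_Mapping.keys p. \<Sum>v\<in>Poly_Mapping.keys q.
     Poly_Mapping.single (Juxt u v) (Poly_Mapping.lookup p u * Poly_Mapping.lookup q v))"

primrec eval_nword :: "('a, 'm) monoid_scheme \<Rightarrow> ('x \<Rightarrow> 'a) \<Rightarrow> 'x nword \<Rightarrow> 'a" where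
  "eval_nword A \<rho> (Letter x) = \<rho> x"
| "eval_nword A \<rho> (Juxt u v) = eval_nword A \<rho> u \<otimes>\<^bsub>A\<^esub> eval_nword A \<rho> v"

definition eval_npoly ::
  "('f::field, 'a, 'm) module_scheme \<Rightarrow> ('x \<Rightarrow> 'a) \<Rightarrow> ('x, 'f) npoly \<Rightarrow> 'a" where
  "eval_npoly A \<rho> f = (\<Oplus>\<^bsub>A\<^esub>w\<in>Poly_Mapping.keys f.
     Poly_Mapping.lookup f w \<odot>\<^bsub>A\<^esub> eval_nword A \<rho> w)"

definition satisfies :: "('f::field, 'a, 'm) module_scheme \<Rightarrow> (nat, 'f) npoly \<Rightarrow> bool" where
  "satisfies A f \<longleftrightarrow> (\<forall>\<rho>. range \<rho> \<subseteq> carrier A \<longrightarrow> eval_npoly A \<rho> f = \<zero>\<^bsub>A\<^esub>)"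

text \<open>A variety is given by a set \<open>E\<close> of defining identities \<open>f = 0\<close>.\<close>

definition variety :: "(nat, 'f::field) npoly set \<Rightarrow> ('f, 'a) module set" where
  "variety E = {A. nonassoc_algebra A \<and> (\<forall>f\<in>E. satisfies A f)}"

definition associator ::
  "('x, 'f::field) npoly \<Rightarrow> ('x, 'f) npoly \<Rightarrow> ('x, 'f) npoly \<Rightarrow> ('x, 'f) npoly" where
  "associator p q r = (p \<star> q) \<star> r - p \<star> (q \<star> r)"

definition alt_metabelian :: "(nat, 'f::field) npoly set" where
  "alt_metabelian =
     {associator (npoly_var 0) (npoly_var 0) (npoly_var 1),
      associator (npoly_var 0) (npoly_var 1) (npoly_var 1),
      (npoly_var 0 \<star> npoly_var 1) \<star> (npoly_var 2 \<star> npoly_var 3)}"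

section \<open>Superidentities and supervarieties\<close>

definition multilinear :: "(nat, 'f::field) npoly \<Rightarrow> bool" where
  "multilinear f \<longleftrightarrow> (\<exists>n. \<forall>w\<in>Poly_Mapping.keys f.
     distinct (letters w) \<and> set (letters w) = {..<n})"

text \<open>
  The sign produced by sorting the variables of \<open>w\<close> into their natural order, when the
  variable \<open>x\<close> has parity \<open>\<pi> x\<close>: one factor \<open>-1\<close> for every inversion between odd variables.
\<close>

definition koszul_sign :: "(nat \<Rightarrow> bit) \<Rightarrow> nat nword \<Rightarrow> 'f::field" where
  "koszul_sign \<pi> w = (let xs = letters w in
     (- 1) ^ card {(i, j). i < j \<and> j < length xs \<and> xs ! j < xs ! i \<and>
                           \<pi> (xs ! i) = 1 \<and> \<pi> (xs ! j) = 1})"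

definition eval_superization ::
  "('f::field, 'a, 'm) superalgebra_scheme \<Rightarrow> (nat \<Rightarrow> bit) \<Rightarrow> (nat \<Rightarrow> 'a) \<Rightarrow> (nat, 'f) npoly \<Rightarrow> 'a"
  where
  "eval_superization A \<pi> \<rho> f = (\<Oplus>\<^bsub>A\<^esub>w\<in>Poly_Mapping.keys f.
     (koszul_sign \<pi> w * Poly_Mapping.lookup f w) \<odot>\<^bsub>A\<^esub> eval_nword A \<rho> w)"

text \<open>
  The superidentity associated with a multilinear \<open>f\<close> is required for all choices of
  parities of the variables, so that it corresponds to \<open>f = 0\<close> in the Grassmann envelope.
\<close>

definition super_satisfies ::
  "('f::field, 'a, 'm) superalgebra_scheme \<Rightarrow> (nat, 'f) npoly \<Rightarrow> bool" where
  "super_satisfies A f \<longleftrightarrow>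
     (\<forall>\<pi> \<rho>. (\<forall>x. \<rho> x \<in> homog A (\<pi> x)) \<longrightarrow> eval_superization A \<pi> \<rho> f = \<zero>\<^bsub>A\<^esub>)"

definition super_class :: "(nat, 'f::field) npoly set \<Rightarrow> ('f, 'a) superalgebra set" where
  "super_class E = {A. is_superalgebra A \<and> grassmann_envelope A \<in> variety E}"

text \<open>
  The generating superalgebra \<open>B\<close> and the members of the supervariety may have different
  underlying types.
\<close>

definition supervariety_generated_by ::
  "('f::field, 'b) superalgebra \<Rightarrow> ('f, 'a) superalgebra set" where
  "supervariety_generated_by B = {A. is_superalgebra A \<and>
     (\<forall>f. multilinear f \<and> super_satisfies B f \<longrightarrow> super_satisfies A f)}"

section \<open>Free superalgebras of a variety\<close>

text \<open>Even generators are tagged by \<^const>\<open>Inl\<close>, odd generators by \<^const>\<open>Inr\<close>.\<close>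

definition nword_parity :: "(nat + nat) nword \<Rightarrow> bit" where
  "nword_parity w = (\<Sum>x\<leftarrow>letters w. case x of Inl _ \<Rightarrow> 0 | Inr _ \<Rightarrow> 1)"

definition free_carrier :: "nat \<Rightarrow> nat \<Rightarrow> (nat + nat, 'f::field) npoly set" where
  "free_carrier r s =
     {p. \<forall>w\<in>Poly_Mapping.keys p. set (letters w) \<subseteq> Inl ` {..<r} \<union> Inr ` {..<s}}"

definition free_superalgebra ::
  "nat \<Rightarrow> nat \<Rightarrow> ('f::field, (nat + nat, 'f) npoly) superalgebra" where
  "free_superalgebra r s = \<lparr>
     carrier = free_carrier r s,
     monoid.mult = (\<star>),
     monoid.one = 0,
     ring.zero = 0,
     add = (+),
     module.smult = (\<lambda>c. Poly_Mapping.map ((*) c)),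
     homog = (\<lambda>i. {p \<in> free_carrier r s. \<forall>w\<in>Poly_Mapping.keys p. nword_parity w = i})\<rparr>"

locale graded_ideal = is_superalgebra A
  for I :: "'a set" and A :: "('f::field, 'a, 'm) superalgebra_scheme" (structure) +
  assumes ideal_submodule: "submodule I (ring_of_type_algebra :: 'f ring) A"
    and ideal_mult_left: "\<lbrakk>a \<in> carrier A; x \<in> I\<rbrakk> \<Longrightarrow> a \<otimes> x \<in> I"
    and ideal_mult_right: "\<lbrakk>a \<in> carrier A; x \<in> I\<rbrakk> \<Longrightarrow> x \<otimes> a \<in> I"
    and ideal_graded: "I = (I \<inter> homog A 0) <+> (I \<inter> homog A 1)"

definition super_quotient ::
  "('f::field, 'a) superalgebra \<Rightarrow> 'a set \<Rightarrow> ('f, 'a set) superalgebra" where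
  "super_quotient A I = \<lparr>
     carrier = a_rcosets\<^bsub>A\<^esub> I,
     monoid.mult = rcoset_mult A I,
     monoid.one = I,
     ring.zero = I,
     add = set_add A,
     module.smult = (\<lambda>c C. \<Union>x\<in>C. I +>\<^bsub>A\<^esub> (c \<odot>\<^bsub>A\<^esub> x)),
     homog = (\<lambda>i. (\<lambda>a. I +>\<^bsub>A\<^esub> a) ` homog A i)\<rparr>"

text \<open>
  The free superalgebra of the variety is the quotient of the free nonassociative
  superalgebra by the least graded ideal whose quotient belongs to the class.
\<close>

definition free_super_in ::
  "(nat, 'f::field) npoly set \<Rightarrow> nat \<Rightarrow> nat \<Rightarrow>
     ('f, (nat + nat, 'f) npoly set) superalgebra" where
  "free_super_in E r s = super_quotient (free_superalgebra r s)
     (\<Inter> {I. graded_ideal I (free_superalgebra r s) \<and>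
             super_quotient (free_superalgebra r s) I \<in> super_class E})"

section \<open>The basic spectrum\<close>

definition rank_supervariety ::
  "(nat, 'f::field) npoly set \<Rightarrow> nat \<Rightarrow> nat \<Rightarrow> ('f, 'a) superalgebra set" where
  "rank_supervariety E r s =
     (if (r, s) = (0, 0) then {A. is_superalgebra A \<and> carrier A = {\<zero>\<^bsub>A\<^esub>}}
      else supervariety_generated_by (free_super_in E r s))"

text \<open>
  A class of superalgebras consists of superalgebras whose carriers are subsets of a fixed
  type \<^typ>\<open>'a\<close>, which is passed explicitly. If \<^typ>\<open>'a\<close> is at least as large as the field
  (which is infinite in characteristic \<open>0\<close>), it contains a copy of every countably generated
  superalgebra. As supervarieties are determined by their countably generated members, the
  equations between them below then do not depend on the choice of \<^typ>\<open>'a\<close>.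
\<close>

definition basic_superrank ::
  "'a itself \<Rightarrow> (nat, 'f::field) npoly set \<Rightarrow> nat \<Rightarrow> nat \<Rightarrow> bool" where
  "basic_superrank U E r s \<longleftrightarrow>
     rank_supervariety E r s = (super_class E :: ('f, 'a) superalgebra set) \<and>
     (\<forall>r' s'. (r', s') \<noteq> (r, s) \<and> r' \<le> r \<and> s' \<le> s \<longrightarrow>
        rank_supervariety E r' s' \<noteq> (super_class E :: ('f, 'a) superalgebra set))"

definition basic_spectrum ::
  "'a itself \<Rightarrow> (nat, 'f::field) npoly set \<Rightarrow> (nat \<times> nat) set" where
  "basic_spectrum U E = {(r, s). basic_superrank U E r s}"

end

theory Submission
  imports Defs "HOL-Library.Product_Plus"
begin

text \<open>A multilinear \<open>f\<close> holds in the Grassmann envelope of a superalgebra exactly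
  when its superization holds in the superalgebra itself (\<open>satisfies_envelope_iff\<close>), so
  the whole question is about multilinear superidentities. For \<open>(r, s)\<close> to generate the
  full supervariety it suffices that every multilinear superidentity of the free superalgebra on
  \<open>r\<close> even and \<open>s\<close> odd generators lies in the T-ideal
  \<open>alt_ideal\<close> (\<open>rank_supervariety_eqI\<close>). Such a superidentity vanishes
  whenever its variables are replaced by homogeneous images of the generators in a model from the
  class (\<open>free_alt_universal\<close>), so the task is to find models in which few elements
  detect everything. Conversely, a pair is excluded by a superidentity of its free superalgebra that
  fails in some model.

  Positive part. On the square of an alternative metabelian algebra right multiplications
  anticommute, two left multiplications equal minus two right ones, and a left multiplication can be
  moved inwards past right ones. Moreover cubes annihilate the algebra. Hence for
  \<open>n \<ge> 4\<close> the multilinear part of degree \<open>n\<close> of the relatively free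
  algebra is spanned by \<open>2 n\<close> elements, two for each variable \<open>m\<close>, both
  skew-symmetric in the variables other than \<open>m\<close> (\<open>normal_form\<close>). Put an
  element \<open>y\<close> for the variable \<open>k\<close> and one odd element \<open>x\<close>
  with \<open>x x = 0\<close> for all the others: only the two elements belonging to
  \<open>k\<close> survive, and in the five-dimensional superalgebra \<open>bimod_algebra\<close>
  their values are linearly independent (\<open>probe_detects_high_degree\<close>). Here
  \<open>y\<close> may be even or odd, so one even and one odd generator, or two odd ones, settle
  all degrees except 3; degrees below 3 are immediate.

  In degree 3 these probes leave one linear condition open, that the coefficients sum to zero
  (\<open>probe_detects_degree_3\<close>). This is the part of \<open>f\<close> carried by the
  symmetrized cube, which dies as soon as it is multiplied by anything. Strictly upper triangular 4
  by 4 matrices see it: either at \<open>(t, t, t)\<close> for a single even \<open>t\<close> with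
  nonzero cube, or at three odd elements in the positions 12, 23, 34. This gives
  \<open>(1, 1)\<close> and \<open>(0, 3)\<close>.

  Negative part. On \<open>r\<close> even generators a left-normed product of \<open>r + 3\<close>
  factors is zero: \<open>r + 1\<close> anticommuting right multiplications by \<open>r\<close>
  generators must repeat one of them (\<open>rprod_nilpotent\<close>). But
  \<open>bimod_algebra\<close> is not nilpotent. On at most two odd generators the superized
  symmetrized cube is zero: on generators it is skew-symmetric and two arguments coincide, and it
  vanishes if an argument is a product (\<open>polar_cube_square\<close>). But on triangular
  matrices its value at \<open>(t, t, t)\<close> is six times the cube of \<open>t\<close>. What
  remains are the pairs above \<open>(1, 1)\<close> or \<open>(0, 3)\<close>.\<close>

lemma ring_of_type_algebra_sel [simp]:
  "carrier (ring_of_type_algebra :: 'f::field ring) = UNIV"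
  "add (ring_of_type_algebra :: 'f ring) = (+)"
  "monoid.mult (ring_of_type_algebra :: 'f ring) = (*)"
  "ring.zero (ring_of_type_algebra :: 'f ring) = 0"
  "monoid.one (ring_of_type_algebra :: 'f ring) = 1"
  by (simp_all add: ring_of_type_algebra_def)

section \<open>Arithmetic of nonassociative polynomials\<close>

abbreviation nscale :: "'f::field \<Rightarrow> ('x, 'f) npoly \<Rightarrow> ('x, 'f) npoly" where
  "nscale c \<equiv> Poly_Mapping.map ((*) c)"

lemma lookup_nscale [simp]: "Poly_Mapping.lookup (nscale c p) w = c * Poly_Mapping.lookup p w"
  by (simp add: Poly_Mapping.map.rep_eq when_def)

lemma keys_nscale: "Poly_Mapping.keys (nscale c p) \<subseteq> Poly_Mapping.keys p"
  by (auto simp: in_keys_iff)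

text \<open>Summing over fixed finite supersets of the supports puts several products over the same
  index sets, so that bilinearity becomes a termwise statement.\<close>

lemma npoly_mult_superset:
  assumes "finite U" "finite V" "Poly_Mapping.keys p \<subseteq> U" "Poly_Mapping.keys q \<subseteq> V"
  shows "p \<star> q = (\<Sum>u\<in>U. \<Sum>v\<in>V.
    Poly_Mapping.single (Juxt u v) (Poly_Mapping.lookup p u * Poly_Mapping.lookup q v))"
proof -
  have "p \<star> q = (\<Sum>u\<in>Poly_Mapping.keys p. \<Sum>v\<in>V.
    Poly_Mapping.single (Juxt u v) (Poly_Mapping.lookup p u * Poly_Mapping.lookup q v))"
    unfolding npoly_mult_def using assms
    by (intro sum.cong[OF refl] sum.mono_neutral_left) (auto simp: in_keys_iff)
  also have "\<dots> = (\<Sum>u\<in>U. \<Sum>v\<in>V.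
    Poly_Mapping.single (Juxt u v) (Poly_Mapping.lookup p u * Poly_Mapping.lookup q v))"
    using assms by (intro sum.mono_neutral_left) (auto simp: in_keys_iff)
  finally show ?thesis .
qed

lemma npoly_mult_add_left: "(p + q) \<star> r = p \<star> r + q \<star> r"
proof -
  let ?U = "Poly_Mapping.keys p \<union> Poly_Mapping.keys q"
  have "Poly_Mapping.keys (p + q) \<subseteq> ?U" by (rule Poly_Mapping.keys_add)
  then show ?thesis
    by (subst (1 2 3) npoly_mult_superset[where U="?U" and V="Poly_Mapping.keys r"])
      (auto simp: sum.distrib lookup_add distrib_right single_add)
qed

lemma npoly_mult_add_right: "r \<star> (p + q) = r \<star> p + r \<star> q"
proof -
  let ?U = "Poly_Mapping.keys p \<union> Poly_Mapping.keys q"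
  have "Poly_Mapping.keys (p + q) \<subseteq> ?U" by (rule Poly_Mapping.keys_add)
  then show ?thesis
    by (subst (1 2 3) npoly_mult_superset[where V="?U" and U="Poly_Mapping.keys r"])
      (auto simp: sum.distrib lookup_add distrib_left single_add)
qed

lemma nscale_add: "nscale c (p + q) = nscale c p + nscale c q"
  by (rule poly_mapping_eqI) (simp add: lookup_add distrib_left)

lemma nscale_single [simp]: "nscale c (Poly_Mapping.single w b) = Poly_Mapping.single w (c * b)"
  by (rule poly_mapping_eqI) (simp add: lookup_single when_def)

lemma nscale_sum: "nscale c (\<Sum>i\<in>I. f i) = (\<Sum>i\<in>I. nscale c (f i))"
  by (rule poly_mapping_eqI) (simp add: lookup_sum sum_distrib_left)

lemma npoly_mult_scale_left: "nscale c p \<star> q = nscale c (p \<star> q)"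
  by (subst (1 2) npoly_mult_superset[where U="Poly_Mapping.keys p" and V="Poly_Mapping.keys q"])
    (auto simp: nscale_sum mult.assoc keys_nscale)

lemma npoly_mult_scale_right: "p \<star> nscale c q = nscale c (p \<star> q)"
  by (subst (1 2) npoly_mult_superset[where U="Poly_Mapping.keys p" and V="Poly_Mapping.keys q"])
    (auto simp: nscale_sum mult_ac keys_nscale)

lemma npoly_mult_zero [simp]: "0 \<star> p = 0" "p \<star> 0 = 0"
  by (simp_all add: npoly_mult_def)

lemma npoly_mult_single:
  "Poly_Mapping.single u a \<star> Poly_Mapping.single v b = Poly_Mapping.single (Juxt u v) (a * b)"
  by (subst npoly_mult_superset[where U="{u}" and V="{v}"]) auto

lemma nscale_simps [simp]:
  "nscale 1 p = p" "nscale 0 p = 0" "nscale c 0 = 0"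
  "nscale a (nscale b p) = nscale (a * b) p"
  by (rule poly_mapping_eqI; simp add: mult.assoc)+

lemma nscale_minus_one: "nscale (-1) p = - p"
  by (rule poly_mapping_eqI) simp

lemma nscale_add_left: "nscale (a + b) p = nscale a p + nscale b p"
  by (rule poly_mapping_eqI) (simp add: lookup_add distrib_right)

lemma npoly_mult_minus_left: "(- p) \<star> q = - (p \<star> q)"
  using npoly_mult_scale_left[of "-1" p q] by (simp add: nscale_minus_one)

lemma npoly_mult_minus_right: "p \<star> (- q) = - (p \<star> q)"
  using npoly_mult_scale_right[of p "-1" q] by (simp add: nscale_minus_one)

lemma npoly_mult_diff_left: "(p - q) \<star> r = p \<star> r - q \<star> r"
  using npoly_mult_add_left[of p "- q" r] by (simp add: npoly_mult_minus_left)

lemma npoly_mult_diff_right: "r \<star> (p - q) = r \<star> p - r \<star> q"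
  using npoly_mult_add_right[of r p "- q"] by (simp add: npoly_mult_minus_right)

lemma npoly_expand:
  "p = (\<Sum>w\<in>Poly_Mapping.keys p. Poly_Mapping.single w (Poly_Mapping.lookup p w))"
  by (rule poly_mapping_eqI) (simp add: lookup_sum lookup_single when_def in_keys_iff)

section \<open>Linear algebra and evaluation of polynomials in an algebra\<close>

context nonassoc_algebra
begin

lemma scale_closed [simp, intro]: "x \<in> carrier A \<Longrightarrow> c \<odot> x \<in> carrier A"
  using smult_closed[of c x] by simp

lemma scale_add_left: "x \<in> carrier A \<Longrightarrow> (a + b) \<odot> x = a \<odot> x \<oplus> b \<odot> x"
  using smult_l_distr[of a b x] by simp

lemma scale_add_right:
  "\<lbrakk>x \<in> carrier A; y \<in> carrier A\<rbrakk> \<Longrightarrow> c \<odot> (x \<oplus> y) = c \<odot> x \<oplus> c \<odot> y"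
  using smult_r_distr[of c x y] by simp

lemma scale_scale: "x \<in> carrier A \<Longrightarrow> a \<odot> (b \<odot> x) = (a * b) \<odot> x"
  using smult_assoc1[of a b x] by simp

lemma scale_one [simp]: "x \<in> carrier A \<Longrightarrow> 1 \<odot> x = x"
  using smult_one[of x] by simp

lemma scale_zero_left [simp]: "x \<in> carrier A \<Longrightarrow> 0 \<odot> x = \<zero>"
  using smult_l_null[of x] by simp

lemma scale_zero_right [simp]: "c \<odot> \<zero> = \<zero>"
  using smult_r_null[of c] by simp

lemma scale_minus_one: "x \<in> carrier A \<Longrightarrow> (-1) \<odot> x = \<ominus> x"
proof -
  assume x: "x \<in> carrier A"
  have "(-1) \<odot> x \<oplus> x = (-1 + 1) \<odot> x"
    using x by (simp only: scale_add_left scale_one)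
  then show ?thesis using x by (simp add: M.minus_equality)
qed

lemma scale_minus_left: "x \<in> carrier A \<Longrightarrow> (- c) \<odot> x = \<ominus> (c \<odot> x)"
  using scale_scale[of x "-1" c] scale_minus_one[of "c \<odot> x"] by simp

lemma scale_cancel:
  assumes "c \<odot> x = \<zero>" "c \<noteq> 0" "x \<in> carrier A" shows "x = \<zero>"
proof -
  have "x = inverse c \<odot> (c \<odot> x)" using assms(2,3) by (simp add: scale_scale)
  then show ?thesis using assms(1) by simp
qed

lemma mult_zero_left [simp]: "x \<in> carrier A \<Longrightarrow> \<zero> \<otimes> x = \<zero>"
  using mult_smult_left[of \<zero> x 0] mult_closed by simp

lemma mult_zero_right [simp]: "x \<in> carrier A \<Longrightarrow> x \<otimes> \<zero> = \<zero>"
  using mult_smult_right[of x \<zero> 0] mult_closed by simp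

declare mult_closed [simp, intro]

lemma finsum_scale:
  assumes "f \<in> I \<rightarrow> carrier A"
  shows "c \<odot> (\<Oplus>i\<in>I. f i) = (\<Oplus>i\<in>I. c \<odot> f i)"
  using assms
proof (induction I rule: infinite_finite_induct)
  case (insert x F)
  then show ?case by (subst (1 2) M.finsum_insert) (auto simp: scale_add_right)
qed (auto simp: M.finsum_infinite)

lemma finsum_mult_left:
  assumes "f \<in> I \<rightarrow> carrier A" "y \<in> carrier A"
  shows "(\<Oplus>i\<in>I. f i) \<otimes> y = (\<Oplus>i\<in>I. f i \<otimes> y)"
  using assms
proof (induction I rule: infinite_finite_induct)
  case (insert x F)
  then show ?case by (subst (1 2) M.finsum_insert) (auto simp: mult_add_left)
qed (auto simp: M.finsum_infinite)

lemma finsum_mult_right: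
  assumes "f \<in> I \<rightarrow> carrier A" "y \<in> carrier A"
  shows "y \<otimes> (\<Oplus>i\<in>I. f i) = (\<Oplus>i\<in>I. y \<otimes> f i)"
  using assms
proof (induction I rule: infinite_finite_induct)
  case (insert x F)
  then show ?case by (subst (1 2) M.finsum_insert) (auto simp: mult_add_right)
qed (auto simp: M.finsum_infinite)

lemma eval_nword_closed [simp, intro]:
  "range \<rho> \<subseteq> carrier A \<Longrightarrow> eval_nword A \<rho> w \<in> carrier A"
  by (induction w) auto

lemma eval_npoly_superset:
  assumes "range \<rho> \<subseteq> carrier A" "finite K" "Poly_Mapping.keys f \<subseteq> K"
  shows "eval_npoly A \<rho> f = (\<Oplus>w\<in>K. Poly_Mapping.lookup f w \<odot> eval_nword A \<rho> w)"
  unfolding eval_npoly_def using assms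
  by (intro M.add.finprod_mono_neutral_cong_left) (auto simp: in_keys_iff)

lemma eval_npoly_closed [simp, intro]:
  "range \<rho> \<subseteq> carrier A \<Longrightarrow> eval_npoly A \<rho> f \<in> carrier A"
  unfolding eval_npoly_def by (intro M.finsum_closed) auto

lemma eval_npoly_zero [simp]: "eval_npoly A \<rho> 0 = \<zero>"
  by (simp add: eval_npoly_def)

lemma eval_npoly_add:
  assumes "range \<rho> \<subseteq> carrier A"
  shows "eval_npoly A \<rho> (p + q) = eval_npoly A \<rho> p \<oplus> eval_npoly A \<rho> q"
proof -
  let ?U = "Poly_Mapping.keys p \<union> Poly_Mapping.keys q"
  have "Poly_Mapping.keys (p + q) \<subseteq> ?U" by (rule Poly_Mapping.keys_add)
  then show ?thesis using assms
    by (subst (1 2 3) eval_npoly_superset[where K="?U"])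
      (auto simp: lookup_add scale_add_left intro!: M.finsum_addf)
qed

lemma eval_npoly_scale:
  assumes "range \<rho> \<subseteq> carrier A"
  shows "eval_npoly A \<rho> (nscale c p) = c \<odot> eval_npoly A \<rho> p"
proof -
  have "c \<odot> eval_npoly A \<rho> p = (\<Oplus>w\<in>Poly_Mapping.keys p. c \<odot> (Poly_Mapping.lookup p w \<odot> eval_nword A \<rho> w))"
    unfolding eval_npoly_def using assms by (intro finsum_scale) auto
  also have "\<dots> = eval_npoly A \<rho> (nscale c p)" using assms
    by (subst eval_npoly_superset[where K="Poly_Mapping.keys p"])
      (auto simp: keys_nscale scale_scale intro!: M.finsum_cong')
  finally show ?thesis by simp
qed

lemma eval_npoly_minus:
  "range \<rho> \<subseteq> carrier A \<Longrightarrow> eval_npoly A \<rho> (- p) = \<ominus> eval_npoly A \<rho> p"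
  using eval_npoly_scale[of \<rho> "-1" p] by (simp add: nscale_minus_one scale_minus_one)

lemma eval_npoly_diff:
  "range \<rho> \<subseteq> carrier A \<Longrightarrow> eval_npoly A \<rho> (p - q) = eval_npoly A \<rho> p \<ominus> eval_npoly A \<rho> q"
  using eval_npoly_add[of \<rho> p "- q"] by (simp add: eval_npoly_minus a_minus_def)

lemma eval_npoly_single [simp]:
  "range \<rho> \<subseteq> carrier A \<Longrightarrow> eval_npoly A \<rho> (Poly_Mapping.single w c) = c \<odot> eval_nword A \<rho> w"
  by (subst eval_npoly_superset[where K="{w}"]) (auto simp: M.finsum_insert[of "{}", simplified])

lemma eval_npoly_sum:
  assumes "range \<rho> \<subseteq> carrier A"
  shows "eval_npoly A \<rho> (\<Sum>i\<in>I. f i) = (\<Oplus>i\<in>I. eval_npoly A \<rho> (f i))"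
proof (induction I rule: infinite_finite_induct)
  case (insert x F)
  then show ?case using assms by (subst M.finsum_insert) (auto simp: eval_npoly_add)
qed (auto simp: M.finsum_infinite)

lemma eval_npoly_var [simp]:
  "range \<rho> \<subseteq> carrier A \<Longrightarrow> eval_npoly A \<rho> (npoly_var x) = \<rho> x"
  by (simp add: npoly_var_def range_subsetD)

lemma eval_npoly_mult:
  assumes \<rho>: "range \<rho> \<subseteq> carrier A"
  shows "eval_npoly A \<rho> (p \<star> q) = eval_npoly A \<rho> p \<otimes> eval_npoly A \<rho> q"
proof -
  let ?P = "Poly_Mapping.keys p" and ?Q = "Poly_Mapping.keys q"
  let ?c = "Poly_Mapping.lookup p" and ?d = "Poly_Mapping.lookup q" and ?e = "eval_nword A \<rho>"
  have "eval_npoly A \<rho> (p \<star> q) = (\<Oplus>u\<in>?P. \<Oplus>v\<in>?Q. (?c u * ?d v) \<odot> (?e u \<otimes> ?e v))"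
    unfolding npoly_mult_def using \<rho> by (simp add: eval_npoly_sum)
  also have "\<dots> = (\<Oplus>u\<in>?P. (?c u \<odot> ?e u) \<otimes> eval_npoly A \<rho> q)"
  proof (intro M.finsum_cong' refl funcsetI)
    fix u assume "u \<in> ?P"
    show "(\<Oplus>v\<in>?Q. (?c u * ?d v) \<odot> (?e u \<otimes> ?e v)) = (?c u \<odot> ?e u) \<otimes> eval_npoly A \<rho> q"
      unfolding eval_npoly_def using \<rho>
      by (subst finsum_mult_right)
        (auto simp: mult_smult_left mult_smult_right scale_scale mult.commute intro!: M.finsum_cong')
  qed (use \<rho> in auto)
  also have "\<dots> = eval_npoly A \<rho> p \<otimes> eval_npoly A \<rho> q"
    using \<rho> unfolding eval_npoly_def[of _ _ p] by (subst finsum_mult_left) auto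
  finally show ?thesis .
qed

end

section \<open>Multilinear polynomials\<close>

definition multilinear_in :: "nat \<Rightarrow> (nat, 'f::field) npoly \<Rightarrow> bool" where
  "multilinear_in n f \<longleftrightarrow> (\<forall>w\<in>Poly_Mapping.keys f.
     distinct (letters w) \<and> set (letters w) = {..<n})"

lemma multilinear_iff: "multilinear f \<longleftrightarrow> (\<exists>n. multilinear_in n f)"
  by (simp add: multilinear_def multilinear_in_def)

text \<open>Superization for fixed parities as an ordinary polynomial, so that evaluating a
  superization is plain evaluation and inherits all its linearity. Koszul signs are units, hence the
  support does not change.\<close>

definition sign_twist :: "(nat \<Rightarrow> bit) \<Rightarrow> (nat, 'f::field) npoly \<Rightarrow> (nat, 'f) npoly" where
  "sign_twist \<pi> f = Poly_Mapping.mapp (\<lambda>w c. koszul_sign \<pi> w * c) f"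

lemma koszul_sign_nonzero [simp]: "koszul_sign \<pi> w \<noteq> (0 :: 'f::field)"
  by (simp add: koszul_sign_def Let_def)

lemma lookup_sign_twist [simp]:
  "Poly_Mapping.lookup (sign_twist \<pi> f) w = koszul_sign \<pi> w * Poly_Mapping.lookup f w"
  by (simp add: sign_twist_def lookup_mapp when_def in_keys_iff)

lemma keys_sign_twist [simp]: "Poly_Mapping.keys (sign_twist \<pi> f) = Poly_Mapping.keys f"
  by (auto simp: in_keys_iff)

lemma eval_superization_eq: "eval_superization A \<pi> \<rho> f = eval_npoly A \<rho> (sign_twist \<pi> f)"
  by (simp add: eval_superization_def eval_npoly_def)

lemma sign_twist_add: "sign_twist \<pi> (p + q) = sign_twist \<pi> p + sign_twist \<pi> q"
  by (rule poly_mapping_eqI) (simp add: lookup_add distrib_left)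

lemma sign_twist_diff: "sign_twist \<pi> (p - q) = sign_twist \<pi> p - sign_twist \<pi> q"
  by (rule poly_mapping_eqI) (simp add: lookup_minus right_diff_distrib)

lemma sign_twist_scale: "sign_twist \<pi> (nscale c p) = nscale c (sign_twist \<pi> p)"
  by (rule poly_mapping_eqI) (simp add: mult_ac)

lemma sign_twist_single [simp]:
  "sign_twist \<pi> (Poly_Mapping.single w c) = Poly_Mapping.single w (koszul_sign \<pi> w * c)"
  by (rule poly_mapping_eqI) (simp add: lookup_single when_def)

lemma eval_nword_cong:
  "(\<And>x. x \<in> set (letters w) \<Longrightarrow> \<rho> x = \<sigma> x) \<Longrightarrow> eval_nword A \<rho> w = eval_nword A \<sigma> w"
  by (induction w) auto

section \<open>Multilinear identities on spanning sets\<close>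

context nonassoc_algebra
begin

inductive_set lspan :: "'a set \<Rightarrow> 'a set" for G :: "'a set" where
  lspan_zero: "\<zero> \<in> lspan G"
| lspan_base: "x \<in> G \<Longrightarrow> x \<in> lspan G"
| lspan_add: "\<lbrakk>x \<in> lspan G; y \<in> lspan G\<rbrakk> \<Longrightarrow> x \<oplus> y \<in> lspan G"
| lspan_scale: "x \<in> lspan G \<Longrightarrow> c \<odot> x \<in> lspan G"

lemma lspan_closed: "G \<subseteq> carrier A \<Longrightarrow> x \<in> lspan G \<Longrightarrow> x \<in> carrier A"
  by (rotate_tac, induction rule: lspan.induct) auto

lemma range_upd [simp]:
  "\<lbrakk>range \<rho> \<subseteq> carrier A; a \<in> carrier A\<rbrakk> \<Longrightarrow> range (\<rho>(i := a)) \<subseteq> carrier A"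
  by auto

lemma eval_nword_upd_add:
  assumes "range \<rho> \<subseteq> carrier A" "a \<in> carrier A" "b \<in> carrier A"
    "distinct (letters w)" "i \<in> set (letters w)"
  shows "eval_nword A (\<rho>(i := a \<oplus> b)) w = eval_nword A (\<rho>(i := a)) w \<oplus> eval_nword A (\<rho>(i := b)) w"
  using assms(4,5)
proof (induction w)
  case (Juxt u v)
  have cong: "eval_nword A (\<rho>(i := c)) t = eval_nword A \<rho> t" if "i \<notin> set (letters t)" for c t
    by (rule eval_nword_cong) (use that in auto)
  have clo: "eval_nword A (\<rho>(i := c)) t \<in> carrier A" if "c \<in> carrier A" for c t
    using assms that by (intro eval_nword_closed range_upd)
  have "i \<in> set (letters u) \<Longrightarrow> i \<notin> set (letters v)" using Juxt.prems by auto
  with Juxt show ?case using assms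
    by (cases "i \<in> set (letters u)") (auto simp: cong clo mult_add_left mult_add_right simp del: fun_upd_apply)
qed simp

lemma eval_nword_upd_scale:
  assumes "range \<rho> \<subseteq> carrier A" "a \<in> carrier A"
    "distinct (letters w)" "i \<in> set (letters w)"
  shows "eval_nword A (\<rho>(i := c \<odot> a)) w = c \<odot> eval_nword A (\<rho>(i := a)) w"
  using assms(3,4)
proof (induction w)
  case (Juxt u v)
  have cong: "eval_nword A (\<rho>(i := c)) t = eval_nword A \<rho> t" if "i \<notin> set (letters t)" for c t
    by (rule eval_nword_cong) (use that in auto)
  have clo: "eval_nword A (\<rho>(i := c)) t \<in> carrier A" if "c \<in> carrier A" for c t
    using assms that by (intro eval_nword_closed range_upd)
  have "i \<in> set (letters u) \<Longrightarrow> i \<notin> set (letters v)" using Juxt.prems by auto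
  with Juxt show ?case using assms
    by (cases "i \<in> set (letters u)") (auto simp: cong clo mult_smult_left mult_smult_right simp del: fun_upd_apply)
qed simp

lemma eval_npoly_upd_add:
  assumes "range \<rho> \<subseteq> carrier A" "a \<in> carrier A" "b \<in> carrier A" "multilinear_in n f" "i < n"
  shows "eval_npoly A (\<rho>(i := a \<oplus> b)) f = eval_npoly A (\<rho>(i := a)) f \<oplus> eval_npoly A (\<rho>(i := b)) f"
proof -
  have clo: "eval_nword A (\<rho>(i := c)) t \<in> carrier A" if "c \<in> carrier A" for c t
    using assms that by (intro eval_nword_closed range_upd)
  have "eval_npoly A (\<rho>(i := a \<oplus> b)) f = (\<Oplus>w\<in>Poly_Mapping.keys f.
    Poly_Mapping.lookup f w \<odot> eval_nword A (\<rho>(i := a)) w \<oplus> Poly_Mapping.lookup f w \<odot> eval_nword A (\<rho>(i := b)) w)"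
    unfolding eval_npoly_def
    by (intro M.finsum_cong' refl funcsetI)
      (use assms clo in \<open>auto simp: multilinear_in_def eval_nword_upd_add scale_add_right\<close>)
  then show ?thesis unfolding eval_npoly_def using assms clo by (subst (asm) M.finsum_addf) auto
qed

lemma eval_npoly_upd_scale:
  assumes "range \<rho> \<subseteq> carrier A" "a \<in> carrier A" "multilinear_in n f" "i < n"
  shows "eval_npoly A (\<rho>(i := c \<odot> a)) f = c \<odot> eval_npoly A (\<rho>(i := a)) f"
proof -
  have clo: "eval_nword A (\<rho>(i := c)) t \<in> carrier A" if "c \<in> carrier A" for c t
    using assms that by (intro eval_nword_closed range_upd)
  have "eval_npoly A (\<rho>(i := c \<odot> a)) f = (\<Oplus>w\<in>Poly_Mapping.keys f.
    c \<odot> (Poly_Mapping.lookup f w \<odot> eval_nword A (\<rho>(i := a)) w))"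
    unfolding eval_npoly_def
    by (intro M.finsum_cong' refl funcsetI)
      (use assms clo in \<open>auto simp: multilinear_in_def eval_nword_upd_scale scale_scale mult.commute\<close>)
  then show ?thesis unfolding eval_npoly_def using assms clo by (subst finsum_scale) auto
qed

lemma eval_npoly_zero_arg:
  assumes "range \<rho> \<subseteq> carrier A" "multilinear_in n f" "i < n" "\<rho> i = \<zero>"
  shows "eval_npoly A \<rho> f = \<zero>"
proof -
  have "eval_npoly A (\<rho>(i := 0 \<odot> \<zero>)) f = 0 \<odot> eval_npoly A (\<rho>(i := \<zero>)) f"
    using assms by (intro eval_npoly_upd_scale) auto
  moreover have "\<rho>(i := \<zero>) = \<rho>" using assms by auto
  ultimately show ?thesis using assms by simp
qed

text \<open>A multilinear function is determined by its values on spanning sets. Each variable has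
  its own spanning set.\<close>

lemma multilinear_vanish_on_span:
  assumes f: "multilinear_in n f" and G: "\<And>i. G i \<subseteq> carrier A"
    and van: "\<And>\<sigma>. range \<sigma> \<subseteq> carrier A \<Longrightarrow> (\<And>i. i < n \<Longrightarrow> \<sigma> i \<in> G i) \<Longrightarrow> eval_npoly A \<sigma> f = \<zero>"
    and \<rho>: "range \<rho> \<subseteq> carrier A" "\<And>i. i < n \<Longrightarrow> \<rho> i \<in> lspan (G i)"
  shows "eval_npoly A \<rho> f = \<zero>"
proof -
  \<comment> \<open>Here \<open>k\<close> counts the variables already released from
    \<open>G\<close> to its span; they are released one at a time, each step being an induction over
    \<open>lspan\<close>.\<close>
  have "eval_npoly A \<sigma> f = \<zero>"
    if "k \<le> n" "range \<sigma> \<subseteq> carrier A" "\<And>i. i < k \<Longrightarrow> \<sigma> i \<in> lspan (G i)"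
      "\<And>i. k \<le> i \<Longrightarrow> i < n \<Longrightarrow> \<sigma> i \<in> G i" for k \<sigma>
    using that
  proof (induction k arbitrary: \<sigma>)
    case 0
    then show ?case using van by simp
  next
    case (Suc k)
    have base: "eval_npoly A (\<sigma>(k := v)) f = \<zero>" if "v \<in> G k" for v
      using that Suc.prems G[of k] by (intro Suc.IH range_upd) auto
    have "eval_npoly A (\<sigma>(k := v)) f = \<zero>" if "v \<in> lspan (G k)" for v
      using that
    proof (induction rule: lspan.induct)
      case lspan_zero
      show ?case using Suc.prems f by (intro eval_npoly_zero_arg[of _ n _ k] range_upd) auto
    next
      case (lspan_add x y)
      have "x \<in> carrier A" "y \<in> carrier A" using lspan_add lspan_closed[OF G] by auto
      then show ?case using lspan_add Suc.prems f
        by (subst eval_npoly_upd_add[of _ _ _ n]) (auto simp del: fun_upd_apply)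
    next
      case (lspan_scale x c)
      have "x \<in> carrier A" using lspan_scale lspan_closed[OF G] by auto
      then show ?case using lspan_scale Suc.prems f
        by (subst eval_npoly_upd_scale[of _ _ n]) (auto simp del: fun_upd_apply)
    qed (rule base)
    from this[of "\<sigma> k"] show ?case using Suc.prems by simp
  qed
  from this[of n \<rho>] show ?thesis using \<rho> by simp
qed

end

section \<open>The ideal of identities of alternative metabelian algebras\<close>

text \<open>The T-ideal of the variety. The first three rules range over arbitrary polynomials, so
  substitution is built into the generators and only the ideal operations have to be closed
  off.\<close>

inductive_set alt_ideal :: "(nat, 'f::field) npoly set" where
  alt_left: "associator a a b \<in> alt_ideal"
| alt_right: "associator a b b \<in> alt_ideal"
| alt_metab: "(a \<star> b) \<star> (c \<star> d) \<in> alt_ideal"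
| alt_zero: "0 \<in> alt_ideal"
| alt_add: "p \<in> alt_ideal \<Longrightarrow> q \<in> alt_ideal \<Longrightarrow> p + q \<in> alt_ideal"
| alt_scale: "p \<in> alt_ideal \<Longrightarrow> nscale c p \<in> alt_ideal"
| alt_mult_left: "p \<in> alt_ideal \<Longrightarrow> q \<star> p \<in> alt_ideal"
| alt_mult_right: "p \<in> alt_ideal \<Longrightarrow> p \<star> q \<in> alt_ideal"

lemma alt_minus: "p \<in> alt_ideal \<Longrightarrow> - p \<in> alt_ideal"
  using alt_scale[of p "-1"] by (simp add: nscale_minus_one)

lemma alt_diff: "p \<in> alt_ideal \<Longrightarrow> q \<in> alt_ideal \<Longrightarrow> p - q \<in> alt_ideal"
  using alt_add[of p "- q"] alt_minus[of q] by simp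

context nonassoc_algebra
begin

definition assoc where "assoc x y z = (x \<otimes> y) \<otimes> z \<ominus> x \<otimes> (y \<otimes> z)"

lemma eval_associator:
  "range \<rho> \<subseteq> carrier A \<Longrightarrow> eval_npoly A \<rho> (associator p q r) =
     assoc (eval_npoly A \<rho> p) (eval_npoly A \<rho> q) (eval_npoly A \<rho> r)"
  by (simp add: associator_def assoc_def eval_npoly_diff eval_npoly_mult)

lemma variety_alt_metabelian_iff:
  "satisfies A (associator (npoly_var 0) (npoly_var 0) (npoly_var 1)) \<longleftrightarrow>
     (\<forall>x\<in>carrier A. \<forall>y\<in>carrier A. assoc x x y = \<zero>)"
  "satisfies A (associator (npoly_var 0) (npoly_var 1) (npoly_var 1)) \<longleftrightarrow>
     (\<forall>x\<in>carrier A. \<forall>y\<in>carrier A. assoc x y y = \<zero>)"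
  "satisfies A ((npoly_var 0 \<star> npoly_var 1) \<star> (npoly_var 2 \<star> npoly_var 3)) \<longleftrightarrow>
     (\<forall>x\<in>carrier A. \<forall>y\<in>carrier A. \<forall>z\<in>carrier A. \<forall>t\<in>carrier A. (x \<otimes> y) \<otimes> (z \<otimes> t) = \<zero>)"
proof -
  have ex: "\<exists>\<rho>. range \<rho> \<subseteq> carrier A \<and> \<rho> 0 = x \<and> \<rho> 1 = y \<and> \<rho> 2 = z \<and> \<rho> (3::nat) = t"
    if "x \<in> carrier A" "y \<in> carrier A" "z \<in> carrier A" "t \<in> carrier A" for x y z t
    using that by (intro exI[of _ "\<lambda>i. if i = 0 then x else if i = 1 then y else if i = 2 then z else t"]) auto
  have ex2: "\<exists>\<rho>. range \<rho> \<subseteq> carrier A \<and> \<rho> 0 = x \<and> \<rho> (1::nat) = y"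
    if "x \<in> carrier A" "y \<in> carrier A" for x y
    using ex[of x y x x] that by auto
  have in_car: "\<rho> i \<in> carrier A" if "range \<rho> \<subseteq> carrier A" for \<rho> :: "nat \<Rightarrow> 'a" and i using that by auto
  show "satisfies A (associator (npoly_var 0) (npoly_var 0) (npoly_var 1)) \<longleftrightarrow>
     (\<forall>x\<in>carrier A. \<forall>y\<in>carrier A. assoc x x y = \<zero>)" (is "?L \<longleftrightarrow> ?R")
  proof
    assume L: ?L
    show ?R
    proof (intro ballI)
      fix x y assume "x \<in> carrier A" "y \<in> carrier A"
      then obtain \<rho> where "range \<rho> \<subseteq> carrier A" "\<rho> 0 = x" "\<rho> (1::nat) = y" using ex2 by blast
      then show "assoc x x y = \<zero>" using L unfolding satisfies_def by (auto simp: eval_associator)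
    qed
  qed (auto simp: satisfies_def eval_associator in_car)
  show "satisfies A (associator (npoly_var 0) (npoly_var 1) (npoly_var 1)) \<longleftrightarrow>
     (\<forall>x\<in>carrier A. \<forall>y\<in>carrier A. assoc x y y = \<zero>)" (is "?L \<longleftrightarrow> ?R")
  proof
    assume L: ?L
    show ?R
    proof (intro ballI)
      fix x y assume "x \<in> carrier A" "y \<in> carrier A"
      then obtain \<rho> where "range \<rho> \<subseteq> carrier A" "\<rho> 0 = x" "\<rho> (1::nat) = y" using ex2 by blast
      then show "assoc x y y = \<zero>" using L unfolding satisfies_def by (auto simp: eval_associator)
    qed
  qed (auto simp: satisfies_def eval_associator in_car)
  show "satisfies A ((npoly_var 0 \<star> npoly_var 1) \<star> (npoly_var 2 \<star> npoly_var 3)) \<longleftrightarrow>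
     (\<forall>x\<in>carrier A. \<forall>y\<in>carrier A. \<forall>z\<in>carrier A. \<forall>t\<in>carrier A. (x \<otimes> y) \<otimes> (z \<otimes> t) = \<zero>)"
     (is "?L \<longleftrightarrow> ?R")
  proof
    assume L: ?L
    show ?R
    proof (intro ballI)
      fix x y z t assume "x \<in> carrier A" "y \<in> carrier A" "z \<in> carrier A" "t \<in> carrier A"
      then obtain \<rho> where "range \<rho> \<subseteq> carrier A" "\<rho> 0 = x" "\<rho> 1 = y" "\<rho> 2 = z" "\<rho> (3::nat) = t"
        using ex by blast
      then show "(x \<otimes> y) \<otimes> (z \<otimes> t) = \<zero>" using L unfolding satisfies_def by (auto simp: eval_npoly_mult)
    qed
  qed (auto simp: satisfies_def eval_npoly_mult in_car)
qed

end

lemma alt_ideal_satisfied: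
  fixes B :: "('f::field, 'b) module"
  assumes B: "B \<in> variety alt_metabelian" and p: "p \<in> alt_ideal"
  shows "satisfies B p"
proof -
  from B have na: "nonassoc_algebra B" by (simp add: variety_def)
  interpret nonassoc_algebra B by (rule na)
  have ids: "\<forall>x\<in>carrier B. \<forall>y\<in>carrier B. assoc x x y = \<zero>\<^bsub>B\<^esub>"
    "\<forall>x\<in>carrier B. \<forall>y\<in>carrier B. assoc x y y = \<zero>\<^bsub>B\<^esub>"
    "\<forall>x\<in>carrier B. \<forall>y\<in>carrier B. \<forall>z\<in>carrier B. \<forall>t\<in>carrier B.
      (x \<otimes>\<^bsub>B\<^esub> y) \<otimes>\<^bsub>B\<^esub> (z \<otimes>\<^bsub>B\<^esub> t) = \<zero>\<^bsub>B\<^esub>"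
    using B unfolding variety_alt_metabelian_iff[symmetric] variety_def alt_metabelian_def by auto
  show ?thesis unfolding satisfies_def
  proof (intro allI impI)
    fix \<rho> :: "nat \<Rightarrow> 'b" assume \<rho>: "range \<rho> \<subseteq> carrier B"
    show "eval_npoly B \<rho> p = \<zero>\<^bsub>B\<^esub>" using p
      by (induction rule: alt_ideal.induct)
        (use \<rho> ids in \<open>simp_all add: eval_associator eval_npoly_add eval_npoly_scale eval_npoly_mult\<close>)
  qed
qed

section \<open>Linearized defining identities\<close>

definition lin_alt_left :: "(nat, 'f::field) npoly" where
  "lin_alt_left = associator (npoly_var 0) (npoly_var 1) (npoly_var 2) +
     associator (npoly_var 1) (npoly_var 0) (npoly_var 2)"

definition lin_alt_right :: "(nat, 'f::field) npoly" where
  "lin_alt_right = associator (npoly_var 0) (npoly_var 1) (npoly_var 2) +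
     associator (npoly_var 0) (npoly_var 2) (npoly_var 1)"

definition metab :: "(nat, 'f::field) npoly" where
  "metab = (npoly_var 0 \<star> npoly_var 1) \<star> (npoly_var 2 \<star> npoly_var 3)"

lemmas npoly_expand_defs = lin_alt_left_def lin_alt_right_def metab_def associator_def
  npoly_var_def npoly_mult_single

lemma associator_add:
  "associator (p + p') q r = associator p q r + associator p' q r"
  "associator p (q + q') r = associator p q r + associator p q' r"
  "associator p q (r + r') = associator p q r + associator p q r'"
  by (simp_all add: associator_def npoly_mult_add_left npoly_mult_add_right)

lemma associator_swap_left: "associator a b c + associator b a c \<in> alt_ideal"
proof -
  have "associator (a + b) (a + b) c - associator a a c - associator b b c \<in> alt_ideal"
    by (intro alt_diff alt_left)
  then show ?thesis by (simp add: associator_add algebra_simps)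
qed

lemma associator_swap_right: "associator a b c + associator a c b \<in> alt_ideal"
proof -
  have "associator a (b + c) (b + c) - associator a b b - associator a c c \<in> alt_ideal"
    by (intro alt_diff alt_right)
  then show ?thesis by (simp add: associator_add algebra_simps)
qed

lemma linearizations_in_alt_ideal:
  "lin_alt_left \<in> alt_ideal" "lin_alt_right \<in> alt_ideal" "metab \<in> alt_ideal"
  unfolding lin_alt_left_def lin_alt_right_def metab_def
  by (rule associator_swap_left associator_swap_right alt_metab)+

lemma multilinear_in_add:
  "multilinear_in n p \<Longrightarrow> multilinear_in n q \<Longrightarrow> multilinear_in n (p + q)"
  using Poly_Mapping.keys_add[of p q] unfolding multilinear_in_def by blast

lemma multilinear_in_scale: "multilinear_in n p \<Longrightarrow> multilinear_in n (nscale c p)"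
  using keys_nscale[of c p] unfolding multilinear_in_def by blast

lemma multilinear_in_minus: "multilinear_in n p \<Longrightarrow> multilinear_in n (- p)"
  using multilinear_in_scale[of n p "-1"] by (simp add: nscale_minus_one)

lemma multilinear_in_diff:
  "multilinear_in n p \<Longrightarrow> multilinear_in n q \<Longrightarrow> multilinear_in n (p - q)"
  using multilinear_in_add[of n p "- q"] multilinear_in_minus[of n q] by simp

lemma multilinear_in_single:
  "distinct (letters w) \<Longrightarrow> set (letters w) = {..<n} \<Longrightarrow> multilinear_in n (Poly_Mapping.single w c)"
  by (simp add: multilinear_in_def)

lemma multilinear_linearizations:
  "multilinear_in 3 lin_alt_left" "multilinear_in 3 lin_alt_right" "multilinear_in 4 metab"
  unfolding npoly_expand_defs
  by (intro multilinear_in_add multilinear_in_diff multilinear_in_single; force)+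

text \<open>Identifying the two variables that were linearized gives twice the original associator,
  and 2 is invertible. From here on only multilinear identities occur, which is what superization
  needs.\<close>

lemma variety_alt_metabelian_linearized:
  assumes "nonassoc_algebra (B :: ('f::field_char_0, 'a) module)"
  shows "B \<in> variety alt_metabelian \<longleftrightarrow>
    satisfies B lin_alt_left \<and> satisfies B lin_alt_right \<and> satisfies B metab"
proof
  assume "B \<in> variety alt_metabelian"
  then show "satisfies B lin_alt_left \<and> satisfies B lin_alt_right \<and> satisfies B metab"
    using alt_ideal_satisfied linearizations_in_alt_ideal by blast
next
  interpret nonassoc_algebra B by fact
  assume *: "satisfies B lin_alt_left \<and> satisfies B lin_alt_right \<and> satisfies B metab"
  have double: "x = \<zero>\<^bsub>B\<^esub>" if "x \<oplus>\<^bsub>B\<^esub> x = \<zero>\<^bsub>B\<^esub>" "x \<in> carrier B" for x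
    using that scale_cancel[of 2 x] scale_add_left[of x 1 1] by simp
  have clo: "assoc x y z \<in> carrier B" if "x \<in> carrier B" "y \<in> carrier B" "z \<in> carrier B" for x y z
    using that by (simp add: assoc_def)
  have "assoc x x y = \<zero>\<^bsub>B\<^esub> \<and> assoc y x x = \<zero>\<^bsub>B\<^esub>" if "x \<in> carrier B" "y \<in> carrier B" for x y
  proof -
    \<comment> \<open>These assignments identify the first two variables in the left law and the
      last two in the right law.\<close>
    let ?\<rho> = "\<lambda>i::nat. if i = 2 then y else x" and ?\<sigma> = "\<lambda>i::nat. if i = 0 then y else x"
    have "range ?\<rho> \<subseteq> carrier B" "range ?\<sigma> \<subseteq> carrier B" using that by auto
    moreover from this have "eval_npoly B ?\<rho> lin_alt_left = \<zero>\<^bsub>B\<^esub>" "eval_npoly B ?\<sigma> lin_alt_right = \<zero>\<^bsub>B\<^esub>"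
      using * unfolding satisfies_def by blast+
    ultimately have "eval_npoly B ?\<rho> lin_alt_left = \<zero>\<^bsub>B\<^esub>" "eval_npoly B ?\<sigma> lin_alt_right = \<zero>\<^bsub>B\<^esub>"
      and "eval_npoly B ?\<rho> lin_alt_left = assoc x x y \<oplus>\<^bsub>B\<^esub> assoc x x y"
      "eval_npoly B ?\<sigma> lin_alt_right = assoc y x x \<oplus>\<^bsub>B\<^esub> assoc y x x"
      by (simp_all add: lin_alt_left_def lin_alt_right_def eval_npoly_add eval_associator)
    then show ?thesis using double clo that by metis
  qed
  then show "B \<in> variety alt_metabelian"
    using * assms variety_alt_metabelian_iff(1,2)
    unfolding variety_def alt_metabelian_def metab_def by blast
qed

section \<open>The Grassmann envelope\<close>

text \<open>Unlike \<^const>\<open>grassmann_sign\<close>, this coefficient vanishes on overlapping sets, so that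
  \<open>e\<^sub>S e\<^sub>T\<close> is always its multiple of \<open>e\<^bsub>S \<union> T\<^esub>\<close>.\<close>

definition gcoeff :: "nat set \<Rightarrow> nat set \<Rightarrow> 'f::field" where
  "gcoeff S T = (if S \<inter> T = {} then grassmann_sign S T else 0)"

lemma grassmann_sign_nonzero [simp]: "grassmann_sign S T \<noteq> (0::'f::field)"
  by (simp add: grassmann_sign_def)

lemma finite_inversions:
  "finite S \<Longrightarrow> finite T \<Longrightarrow> finite {(s, t). s \<in> S \<and> t \<in> T \<and> (t::nat) < s}"
  by (rule finite_subset[of _ "S \<times> T"]) auto

lemma grassmann_sign_Un_left:
  assumes "finite S" "finite S'" "finite T" "S \<inter> S' = {}"
  shows "grassmann_sign (S \<union> S') T = grassmann_sign S T * (grassmann_sign S' T :: 'f::field)"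
proof -
  have "{(s, t). s \<in> S \<union> S' \<and> t \<in> T \<and> t < s} =
      {(s, t). s \<in> S \<and> t \<in> T \<and> t < s} \<union> {(s, t). s \<in> S' \<and> t \<in> T \<and> t < s}" by auto
  moreover have "card \<dots> = card {(s, t). s \<in> S \<and> t \<in> T \<and> t < s} + card {(s, t). s \<in> S' \<and> t \<in> T \<and> t < s}"
    using assms by (intro card_Un_disjoint finite_inversions) auto
  ultimately show ?thesis by (simp add: grassmann_sign_def power_add)
qed

lemma grassmann_sign_Un_right:
  assumes "finite S" "finite T" "finite T'" "T \<inter> T' = {}"
  shows "grassmann_sign S (T \<union> T') = grassmann_sign S T * (grassmann_sign S T' :: 'f::field)"
proof -
  have "{(s, t). s \<in> S \<and> t \<in> T \<union> T' \<and> t < s} =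
      {(s, t). s \<in> S \<and> t \<in> T \<and> t < s} \<union> {(s, t). s \<in> S \<and> t \<in> T' \<and> t < s}" by auto
  moreover have "card \<dots> = card {(s, t). s \<in> S \<and> t \<in> T \<and> t < s} + card {(s, t). s \<in> S \<and> t \<in> T' \<and> t < s}"
    using assms by (intro card_Un_disjoint finite_inversions) auto
  ultimately show ?thesis by (simp add: grassmann_sign_def power_add)
qed

lemma gcoeff_Un_left:
  assumes "finite S" "finite S'" "finite T" "S \<inter> S' = {}"
  shows "gcoeff (S \<union> S') T = gcoeff S T * (gcoeff S' T :: 'f::field)"
  using grassmann_sign_Un_left[OF assms] by (auto simp: gcoeff_def Int_Un_distrib2)

lemma gcoeff_Un_right:
  assumes "finite S" "finite T" "finite T'" "T \<inter> T' = {}"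
  shows "gcoeff S (T \<union> T') = gcoeff S T * (gcoeff S T' :: 'f::field)"
  using grassmann_sign_Un_right[OF assms] by (auto simp: gcoeff_def Int_Un_distrib)

text \<open>For disjoint sets every pair in \<open>S \<times> T\<close> is an inversion for exactly
  one of the two orders, so the two exponents add up to \<open>card S * card T\<close>. For
  overlapping sets both sides are zero.\<close>

lemma gcoeff_commute:
  assumes "finite S" "finite T"
  shows "gcoeff S T = (- 1) ^ (card S * card T) * (gcoeff T S :: 'f::field)"
proof (cases "S \<inter> T = {}")
  case True
  let ?I = "\<lambda>S T. {(s, t). s \<in> S \<and> t \<in> T \<and> (t::nat) < s}"
  have "card (S \<times> T) = card (?I S T \<union> (\<lambda>(t, s). (s, t)) ` ?I T S)"
  proof (rule arg_cong[where f=card], intro equalityI subsetI)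
    fix p assume "p \<in> S \<times> T"
    then obtain s t where p: "p = (s, t)" "s \<in> S" "t \<in> T" by auto
    then have "t < s \<or> s < t" using True by (metis disjoint_iff linorder_neqE_nat)
    then show "p \<in> ?I S T \<union> (\<lambda>(t, s). (s, t)) ` ?I T S" using p by (auto simp: image_iff)
  qed auto
  also have "\<dots> = card (?I S T) + card ((\<lambda>(t, s). (s, t)) ` ?I T S)"
    using assms by (intro card_Un_disjoint finite_imageI finite_inversions) auto
  also have "card ((\<lambda>(t, s). (s, t)) ` ?I T S) = card (?I T S)"
    by (rule card_image) (auto simp: inj_on_def)
  finally have *: "card S * card T = card (?I S T) + card (?I T S)" by (simp add: card_cartesian_product)
  have "(-1 :: 'f) ^ (a + b) * (-1) ^ b = (-1) ^ a" for a b :: nat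
    by (simp add: power_add mult.assoc flip: power_mult_distrib)
  then have "(-1 :: 'f) ^ card (?I S T) = (-1) ^ (card S * card T) * (-1) ^ card (?I T S)"
    unfolding * by simp
  then show ?thesis using True by (simp add: gcoeff_def grassmann_sign_def Int_commute)
qed (simp add: gcoeff_def Int_commute)

section \<open>Grassmann coefficients versus Koszul signs\<close>

lemma of_nat_bit: "of_nat n = (if even n then 0 else 1 :: bit)"
  by (induction n) auto

text \<open>The scalar by which a product of Grassmann basis words, taken in the order of the list,
  differs from the basis word of the union of their index sets. It is zero if two of these sets
  meet.\<close>

primrec list_gcoeff :: "(nat \<Rightarrow> nat set) \<Rightarrow> nat list \<Rightarrow> 'f::field" where
  "list_gcoeff S [] = 1"
| "list_gcoeff S (x # xs) = (\<Prod>y\<leftarrow>xs. gcoeff (S x) (S y)) * list_gcoeff S xs"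

definition koszul_factor :: "(nat \<Rightarrow> bit) \<Rightarrow> nat \<Rightarrow> nat \<Rightarrow> 'f::field" where
  "koszul_factor \<pi> x y = (if y < x \<and> \<pi> x = 1 \<and> \<pi> y = 1 then -1 else 1)"

primrec list_koszul :: "(nat \<Rightarrow> bit) \<Rightarrow> nat list \<Rightarrow> 'f::field" where
  "list_koszul \<pi> [] = 1"
| "list_koszul \<pi> (x # xs) = (\<Prod>y\<leftarrow>xs. koszul_factor \<pi> x y) * list_koszul \<pi> xs"

lemma prod_koszul_factor:
  "(\<Prod>y\<leftarrow>xs. koszul_factor \<pi> x y) =
     ((-1) ^ card {j. j < length xs \<and> xs ! j < x \<and> \<pi> x = 1 \<and> \<pi> (xs ! j) = 1} :: 'f::field)"
proof (induction xs)
  case (Cons y ys)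
  let ?J = "\<lambda>xs. {j. j < length xs \<and> xs ! j < x \<and> \<pi> x = 1 \<and> \<pi> (xs ! j) = 1}"
  let ?B = "if y < x \<and> \<pi> x = 1 \<and> \<pi> y = 1 then {0::nat} else {}"
  have "?J (y # ys) = ?B \<union> Suc ` ?J ys"
    by (auto simp: less_Suc_eq_0_disj image_iff)
  moreover have "card \<dots> = card ?B + card (Suc ` ?J ys)"
    by (rule card_Un_disjoint) auto
  ultimately show ?case using Cons by (simp add: koszul_factor_def card_image)
qed simp

text \<open>Inversions of \<open>x # xs\<close> split into those that start at the head and those
  inside the tail, which turns the global count into a product over pairs, the same shape as
  \<open>list_gcoeff\<close>.\<close>

lemma koszul_sign_letters: "koszul_sign \<pi> w = (list_koszul \<pi> (letters w) :: 'f::field)"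
proof -
  have "((-1) ^ card {(i, j). i < j \<and> j < length xs \<and> xs ! j < xs ! i \<and> \<pi> (xs ! i) = 1 \<and> \<pi> (xs ! j) = 1} :: 'f)
    = list_koszul \<pi> xs" for xs
  proof (induction xs)
    case (Cons x xs)
    let ?J = "\<lambda>xs. {(i, j). i < j \<and> j < length xs \<and> xs ! j < xs ! i \<and> \<pi> (xs ! i) = 1 \<and> \<pi> (xs ! j) = 1}"
    let ?B = "{j. j < length xs \<and> xs ! j < x \<and> \<pi> x = 1 \<and> \<pi> (xs ! j) = 1}"
    have fin: "finite (?J ys)" for ys
      by (rule finite_subset[of _ "{..<length ys} \<times> {..<length ys}"]) auto
    have "?J (x # xs) = (\<lambda>j. (0, Suc j)) ` ?B \<union> map_prod Suc Suc ` ?J xs"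
    proof (intro equalityI subsetI)
      fix p assume "p \<in> ?J (x # xs)"
      moreover obtain i j where "p = (i, j)" by force
      ultimately show "p \<in> (\<lambda>j. (0, Suc j)) ` ?B \<union> map_prod Suc Suc ` ?J xs"
        by (cases i; cases j) (auto simp: image_iff)
    qed auto
    moreover have "card \<dots> = card ((\<lambda>j. (0::nat, Suc j)) ` ?B) + card (map_prod Suc Suc ` ?J xs)"
      by (rule card_Un_disjoint) (use fin in auto)
    moreover have "card ((\<lambda>j. (0::nat, Suc j)) ` ?B) = card ?B"
      by (rule card_image) (auto simp: inj_on_def)
    moreover have "card (map_prod Suc Suc ` ?J xs) = card (?J xs)"
      by (rule card_image) (auto simp: inj_on_def)
    ultimately show ?case using Cons by (simp add: prod_koszul_factor power_add)
  qed simp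
  then show ?thesis by (simp add: koszul_sign_def Let_def)
qed

text \<open>The coefficient of the Grassmann product taken in the natural order of the variables. It
  depends only on the set of variables, hence is common to all words of a multilinear
  polynomial.\<close>

definition sorted_gcoeff :: "(nat \<Rightarrow> nat set) \<Rightarrow> nat set \<Rightarrow> 'f::field" where
  "sorted_gcoeff S J = (\<Prod>(i, j)\<in>{(i, j). i \<in> J \<and> j \<in> J \<and> i < j}. gcoeff (S i) (S j))"

lemma sorted_gcoeff_insert:
  assumes "finite J" "x \<notin> J"
  shows "sorted_gcoeff S (insert x J) =
    (\<Prod>y\<in>J. gcoeff (S (min x y)) (S (max x y))) * (sorted_gcoeff S J :: 'f::field)"
proof -
  let ?P = "\<lambda>J. {(i, j). i \<in> J \<and> j \<in> J \<and> i < (j::nat)}"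
  let ?m = "\<lambda>y. (min x y, max x y)"
  have fin: "finite (?P J)" by (rule finite_subset[of _ "J \<times> J"]) (use assms in auto)
  have "?P (insert x J) = ?m ` J \<union> ?P J"
  proof (intro equalityI subsetI)
    fix p assume "p \<in> ?P (insert x J)"
    then obtain i j where p: "p = (i, j)" "i \<in> insert x J" "j \<in> insert x J" "i < j" by auto
    show "p \<in> ?m ` J \<union> ?P J"
    proof (cases "i = x")
      case True
      then have "p = ?m j" "j \<in> J" using p by auto
      then show ?thesis by blast
    next
      case False
      show ?thesis
      proof (cases "j = x")
        case True
        then have "p = ?m i" "i \<in> J" using p False by auto
        then show ?thesis by blast
      qed (use p False in auto)
    qed
  qed (use assms in \<open>auto simp: min_def max_def less_le split: if_splits\<close>)
  moreover have "?m ` J \<inter> ?P J = {}" using assms by (auto simp: min_def max_def split: if_splits)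
  moreover have "inj_on ?m J" by (auto simp: inj_on_def min_def max_def split: if_splits)
  ultimately show ?thesis unfolding sorted_gcoeff_def
    using assms fin by (simp add: prod.union_disjoint prod.reindex o_def)
qed

text \<open>This is the origin of the Koszul rule: sorting Grassmann words of parities
  \<open>\<pi>\<close> costs \<open>-1\<close> exactly for each inversion between two odd ones, by
  \<open>gcoeff_commute\<close>.\<close>

lemma list_gcoeff_eq:
  assumes "distinct xs" "\<And>i. finite (S i)" "\<And>i. \<pi> i = of_nat (card (S i))"
  shows "list_gcoeff S xs = sorted_gcoeff S (set xs) * (list_koszul \<pi> xs :: 'f::field)"
  using assms(1)
proof (induction xs)
  case (Cons x xs)
  have eq: "gcoeff (S x) (S y) = gcoeff (S (min x y)) (S (max x y)) * (koszul_factor \<pi> x y :: 'f)" if "x \<noteq> y" for y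
  proof (cases "x < y")
    case False
    then have "min x y = y" "max x y = x" "y < x" using that by auto
    moreover have "(- 1 :: 'f) ^ (card (S x) * card (S y)) = koszul_factor \<pi> x y"
      using \<open>y < x\<close> by (cases "even (card (S x))"; cases "even (card (S y))") (auto simp: koszul_factor_def assms(3) of_nat_bit)
    ultimately show ?thesis
      using gcoeff_commute[of "S x" "S y", where 'f='f] assms(2) by (simp add: mult.commute)
  qed (simp add: koszul_factor_def min_def max_def)
  have "(\<Prod>y\<leftarrow>xs. gcoeff (S x) (S y)) =
      (\<Prod>y\<leftarrow>xs. gcoeff (S (min x y)) (S (max x y)) * (koszul_factor \<pi> x y :: 'f))"
    by (intro arg_cong[where f=prod_list] map_cong refl eq) (use Cons.prems in auto)
  also have "\<dots> = (\<Prod>y\<in>set xs. gcoeff (S (min x y)) (S (max x y))) * (\<Prod>y\<leftarrow>xs. koszul_factor \<pi> x y)"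
    using Cons.prems by (simp add: prod.distrib flip: prod.distinct_set_conv_list)
  finally show ?case using Cons by (simp add: sorted_gcoeff_insert)
qed (simp add: sorted_gcoeff_def)

lemma list_gcoeff_disjoint:
  assumes "list_gcoeff S (x # xs) \<noteq> (0::'f::field)"
  shows "S x \<inter> (\<Union>y\<in>set xs. S y) = {}" "list_gcoeff S xs \<noteq> (0::'f)"
  using assms by (auto simp: prod_list_zero_iff gcoeff_def split: if_splits)

text \<open>The nonvanishing hypothesis makes the sets pairwise disjoint, which multiplicativity of
  \<open>gcoeff\<close> in a union requires.\<close>

lemma gcoeff_Union_left:
  assumes "list_gcoeff S xs \<noteq> (0::'f::field)" "\<And>i. finite (S i)" "finite T"
  shows "gcoeff (\<Union>x\<in>set xs. S x) T = (\<Prod>x\<leftarrow>xs. gcoeff (S x) T :: 'f)"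
  using assms(1)
proof (induction xs)
  case (Cons x xs)
  note d = list_gcoeff_disjoint[OF Cons.prems]
  have "gcoeff (S x \<union> (\<Union>y\<in>set xs. S y)) T = gcoeff (S x) T * (gcoeff (\<Union>y\<in>set xs. S y) T :: 'f)"
    using assms d by (intro gcoeff_Un_left) auto
  then show ?case using Cons.IH d by simp
qed (simp add: gcoeff_def grassmann_sign_def)

lemma gcoeff_Union_right:
  assumes "list_gcoeff S xs \<noteq> (0::'f::field)" "\<And>i. finite (S i)" "finite T"
  shows "gcoeff T (\<Union>x\<in>set xs. S x) = (\<Prod>x\<leftarrow>xs. gcoeff T (S x) :: 'f)"
  using assms(1)
proof (induction xs)
  case (Cons x xs)
  note d = list_gcoeff_disjoint[OF Cons.prems]
  have "gcoeff T (S x \<union> (\<Union>y\<in>set xs. S y)) = gcoeff T (S x) * (gcoeff T (\<Union>y\<in>set xs. S y) :: 'f)"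
    using assms d by (intro gcoeff_Un_right) auto
  then show ?case using Cons.IH d by simp
qed (simp add: gcoeff_def grassmann_sign_def)

lemma list_gcoeff_append:
  "list_gcoeff S (xs @ ys) = list_gcoeff S xs * list_gcoeff S ys *
     (\<Prod>x\<leftarrow>xs. \<Prod>y\<leftarrow>ys. gcoeff (S x) (S y) :: 'f::field)"
  by (induction xs) (auto simp: mult_ac)

lemma list_gcoeff_append_Union:
  assumes fin: "\<And>i. finite (S i)"
  shows "list_gcoeff S (xs @ ys) = list_gcoeff S xs * list_gcoeff S ys *
    (gcoeff (\<Union>x\<in>set xs. S x) (\<Union>y\<in>set ys. S y) :: 'f::field)"
proof (cases "list_gcoeff S xs * list_gcoeff S ys = (0::'f)")
  case False
  then show ?thesis
    unfolding list_gcoeff_append using fin by (subst gcoeff_Union_left) (auto simp: gcoeff_Union_right)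
next
  case True
  then show ?thesis unfolding list_gcoeff_append by simp
qed


lemma (in nonassoc_algebra) eval_npoly_cong:
  assumes "range \<rho>' \<subseteq> carrier A"
    and "\<And>w x. w \<in> Poly_Mapping.keys f \<Longrightarrow> x \<in> set (letters w) \<Longrightarrow> \<rho> x = \<rho>' x"
  shows "eval_npoly A \<rho> f = eval_npoly A \<rho>' f"
  unfolding eval_npoly_def
proof (intro M.finsum_cong' refl funcsetI)
  fix w assume "w \<in> Poly_Mapping.keys f"
  then have "eval_nword A \<rho> w = eval_nword A \<rho>' w" using assms(2) by (intro eval_nword_cong)
  then show "Poly_Mapping.lookup f w \<odot> eval_nword A \<rho> w = Poly_Mapping.lookup f w \<odot> eval_nword A \<rho>' w"
    by simp
qed (use assms(1) in auto)

section \<open>The Grassmann envelope as an algebra\<close>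

context is_superalgebra
begin

lemma homog_subset: "homog A i \<subseteq> carrier A"
  using submoduleE(1)[OF homog_submodule] .

lemma homog_closed [simp]: "x \<in> homog A i \<Longrightarrow> x \<in> carrier A"
  using homog_subset by auto

lemma homog_add [simp]: "x \<in> homog A i \<Longrightarrow> y \<in> homog A i \<Longrightarrow> x \<oplus> y \<in> homog A i"
  using submoduleE(5)[OF homog_submodule] .

lemma homog_scale [simp]: "x \<in> homog A i \<Longrightarrow> c \<odot> x \<in> homog A i"
  using submoduleE(4)[OF homog_submodule, of c] by simp

lemma homog_minus [simp]: "x \<in> homog A i \<Longrightarrow> \<ominus> x \<in> homog A i"
  using submoduleE(3)[OF homog_submodule] .

lemma homog_zero [simp]: "\<zero> \<in> homog A i"
  using submoduleE(2)[OF homog_submodule, of i] homog_scale[of _ i 0] by fastforce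

lemma homog_finsum: "(\<And>i. i \<in> I \<Longrightarrow> f i \<in> homog A k) \<Longrightarrow> (\<Oplus>i\<in>I. f i) \<in> homog A k"
proof (induction I rule: infinite_finite_induct)
  case (insert x F)
  then show ?case by (subst M.finsum_insert) (auto intro: homog_closed)
qed (auto simp: M.finsum_infinite)

abbreviation G where "G \<equiv> grassmann_envelope A"

lemma G_simps [simp]:
  "u \<otimes>\<^bsub>G\<^esub> v = (\<lambda>U. \<Oplus>S\<in>Pow U. grassmann_sign S (U - S) \<odot> (u S \<otimes> v (U - S)))"
  "\<zero>\<^bsub>G\<^esub> = (\<lambda>_. \<zero>)" "u \<oplus>\<^bsub>G\<^esub> v = (\<lambda>S. u S \<oplus> v S)" "c \<odot>\<^bsub>G\<^esub> u = (\<lambda>S. c \<odot> u S)"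
  by (simp_all add: grassmann_envelope_def fun_eq_iff)

lemma G_carrier: "u \<in> carrier G \<longleftrightarrow> finite {S. u S \<noteq> \<zero>} \<and> (\<forall>S. infinite S \<longrightarrow> u S = \<zero>) \<and>
    (\<forall>S. finite S \<longrightarrow> u S \<in> homog A (of_nat (card S)))"
  by (simp add: grassmann_envelope_def)

lemma G_value [simp]: "u \<in> carrier G \<Longrightarrow> u S \<in> carrier A"
  by (cases "finite S") (auto simp: G_carrier)

lemma G_mult_closed:
  assumes u: "u \<in> carrier G" and v: "v \<in> carrier G"
  shows "u \<otimes>\<^bsub>G\<^esub> v \<in> carrier G"
proof -
  let ?p = "u \<otimes>\<^bsub>G\<^esub> v" and ?s = "\<lambda>u. {S. u S \<noteq> \<zero>}"
  have "?s ?p \<subseteq> (\<lambda>(S, T). S \<union> T) ` (?s u \<times> ?s v)"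
  proof
    fix U assume U: "U \<in> ?s ?p"
    have "\<exists>S\<in>Pow U. u S \<otimes> v (U - S) \<noteq> \<zero>"
    proof (rule ccontr)
      assume "\<not> ?thesis"
      then have "?p U = (\<Oplus>S\<in>Pow U. \<zero>)"
        unfolding G_simps by (intro M.finsum_cong') auto
      then show False using U by simp
    qed
    then obtain S where S: "S \<subseteq> U" "u S \<otimes> v (U - S) \<noteq> \<zero>" by auto
    then have "(S, U - S) \<in> ?s u \<times> ?s v" using u v by auto
    then show "U \<in> (\<lambda>(S, T). S \<union> T) ` (?s u \<times> ?s v)" using S by (auto simp: image_iff intro!: bexI[of _ S] bexI[of _ "U - S"])
  qed
  moreover have "finite ((\<lambda>(S, T). S \<union> T) ` (?s u \<times> ?s v))"
    using u v by (intro finite_imageI finite_cartesian_product) (auto simp: G_carrier)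
  ultimately have "finite (?s ?p)" by (rule finite_subset)
  moreover have "?p U = \<zero>" if "infinite U" for U
    using that by (simp add: M.finsum_infinite)
  moreover have "?p U \<in> homog A (of_nat (card U))" if U: "finite U" for U
    unfolding G_simps
  proof (intro homog_finsum homog_scale)
    fix S assume "S \<in> Pow U"
    then have S: "S \<subseteq> U" "finite S" using U finite_subset by auto
    have "u S \<otimes> v (U - S) \<in> homog A (of_nat (card S) + of_nat (card (U - S)))"
      using u v S U by (intro homog_mult) (auto simp: G_carrier)
    moreover have "card S + card (U - S) = card U"
      using S U by (metis card_Diff_subset card_mono le_add_diff_inverse)
    ultimately show "u S \<otimes> v (U - S) \<in> homog A (of_nat (card U))"
      by (metis of_nat_add)
  qed
  ultimately show ?thesis by (simp add: G_carrier)
qed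

lemma G_add_closed:
  assumes u: "u \<in> carrier G" and v: "v \<in> carrier G"
  shows "u \<oplus>\<^bsub>G\<^esub> v \<in> carrier G"
proof -
  have "finite {S. u S \<oplus> v S \<noteq> \<zero>}"
    by (rule finite_subset[of _ "{S. u S \<noteq> \<zero>} \<union> {S. v S \<noteq> \<zero>}"]) (use u v in \<open>auto simp: G_carrier\<close>)
  then show ?thesis using u v by (simp add: G_carrier)
qed

lemma G_scale_closed:
  assumes u: "u \<in> carrier G" shows "c \<odot>\<^bsub>G\<^esub> u \<in> carrier G"
proof -
  have "finite {S. c \<odot> u S \<noteq> \<zero>}"
    by (rule finite_subset[of _ "{S. u S \<noteq> \<zero>}"]) (use u in \<open>auto simp: G_carrier\<close>)
  then show ?thesis using u by (simp add: G_carrier)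
qed

lemma G_abelian_group: "abelian_group G"
proof (rule abelian_groupI)
  show "\<exists>y\<in>carrier G. y \<oplus>\<^bsub>G\<^esub> x = \<zero>\<^bsub>G\<^esub>" if "x \<in> carrier G" for x
  proof (rule bexI[of _ "(-1) \<odot>\<^bsub>G\<^esub> x"])
    show "(- 1) \<odot>\<^bsub>G\<^esub> x \<oplus>\<^bsub>G\<^esub> x = \<zero>\<^bsub>G\<^esub>"
      using that by (auto simp: scale_minus_one M.l_neg)
  qed (rule G_scale_closed[OF that])
  show "\<zero>\<^bsub>G\<^esub> \<in> carrier G" by (simp add: G_carrier)
qed (rule G_add_closed, auto simp: M.a_ac)

lemma G_nonassoc_algebra: "nonassoc_algebra G"
proof -
  show ?thesis
  proof (rule nonassoc_algebra.intro)
    show "module (ring_of_type_algebra :: 'f ring) G"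
    proof (rule moduleI)
      show "cring (ring_of_type_algebra :: 'f ring)" by (rule R.is_cring)
      show "abelian_group G" by (rule G_abelian_group)
    qed (use G_scale_closed in \<open>auto simp: scale_add_left scale_add_right scale_scale\<close>)
    show "nonassoc_algebra_axioms G"
    proof (rule nonassoc_algebra_axioms.intro)
      fix x y z and c :: 'f
      assume x: "x \<in> carrier G" and y: "y \<in> carrier G"
      show "x \<otimes>\<^bsub>G\<^esub> y \<in> carrier G" using x y by (rule G_mult_closed)
      show "(c \<odot>\<^bsub>G\<^esub> x) \<otimes>\<^bsub>G\<^esub> y = c \<odot>\<^bsub>G\<^esub> (x \<otimes>\<^bsub>G\<^esub> y)"
        using x y by (auto simp: finsum_scale mult_smult_left scale_scale mult.commute intro!: ext M.finsum_cong')
      show "x \<otimes>\<^bsub>G\<^esub> (c \<odot>\<^bsub>G\<^esub> y) = c \<odot>\<^bsub>G\<^esub> (x \<otimes>\<^bsub>G\<^esub> y)"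
        using x y by (auto simp: finsum_scale mult_smult_right scale_scale mult.commute intro!: ext M.finsum_cong')
      assume z: "z \<in> carrier G"
      show "(x \<oplus>\<^bsub>G\<^esub> y) \<otimes>\<^bsub>G\<^esub> z = x \<otimes>\<^bsub>G\<^esub> z \<oplus>\<^bsub>G\<^esub> y \<otimes>\<^bsub>G\<^esub> z"
        using x y z by (simp add: mult_add_left scale_add_right M.finsum_addf Pi_def)
      show "x \<otimes>\<^bsub>G\<^esub> (y \<oplus>\<^bsub>G\<^esub> z) = x \<otimes>\<^bsub>G\<^esub> y \<oplus>\<^bsub>G\<^esub> x \<otimes>\<^bsub>G\<^esub> z"
        using x y z by (simp add: mult_add_right scale_add_right M.finsum_addf Pi_def)
    qed
  qed
qed

section \<open>Monomials \<open>e_S\<close> tensor \<open>a\<close> of the envelope, and identities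
  versus superidentities\<close>

definition gmono where "gmono S a = (\<lambda>U. if U = S then a else \<zero>)"

lemma mono_closed: "finite S \<Longrightarrow> a \<in> homog A (of_nat (card S)) \<Longrightarrow> gmono S a \<in> carrier G"
  by (auto simp: G_carrier gmono_def)

lemma mono_mult:
  assumes "finite S" "finite T" "a \<in> carrier A" "b \<in> carrier A"
  shows "gmono S a \<otimes>\<^bsub>G\<^esub> gmono T b = gmono (S \<union> T) (gcoeff S T \<odot> (a \<otimes> b))"
proof
  fix U
  let ?f = "\<lambda>P. grassmann_sign P (U - P) \<odot> (gmono S a P \<otimes> gmono T b (U - P))"
  show "(gmono S a \<otimes>\<^bsub>G\<^esub> gmono T b) U = gmono (S \<union> T) (gcoeff S T \<odot> (a \<otimes> b)) U"
  proof (cases "U = S \<union> T \<and> S \<inter> T = {}")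
    case True
    then have U: "U - S = T" "S \<in> Pow U" "finite (Pow U)" using assms by auto
    have "(\<Oplus>P\<in>Pow U. ?f P) = (\<Oplus>P\<in>Pow U. if S = P then grassmann_sign S T \<odot> (a \<otimes> b) else \<zero>)"
      using assms U by (intro M.finsum_cong') (auto simp: gmono_def)
    also have "\<dots> = grassmann_sign S T \<odot> (a \<otimes> b)"
      using U assms by (intro M.add.finprod_singleton[where f="\<lambda>_. grassmann_sign S T \<odot> (a \<otimes> b)"]) auto
    finally show ?thesis using True by (simp add: gmono_def gcoeff_def)
  next
    case False
    have "(\<Oplus>P\<in>Pow U. ?f P) = (\<Oplus>P\<in>Pow U. \<zero>)"
      using assms False by (intro M.finsum_cong') (auto simp: gmono_def)
    then show ?thesis using assms False by (auto simp: gmono_def gcoeff_def)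
  qed
qed

lemma mono_in_carrier_iff: "finite S \<Longrightarrow> gmono S a \<in> carrier G \<longleftrightarrow> a \<in> homog A (of_nat (card S))"
  using mono_closed by (auto simp: G_carrier gmono_def dest: spec[of _ S])

lemma mono_zero: "gmono S \<zero> = \<zero>\<^bsub>G\<^esub>"
  by (auto simp: gmono_def)

lemma mono_add: "gmono S (a \<oplus> b) = gmono S a \<oplus>\<^bsub>G\<^esub> gmono S b" if "a \<in> carrier A" "b \<in> carrier A"
  using that by (auto simp: gmono_def)

lemma mono_scale: "gmono S (c \<odot> a) = c \<odot>\<^bsub>G\<^esub> gmono S a" if "a \<in> carrier A"
  using that by (auto simp: gmono_def)

lemma mono_finsum:
  assumes "finite S" "\<And>i. i \<in> I \<Longrightarrow> f i \<in> homog A (of_nat (card S))"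
  shows "(\<Oplus>\<^bsub>G\<^esub>i\<in>I. gmono S (f i)) = gmono S (\<Oplus>i\<in>I. f i)"
proof -
  interpret G: nonassoc_algebra G by (rule G_nonassoc_algebra)
  show ?thesis using assms(2)
  proof (induction I rule: infinite_finite_induct)
    case (insert x F)
    have "(\<Oplus>\<^bsub>G\<^esub>i\<in>insert x F. gmono S (f i)) = gmono S (f x) \<oplus>\<^bsub>G\<^esub> gmono S (\<Oplus>i\<in>F. f i)"
      using insert assms(1) by (subst G.M.finsum_insert) (auto simp: mono_closed simp del: G_simps)
    also have "\<dots> = gmono S (f x \<oplus> (\<Oplus>i\<in>F. f i))"
      using insert.prems by (intro mono_add[symmetric] M.finsum_closed) (auto intro: homog_closed)
    also have "f x \<oplus> (\<Oplus>i\<in>F. f i) = (\<Oplus>i\<in>insert x F. f i)"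
      using insert by (subst M.finsum_insert) (auto intro: homog_closed)
    finally show ?case .
  qed (auto simp: mono_zero G.M.finsum_infinite M.finsum_infinite simp del: G_simps)
qed

lemma eval_nword_mono:
  assumes fin: "\<And>i. finite (S i)" and \<rho>: "range \<rho> \<subseteq> carrier A"
  shows "eval_nword G (\<lambda>i. gmono (S i) (\<rho> i)) w =
    gmono (\<Union>i\<in>set (letters w). S i) (list_gcoeff S (letters w) \<odot> eval_nword A \<rho> w)"
proof (induction w)
  case (Letter x)
  then show ?case using \<rho> by (simp add: range_subsetD)
next
  case (Juxt u v)
  have "eval_nword G (\<lambda>i. gmono (S i) (\<rho> i)) (Juxt u v) =
      gmono (\<Union>i\<in>set (letters u). S i) (list_gcoeff S (letters u) \<odot> eval_nword A \<rho> u) \<otimes>\<^bsub>G\<^esub>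
      gmono (\<Union>i\<in>set (letters v). S i) (list_gcoeff S (letters v) \<odot> eval_nword A \<rho> v)"
    by (simp only: eval_nword.simps Juxt)
  also have "\<dots> = gmono (\<Union>i\<in>set (letters (Juxt u v)). S i)
      (list_gcoeff S (letters (Juxt u v)) \<odot> eval_nword A \<rho> (Juxt u v))"
    using fin \<rho>
    by (subst mono_mult)
      (auto simp: list_gcoeff_append_Union mult_smult_left mult_smult_right scale_scale mult_ac simp del: G_simps)
  finally show ?case .
qed

text \<open>All words of a multilinear polynomial use the same variables, so their Grassmann parts
  are multiples of one basis word. Relative to the sorted coefficient the factor of each word is its
  Koszul sign, and what remains in the second tensor factor is the superization.\<close>

lemma eval_npoly_mono:
  assumes f: "multilinear_in n f" and fin: "\<And>i. finite (S i)" and par: "\<And>i. \<pi> i = of_nat (card (S i))"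
    and \<rho>: "\<And>i. \<rho> i \<in> homog A (\<pi> i)"
  shows "eval_npoly G (\<lambda>i. gmono (S i) (\<rho> i)) f =
    gmono (\<Union>i<n. S i) (sorted_gcoeff S {..<n} \<odot> eval_superization A \<pi> \<rho> f)"
proof -
  interpret G: nonassoc_algebra G by (rule G_nonassoc_algebra)
  let ?U = "\<Union>i<n. S i" and ?\<kappa> = "sorted_gcoeff S {..<n}"
  let ?g = "\<lambda>w. (koszul_sign \<pi> w * Poly_Mapping.lookup f w) \<odot> eval_nword A \<rho> w"
  have \<rho>c: "range \<rho> \<subseteq> carrier A" using \<rho> homog_closed by blast
  have mc: "range (\<lambda>i. gmono (S i) (\<rho> i)) \<subseteq> carrier G" using fin \<rho> par by (auto intro!: mono_closed)
  have w: "Poly_Mapping.lookup f w \<odot>\<^bsub>G\<^esub> eval_nword G (\<lambda>i. gmono (S i) (\<rho> i)) w = gmono ?U (?\<kappa> \<odot> ?g w)"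
    if "w \<in> Poly_Mapping.keys f" for w
  proof -
    have "distinct (letters w)" "set (letters w) = {..<n}" using f that by (auto simp: multilinear_in_def)
    then show ?thesis using \<rho>c fin list_gcoeff_eq[of "letters w" S \<pi>, where 'f='f] par
      by (simp add: eval_nword_mono koszul_sign_letters scale_scale mult_ac flip: mono_scale del: G_simps)
  qed
  \<comment> \<open>The parity of each summand is read off from the envelope: the left side of the
    previous fact lies in it because products do, and membership of a monomial fixes the parity of
    its coefficient.\<close>
  have "gmono ?U (?\<kappa> \<odot> ?g w) \<in> carrier G" if "w \<in> Poly_Mapping.keys f" for w
    unfolding w[OF that, symmetric] using mc by (auto simp del: G_simps)
  then have h: "?\<kappa> \<odot> ?g w \<in> homog A (of_nat (card ?U))" if "w \<in> Poly_Mapping.keys f" for w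
    using fin that by (subst (asm) mono_in_carrier_iff) auto
  have "eval_npoly G (\<lambda>i. gmono (S i) (\<rho> i)) f = (\<Oplus>\<^bsub>G\<^esub>w\<in>Poly_Mapping.keys f. gmono ?U (?\<kappa> \<odot> ?g w))"
    unfolding eval_npoly_def by (rule G.M.finsum_cong') (use w h fin in \<open>auto simp: mono_closed simp del: G_simps\<close>)
  also have "\<dots> = gmono ?U (\<Oplus>w\<in>Poly_Mapping.keys f. ?\<kappa> \<odot> ?g w)"
    by (rule mono_finsum) (use fin h in auto)
  also have "(\<Oplus>w\<in>Poly_Mapping.keys f. ?\<kappa> \<odot> ?g w) = ?\<kappa> \<odot> eval_superization A \<pi> \<rho> f"
    unfolding eval_superization_def using \<rho>c by (intro finsum_scale[symmetric]) auto
  finally show ?thesis .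
qed

lemma eval_superization_closed [simp]:
  "(\<And>i. \<rho> i \<in> homog A (\<pi> i)) \<Longrightarrow> eval_superization A \<pi> \<rho> f \<in> carrier A"
  unfolding eval_superization_eq by (rule eval_npoly_closed) (use homog_closed in blast)

lemma G_span:
  assumes "u \<in> carrier G"
  shows "u \<in> nonassoc_algebra.lspan G {gmono S a |S a. finite S \<and> a \<in> homog A (of_nat (card S))}"
proof -
  interpret G: nonassoc_algebra G by (rule G_nonassoc_algebra)
  let ?M = "{gmono S a |S a. finite S \<and> a \<in> homog A (of_nat (card S))}"
  have "u \<in> G.lspan ?M" if "finite F" "u \<in> carrier G" "{S. u S \<noteq> \<zero>} \<subseteq> F" for F u
    using that
  proof (induction F arbitrary: u)
    case empty
    then have "u = \<zero>\<^bsub>G\<^esub>" by auto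
    then show ?case using G.lspan_zero by simp
  next
    case (insert S F)
    show ?case
    proof (cases "u S = \<zero>")
      case True
      then show ?thesis using insert by (intro insert.IH) auto
    next
      case False
      then have S: "finite S" "u S \<in> homog A (of_nat (card S))" using insert.prems by (auto simp: G_carrier)
      let ?v = "u(S := \<zero>)"
      have "finite {T. ?v T \<noteq> \<zero>}"
        by (rule finite_subset[of _ "{T. u T \<noteq> \<zero>}"]) (use insert.prems in \<open>auto simp: G_carrier\<close>)
      then have v: "?v \<in> carrier G" using insert.prems by (auto simp: G_carrier)
      moreover have "{T. ?v T \<noteq> \<zero>} \<subseteq> F" using insert.prems by auto
      ultimately have "?v \<in> G.lspan ?M" by (rule insert.IH)
      moreover have "gmono S (u S) \<in> G.lspan ?M" using S by (intro G.lspan_base) auto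
      ultimately have "gmono S (u S) \<oplus>\<^bsub>G\<^esub> ?v \<in> G.lspan ?M" by (intro G.lspan_add)
      moreover have "gmono S (u S) \<oplus>\<^bsub>G\<^esub> ?v = u"
        using insert.prems S by (auto simp: gmono_def fun_eq_iff)
      ultimately show ?thesis by simp
    qed
  qed
  then show ?thesis using assms by (auto simp: G_carrier)
qed

text \<open>One direction evaluates at monomials with disjoint index sets, where the Grassmann
  coefficient is invertible. For the other, monomials span the envelope and a multilinear polynomial
  need only be tested on them.\<close>

theorem satisfies_envelope_iff:
  assumes f: "multilinear f"
  shows "satisfies G f \<longleftrightarrow> super_satisfies A f"
proof
  interpret G: nonassoc_algebra G by (rule G_nonassoc_algebra)
  from f obtain n where n: "multilinear_in n f" by (auto simp: multilinear_iff)
  show "super_satisfies A f" if "satisfies G f"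
    unfolding super_satisfies_def
  proof (intro allI impI)
    fix \<pi> :: "nat \<Rightarrow> bit" and \<rho> assume \<rho>: "\<forall>x. \<rho> x \<in> homog A (\<pi> x)"
    \<comment> \<open>The smallest disjoint index sets of the required parity: the empty set for an
      even variable and the singleton of its own number for an odd one.\<close>
    define S where "S i = (if \<pi> i = 0 then {} else {i})" for i :: nat
    have S: "finite (S i)" "\<pi> i = of_nat (card (S i))" for i by (auto simp: S_def)
    have "gmono (S i) (\<rho> i) \<in> carrier G" for i
      using \<rho> S(1) by (intro mono_closed) (simp_all flip: S(2))
    then have "eval_npoly G (\<lambda>i. gmono (S i) (\<rho> i)) f = \<zero>\<^bsub>G\<^esub>"
      by (intro that[unfolded satisfies_def, rule_format]) auto
    then have "gmono (\<Union>i<n. S i) (sorted_gcoeff S {..<n} \<odot> eval_superization A \<pi> \<rho> f) = \<zero>\<^bsub>G\<^esub>"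
      using eval_npoly_mono[OF n S(1) S(2)] \<rho> by simp
    then have "sorted_gcoeff S {..<n} \<odot> eval_superization A \<pi> \<rho> f = \<zero>"
      by (auto simp: gmono_def fun_eq_iff split: if_splits)
    moreover have "sorted_gcoeff S {..<n} \<noteq> (0::'f)"
    proof -
      have "finite {(i, j). i \<in> {..<n} \<and> j \<in> {..<n} \<and> i < j}"
        by (rule finite_subset[of _ "{..<n} \<times> {..<n}"]) auto
      then show ?thesis by (auto simp: sorted_gcoeff_def gcoeff_def S_def)
    qed
    ultimately show "eval_superization A \<pi> \<rho> f = \<zero>"
      using scale_cancel \<rho> by auto
  qed
  show "satisfies G f" if sat: "super_satisfies A f"
    unfolding satisfies_def
  proof (intro allI impI)
    fix \<sigma> :: "nat \<Rightarrow> nat set \<Rightarrow> 'a" assume \<sigma>: "range \<sigma> \<subseteq> carrier G"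
    let ?M = "{gmono S a |S a. finite S \<and> a \<in> homog A (of_nat (card S))}"
    show "eval_npoly G \<sigma> f = \<zero>\<^bsub>G\<^esub>"
    proof (rule G.multilinear_vanish_on_span[OF n, where G="\<lambda>_. ?M"])
      show "?M \<subseteq> carrier G" using mono_closed by auto
      fix \<tau> :: "nat \<Rightarrow> nat set \<Rightarrow> 'a" assume \<tau>: "\<And>i. i < n \<Longrightarrow> \<tau> i \<in> ?M"
      \<comment> \<open>Variables not occurring in \<open>f\<close> receive the zero monomial, so
        that \<open>S\<close> and \<open>a\<close> are defined for all indices.\<close>
      have "\<exists>S a. finite S \<and> a \<in> homog A (of_nat (card S)) \<and> (i < n \<longrightarrow> \<tau> i = gmono S a)" for i
      proof (cases "i < n")
        case False
        have "finite {} \<and> \<zero> \<in> homog A (of_nat (card {})) \<and> (i < n \<longrightarrow> \<tau> i = gmono {} \<zero>)"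
          using False by simp
        then show ?thesis by blast
      qed (use \<tau>[of i] in blast)
      then obtain S a where S: "\<And>i. finite (S i)" "\<And>i. a i \<in> homog A (of_nat (card (S i)))"
        "\<And>i. i < n \<Longrightarrow> \<tau> i = gmono (S i) (a i)" by metis
      have "eval_npoly G \<tau> f = eval_npoly G (\<lambda>i. gmono (S i) (a i)) f"
        using n S by (intro G.eval_npoly_cong) (auto simp: multilinear_in_def mono_closed simp del: G_simps)
      also have "\<dots> = gmono (\<Union>i<n. S i) (sorted_gcoeff S {..<n} \<odot>
          eval_superization A (\<lambda>i. of_nat (card (S i))) a f)"
        using S by (intro eval_npoly_mono[OF n]) auto
      also have "eval_superization A (\<lambda>i. of_nat (card (S i))) a f = \<zero>"
        by (rule sat[unfolded super_satisfies_def, rule_format]) (rule S(2))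
      finally show "eval_npoly G \<tau> f = \<zero>\<^bsub>G\<^esub>" by (simp add: mono_zero del: G_simps)
    qed (use \<sigma> G_span in auto)
  qed
qed

end

text \<open>Replaces membership of the envelope in the variety by three superidentities of the
  superalgebra itself; all later membership proofs and the construction of the free object go
  through this form.\<close>

theorem super_class_alt_metabelian_iff:
  fixes A :: "('f::field_char_0, 'a) superalgebra"
  shows "A \<in> super_class alt_metabelian \<longleftrightarrow> is_superalgebra A \<and>
    super_satisfies A lin_alt_left \<and> super_satisfies A lin_alt_right \<and> super_satisfies A metab"
proof (cases "is_superalgebra A")
  case True
  then interpret is_superalgebra A .
  have "multilinear (lin_alt_left :: (nat, 'f) npoly)" "multilinear (lin_alt_right :: (nat, 'f) npoly)"
    "multilinear (metab :: (nat, 'f) npoly)"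
    using multilinear_linearizations multilinear_iff by blast+
  then show ?thesis using True
    by (simp add: super_class_def variety_alt_metabelian_linearized[OF G_nonassoc_algebra] satisfies_envelope_iff)
qed (simp add: super_class_def)

lemma super_class_alt_ideal:
  fixes A :: "('f::field_char_0, 'a) superalgebra"
  assumes "A \<in> super_class alt_metabelian" "f \<in> alt_ideal" "multilinear f"
  shows "super_satisfies A f"
proof -
  interpret is_superalgebra A using assms(1) by (simp add: super_class_def)
  show ?thesis
    using alt_ideal_satisfied[of G f] assms satisfies_envelope_iff[of f] by (simp add: super_class_def)
qed

section \<open>Homomorphic images and quotients\<close>

definition alg_hom :: "('f::field, 'a, 'm) module_scheme \<Rightarrow> ('f, 'b, 'n) module_scheme \<Rightarrow> ('a \<Rightarrow> 'b) \<Rightarrow> bool" where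
  "alg_hom A B \<phi> \<longleftrightarrow> (\<forall>x\<in>carrier A. \<phi> x \<in> carrier B) \<and>
     (\<forall>x\<in>carrier A. \<forall>y\<in>carrier A. \<phi> (x \<oplus>\<^bsub>A\<^esub> y) = \<phi> x \<oplus>\<^bsub>B\<^esub> \<phi> y) \<and>
     (\<forall>x\<in>carrier A. \<forall>y\<in>carrier A. \<phi> (x \<otimes>\<^bsub>A\<^esub> y) = \<phi> x \<otimes>\<^bsub>B\<^esub> \<phi> y) \<and>
     (\<forall>c. \<forall>x\<in>carrier A. \<phi> (c \<odot>\<^bsub>A\<^esub> x) = c \<odot>\<^bsub>B\<^esub> \<phi> x)"

lemma alg_homD:
  assumes "alg_hom A B \<phi>"
  shows "x \<in> carrier A \<Longrightarrow> \<phi> x \<in> carrier B"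
    and "x \<in> carrier A \<Longrightarrow> y \<in> carrier A \<Longrightarrow> \<phi> (x \<oplus>\<^bsub>A\<^esub> y) = \<phi> x \<oplus>\<^bsub>B\<^esub> \<phi> y"
    and "x \<in> carrier A \<Longrightarrow> y \<in> carrier A \<Longrightarrow> \<phi> (x \<otimes>\<^bsub>A\<^esub> y) = \<phi> x \<otimes>\<^bsub>B\<^esub> \<phi> y"
    and "x \<in> carrier A \<Longrightarrow> \<phi> (c \<odot>\<^bsub>A\<^esub> x) = c \<odot>\<^bsub>B\<^esub> \<phi> x"
  using assms by (auto simp: alg_hom_def)

lemma alg_hom_zero:
  assumes "alg_hom A B \<phi>" "nonassoc_algebra A" "nonassoc_algebra B"
  shows "\<phi> \<zero>\<^bsub>A\<^esub> = \<zero>\<^bsub>B\<^esub>"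
proof -
  interpret A: nonassoc_algebra A by fact
  interpret B: nonassoc_algebra B by fact
  show ?thesis
    using alg_homD(4)[OF assms(1), of "\<zero>\<^bsub>A\<^esub>" 0] alg_homD(1)[OF assms(1), of "\<zero>\<^bsub>A\<^esub>"] by simp
qed

lemma alg_hom_eval_npoly:
  assumes \<phi>: "alg_hom A B \<phi>" and A: "nonassoc_algebra A" and B: "nonassoc_algebra B"
    and \<rho>: "range \<rho> \<subseteq> carrier A"
  shows "\<phi> (eval_npoly A \<rho> f) = eval_npoly B (\<lambda>x. \<phi> (\<rho> x)) f"
proof -
  interpret A: nonassoc_algebra A by fact
  interpret B: nonassoc_algebra B by fact
  have w: "\<phi> (eval_nword A \<rho> w) = eval_nword B (\<lambda>x. \<phi> (\<rho> x)) w" for w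
    using \<rho> by (induction w) (auto simp: alg_homD(3)[OF \<phi>])
  have sum: "\<phi> (\<Oplus>\<^bsub>A\<^esub>i\<in>K. g i) = (\<Oplus>\<^bsub>B\<^esub>i\<in>K. \<phi> (g i))" if "\<And>i. i \<in> K \<Longrightarrow> g i \<in> carrier A" for g K
    using that
  proof (induction K rule: infinite_finite_induct)
    case (insert x F)
    then show ?case
      by (subst A.M.finsum_insert, simp, simp, simp, simp, subst B.M.finsum_insert)
        (auto simp: alg_homD(1,2)[OF \<phi>])
  qed (auto simp: A.M.finsum_infinite B.M.finsum_infinite alg_hom_zero[OF \<phi> A B])
  have "\<phi> (eval_npoly A \<rho> f) = (\<Oplus>\<^bsub>B\<^esub>w\<in>Poly_Mapping.keys f. \<phi> (Poly_Mapping.lookup f w \<odot>\<^bsub>A\<^esub> eval_nword A \<rho> w))"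
    unfolding eval_npoly_def by (rule sum) (use \<rho> in auto)
  also have "(\<lambda>w. \<phi> (Poly_Mapping.lookup f w \<odot>\<^bsub>A\<^esub> eval_nword A \<rho> w)) =
      (\<lambda>w. Poly_Mapping.lookup f w \<odot>\<^bsub>B\<^esub> eval_nword B (\<lambda>x. \<phi> (\<rho> x)) w)"
    using \<rho> by (simp add: w alg_homD(4)[OF \<phi>])
  finally show ?thesis by (simp add: eval_npoly_def)
qed

lemma alg_hom_eval_superization:
  assumes "alg_hom A B \<phi>" "is_superalgebra A" "is_superalgebra B" "\<And>x. \<rho> x \<in> homog A (\<pi> x)"
  shows "\<phi> (eval_superization A \<pi> \<rho> f) = eval_superization B \<pi> (\<lambda>x. \<phi> (\<rho> x)) f"
proof -
  interpret A: is_superalgebra A by fact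
  interpret B: is_superalgebra B by fact
  have "range \<rho> \<subseteq> carrier A" using assms(4) A.homog_closed by blast
  then show ?thesis unfolding eval_superization_eq
    by (intro alg_hom_eval_npoly assms A.nonassoc_algebra_axioms B.nonassoc_algebra_axioms)
qed

lemma homog_sum_iff: "x \<in> P <+>\<^bsub>A\<^esub> Q \<longleftrightarrow> (\<exists>a\<in>P. \<exists>b\<in>Q. x = a \<oplus>\<^bsub>A\<^esub> b)"
  by (auto simp: set_add_def')

text \<open>All equational axioms pass to a homomorphic image; only the intersection of the two
  homogeneous parts can grow and must be checked separately. This serves both quotients and
  transport along an injection.\<close>

lemma is_superalgebra_image:
  fixes A :: "('f::field, 'a) superalgebra" and B :: "('f, 'b) superalgebra"
  assumes A: "is_superalgebra A" and \<phi>: "alg_hom A B \<phi>" and car: "carrier B = \<phi> ` carrier A"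
    and zero: "\<phi> \<zero>\<^bsub>A\<^esub> = \<zero>\<^bsub>B\<^esub>" and hom: "\<And>i. homog B i = \<phi> ` homog A i"
    and int: "homog B 0 \<inter> homog B 1 \<subseteq> {\<zero>\<^bsub>B\<^esub>}"
  shows "is_superalgebra B"
proof -
  interpret A: is_superalgebra A by fact
  note h = alg_homD(2,3,4)[OF \<phi>, symmetric]
  have ag: "abelian_group B"
  proof (rule abelian_groupI)
    show "\<zero>\<^bsub>B\<^esub> \<in> carrier B" using zero car by (metis A.M.zero_closed imageI)
    show "\<exists>y\<in>carrier B. y \<oplus>\<^bsub>B\<^esub> x = \<zero>\<^bsub>B\<^esub>" if x: "x \<in> carrier B" for x
    proof -
      obtain a where a: "a \<in> carrier A" "x = \<phi> a" using x car by auto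
      show ?thesis
        by (rule bexI[of _ "\<phi> (\<ominus>\<^bsub>A\<^esub> a)"]) (use a car zero h in \<open>auto simp: A.M.l_neg\<close>)
    qed
    show "\<zero>\<^bsub>B\<^esub> \<oplus>\<^bsub>B\<^esub> x = x" if "x \<in> carrier B" for x
      using that unfolding car zero[symmetric] by (auto simp: h)
  qed (auto simp: car h A.M.a_ac A.mult_closed)
  have sm: "module (ring_of_type_algebra :: 'f ring) B"
  proof (rule moduleI[OF A.R.is_cring ag])
    fix a b :: 'f and x y assume "x \<in> carrier B" "y \<in> carrier B"
    then obtain u v where u: "u \<in> carrier A" "x = \<phi> u" and v: "v \<in> carrier A" "y = \<phi> v"
      using car by auto
    show "a \<odot>\<^bsub>B\<^esub> (x \<oplus>\<^bsub>B\<^esub> y) = a \<odot>\<^bsub>B\<^esub> x \<oplus>\<^bsub>B\<^esub> a \<odot>\<^bsub>B\<^esub> y"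
      using u v by (simp add: h A.scale_add_right)
  next
    fix a b :: 'f and x assume "x \<in> carrier B"
    then obtain u where u: "u \<in> carrier A" "x = \<phi> u" using car by auto
    show "a \<odot>\<^bsub>B\<^esub> x \<in> carrier B" using u by (simp add: h car)
    show "(a \<oplus>\<^bsub>ring_of_type_algebra\<^esub> b) \<odot>\<^bsub>B\<^esub> x = a \<odot>\<^bsub>B\<^esub> x \<oplus>\<^bsub>B\<^esub> b \<odot>\<^bsub>B\<^esub> x"
      using u by (simp add: h A.scale_add_left)
    show "(a \<otimes>\<^bsub>ring_of_type_algebra\<^esub> b) \<odot>\<^bsub>B\<^esub> x = a \<odot>\<^bsub>B\<^esub> (b \<odot>\<^bsub>B\<^esub> x)"
      using u by (simp add: h A.scale_scale)
    show "\<one>\<^bsub>ring_of_type_algebra\<^esub> \<odot>\<^bsub>B\<^esub> x = x"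
      using u by (simp add: h)
  qed
  have na: "nonassoc_algebra B"
  proof (rule nonassoc_algebra.intro[OF sm], unfold_locales)
    fix x y z c assume "x \<in> carrier B" "y \<in> carrier B"
    then obtain u v where u: "u \<in> carrier A" "x = \<phi> u" and v: "v \<in> carrier A" "y = \<phi> v"
      using car by auto
    show "x \<otimes>\<^bsub>B\<^esub> y \<in> carrier B" using u v by (simp add: h car)
    show "(c \<odot>\<^bsub>B\<^esub> x) \<otimes>\<^bsub>B\<^esub> y = c \<odot>\<^bsub>B\<^esub> (x \<otimes>\<^bsub>B\<^esub> y)" using u v by (simp add: h A.mult_smult_left)
    show "x \<otimes>\<^bsub>B\<^esub> (c \<odot>\<^bsub>B\<^esub> y) = c \<odot>\<^bsub>B\<^esub> (x \<otimes>\<^bsub>B\<^esub> y)" using u v by (simp add: h A.mult_smult_right)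
    assume "z \<in> carrier B"
    then obtain w where w: "w \<in> carrier A" "z = \<phi> w" using car by auto
    show "(x \<oplus>\<^bsub>B\<^esub> y) \<otimes>\<^bsub>B\<^esub> z = x \<otimes>\<^bsub>B\<^esub> z \<oplus>\<^bsub>B\<^esub> y \<otimes>\<^bsub>B\<^esub> z"
      using u v w by (simp add: h A.mult_add_left)
    show "x \<otimes>\<^bsub>B\<^esub> (y \<oplus>\<^bsub>B\<^esub> z) = x \<otimes>\<^bsub>B\<^esub> y \<oplus>\<^bsub>B\<^esub> x \<otimes>\<^bsub>B\<^esub> z"
      using u v w by (simp add: h A.mult_add_right)
  qed
  interpret B: nonassoc_algebra B by fact
  show ?thesis
  proof (rule is_superalgebra.intro[OF na], rule is_superalgebra_axioms.intro)
    fix i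
    show "submodule (homog B i) (ring_of_type_algebra :: 'f ring) B"
    proof (rule B.submoduleI)
      show "homog B i \<subseteq> carrier B" using hom car by auto
      show "\<zero>\<^bsub>B\<^esub> \<in> homog B i" unfolding hom zero[symmetric] by simp
      show "\<ominus>\<^bsub>B\<^esub> a \<in> homog B i" if a: "a \<in> homog B i" for a
      proof -
        obtain b where b: "b \<in> homog A i" "a = \<phi> b" using a hom by auto
        have "a \<in> carrier B" using b car by auto
        then have "\<ominus>\<^bsub>B\<^esub> a = \<phi> ((-1) \<odot>\<^bsub>A\<^esub> b)"
          using b by (simp add: B.scale_minus_one[symmetric] alg_homD(4)[OF \<phi>] del: A.scale_minus_one)
        then show ?thesis using b hom by auto
      qed
    qed (auto simp: hom h)
  next
    show "carrier B = homog B 0 <+>\<^bsub>B\<^esub> homog B 1"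
    proof (intro equalityI subsetI)
      fix x assume "x \<in> carrier B"
      then obtain a where a: "a \<in> carrier A" "x = \<phi> a" using car by auto
      then obtain b c where "b \<in> homog A 0" "c \<in> homog A 1" "a = b \<oplus>\<^bsub>A\<^esub> c"
        using A.homog_sum homog_sum_iff by metis
      then show "x \<in> homog B 0 <+>\<^bsub>B\<^esub> homog B 1"
        using a by (auto simp: homog_sum_iff hom alg_homD(2)[OF \<phi>])
    qed (auto simp: homog_sum_iff hom h car)
    show "homog B 0 \<inter> homog B 1 = {\<zero>\<^bsub>B\<^esub>}"
      using int unfolding hom zero[symmetric] by auto
    fix x y i j assume "x \<in> homog B i" "y \<in> homog B j"
    then obtain u v where u: "u \<in> homog A i" "x = \<phi> u" and v: "v \<in> homog A j" "y = \<phi> v"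
      using hom by auto
    have "x \<otimes>\<^bsub>B\<^esub> y = \<phi> (u \<otimes>\<^bsub>A\<^esub> v)" using u v by (simp add: h)
    then show "x \<otimes>\<^bsub>B\<^esub> y \<in> homog B (i + j)"
      using A.homog_mult[OF u(1) v(1)] hom by auto
  qed
qed

context is_superalgebra
begin

lemma minus_eq_zeroD:
  assumes "x \<ominus> y = \<zero>" "x \<in> carrier A" "y \<in> carrier A" shows "x = y"
proof -
  have "x = (x \<ominus> y) \<oplus> y" using assms(2,3) by (simp add: a_minus_def M.a_assoc M.l_neg)
  then show ?thesis using assms by simp
qed

lemma homog_unique:
  assumes "a \<in> homog A 0" "b \<in> homog A 1" "a' \<in> homog A 0" "b' \<in> homog A 1" "a \<oplus> b = a' \<oplus> b'"
  shows "a = a'" "b = b'"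
proof -
  have car: "a \<in> carrier A" "b \<in> carrier A" "a' \<in> carrier A" "b' \<in> carrier A"
    using assms homog_closed by auto
  have "a \<ominus> a' = (a \<oplus> b) \<oplus> (\<ominus> b \<oplus> \<ominus> a')"
    using car by (simp add: a_minus_def M.a_assoc M.r_neg2)
  also have "\<dots> = (b' \<oplus> a') \<oplus> (\<ominus> a' \<oplus> \<ominus> b)"
    using car assms(5) by (simp add: M.a_comm)
  also have "\<dots> = b' \<ominus> b"
    using car by (simp add: a_minus_def M.a_assoc M.r_neg2)
  finally have "a \<ominus> a' = b' \<ominus> b" .
  moreover have "a \<ominus> a' \<in> homog A 0" "b' \<ominus> b \<in> homog A 1"
    using assms by (simp_all add: a_minus_def)
  ultimately have "a \<ominus> a' = \<zero>" "b' \<ominus> b = \<zero>" using homog_Int by auto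
  then show "a = a'" "b = b'" using car minus_eq_zeroD by auto
qed

lemma graded_idealI:
  assumes sub: "submodule I (ring_of_type_algebra :: 'f ring) A"
    and "\<And>a x. \<lbrakk>a \<in> carrier A; x \<in> I\<rbrakk> \<Longrightarrow> a \<otimes> x \<in> I"
    and "\<And>a x. \<lbrakk>a \<in> carrier A; x \<in> I\<rbrakk> \<Longrightarrow> x \<otimes> a \<in> I"
    and gr: "\<And>x y. \<lbrakk>x \<in> homog A 0; y \<in> homog A 1; x \<oplus> y \<in> I\<rbrakk> \<Longrightarrow> x \<in> I \<and> y \<in> I"
  shows "graded_ideal I A"
proof (rule graded_ideal.intro[OF is_superalgebra_axioms], rule graded_ideal_axioms.intro)
  note s = submoduleE[OF sub]
  show "I = (I \<inter> homog A 0) <+> (I \<inter> homog A 1)"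
  proof (intro equalityI subsetI)
    fix x assume x: "x \<in> I"
    then obtain a b where ab: "a \<in> homog A 0" "b \<in> homog A 1" "x = a \<oplus> b"
      using s(1) homog_sum homog_sum_iff by (metis subsetD)
    then have "a \<in> I \<and> b \<in> I" using gr x by blast
    then show "x \<in> (I \<inter> homog A 0) <+> (I \<inter> homog A 1)" using ab unfolding homog_sum_iff by blast
  qed (use s(5) in \<open>auto simp: homog_sum_iff\<close>)
qed fact+

end

context graded_ideal
begin

lemma graded_split:
  assumes "x \<in> homog A 0" "y \<in> homog A 1" "x \<oplus> y \<in> I"
  shows "x \<in> I" "y \<in> I"
proof -
  have "x \<oplus> y \<in> (I \<inter> homog A 0) <+> (I \<inter> homog A 1)"
    using assms(3) by (subst (asm) ideal_graded)
  then obtain a b where ab: "a \<in> I" "a \<in> homog A 0" "b \<in> I" "b \<in> homog A 1" "x \<oplus> y = a \<oplus> b"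
    by (auto simp: homog_sum_iff)
  show "x \<in> I" "y \<in> I"
    using homog_unique[OF assms(1,2) ab(2,4,5)] ab by auto
qed

lemma ideal_abelian_subgroup: "abelian_subgroup I A"
  using ideal_submodule submodule.axioms(1) abelian_subgroupI3 M.abelian_group_axioms
  by (metis additive_subgroup.intro)

sublocale I: abelian_subgroup I A by (rule ideal_abelian_subgroup)

lemma ideal_subset: "I \<subseteq> carrier A" and ideal_add: "x \<in> I \<Longrightarrow> y \<in> I \<Longrightarrow> x \<oplus> y \<in> I"
  and ideal_minus: "x \<in> I \<Longrightarrow> \<ominus> x \<in> I" and ideal_scale: "x \<in> I \<Longrightarrow> c \<odot> x \<in> I"
  using submoduleE[OF ideal_submodule] by auto

lemma coset_eq_iff:
  assumes "x \<in> carrier A" "y \<in> carrier A"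
  shows "I +> x = I +> y \<longleftrightarrow> x \<ominus> y \<in> I"
  using assms I.a_rcos_module I.a_repr_independence' I.a_repr_independenceD
  by (metis a_minus_def)

lemma coset_elem:
  assumes "a \<in> carrier A" "x \<in> I +> a"
  obtains i where "i \<in> I" "x = i \<oplus> a"
  using assms by (auto simp: a_r_coset_def')

lemma coset_eqI: "x \<in> carrier A \<Longrightarrow> i \<in> I \<Longrightarrow> I +> (i \<oplus> x) = I +> x"
  using ideal_subset by (subst coset_eq_iff) (auto simp: a_minus_def M.a_assoc M.r_neg subset_iff)

end

lemma quotient_hom:
  fixes A :: "('f::field, 'a) superalgebra" (structure)
  assumes "graded_ideal I A"
  shows "alg_hom A (super_quotient A I) (\<lambda>a. I +> a)"
proof -
  interpret graded_ideal I A by fact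
  show ?thesis unfolding alg_hom_def
proof (intro conjI ballI allI)
  fix x y c assume x: "x \<in> carrier A"
  show "I +> x \<in> carrier (super_quotient A I)"
    using x by (auto simp: super_quotient_def A_RCOSETS_def')
  have 1: "I +> (c \<odot> z) = I +> (c \<odot> x)" if "z \<in> I +> x" for z
  proof -
    obtain i where i: "i \<in> I" "z = i \<oplus> x" using coset_elem[OF x \<open>z \<in> I +> x\<close>] .
    then show ?thesis using x ideal_scale ideal_subset
      by (auto simp: scale_add_right subset_iff intro!: coset_eqI)
  qed
  have 2: "x \<in> I +> x" using x by (rule I.a_rcos_self)
  have "c \<odot>\<^bsub>super_quotient A I\<^esub> (I +> x) = (\<Union>z\<in>I +> x. I +> (c \<odot> z))"
    by (simp add: super_quotient_def)
  also have "\<dots> = (\<Union>z\<in>I +> x. I +> (c \<odot> x))" by (rule SUP_cong[OF refl 1])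
  also have "\<dots> = I +> (c \<odot> x)" using 2 by blast
  finally show "I +> (c \<odot> x) = c \<odot>\<^bsub>super_quotient A I\<^esub> (I +> x)" ..
  assume y: "y \<in> carrier A"
  show "I +> (x \<oplus> y) = (I +> x) \<oplus>\<^bsub>super_quotient A I\<^esub> (I +> y)"
    using x y by (simp add: super_quotient_def I.a_rcos_sum)
  have 3: "I +> (u \<otimes> v) = I +> (x \<otimes> y)" if "u \<in> I +> x" "v \<in> I +> y" for u v
  proof -
    obtain i where i: "i \<in> I" "u = i \<oplus> x" using coset_elem[OF x \<open>u \<in> I +> x\<close>] .
    obtain j where j: "j \<in> I" "v = j \<oplus> y" using coset_elem[OF y \<open>v \<in> I +> y\<close>] .
    have ij: "i \<in> carrier A" "j \<in> carrier A" using i j ideal_subset by auto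
    have "u \<otimes> v = (i \<otimes> j \<oplus> x \<otimes> j \<oplus> i \<otimes> y) \<oplus> x \<otimes> y"
      using i j ij x y by (simp add: mult_add_left mult_add_right M.a_ac)
    moreover have "i \<otimes> j \<oplus> x \<otimes> j \<oplus> i \<otimes> y \<in> I"
      using i j ij x y by (intro ideal_add ideal_mult_left ideal_mult_right) auto
    ultimately show ?thesis using coset_eqI x y by simp
  qed
  have 4: "y \<in> I +> y" using y by (rule I.a_rcos_self)
  have "(I +> x) \<otimes>\<^bsub>super_quotient A I\<^esub> (I +> y) = (\<Union>u\<in>I +> x. \<Union>v\<in>I +> y. I +> (u \<otimes> v))"
    by (simp add: super_quotient_def rcoset_mult_def)
  also have "\<dots> = (\<Union>u\<in>I +> x. \<Union>v\<in>I +> y. I +> (x \<otimes> y))"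
    by (intro SUP_cong refl 3)
  also have "\<dots> = I +> (x \<otimes> y)" using 2 4 by blast
  finally show "I +> (x \<otimes> y) = (I +> x) \<otimes>\<^bsub>super_quotient A I\<^esub> (I +> y)" ..
qed
qed

lemma super_quotient_is_superalgebra:
  fixes A :: "('f::field, 'a) superalgebra"
  assumes "graded_ideal I A"
  shows "is_superalgebra (super_quotient A I)"
proof -
  interpret graded_ideal I A by fact
  show ?thesis
  proof (rule is_superalgebra_image[OF is_superalgebra_axioms quotient_hom[OF assms]])
    have zI: "\<zero>\<^bsub>A\<^esub> \<in> I" by (rule I.zero_closed)
    have const: "I +>\<^bsub>A\<^esub> i = I" if "i \<in> I" for i using that by (rule I.a_rcos_const)
    show "I +>\<^bsub>A\<^esub> \<zero>\<^bsub>A\<^esub> = \<zero>\<^bsub>super_quotient A I\<^esub>"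
      using const zI by (simp add: super_quotient_def)
    show "homog (super_quotient A I) 0 \<inter> homog (super_quotient A I) 1 \<subseteq> {\<zero>\<^bsub>super_quotient A I\<^esub>}"
    proof
      fix C assume "C \<in> homog (super_quotient A I) 0 \<inter> homog (super_quotient A I) 1"
      then obtain a b where ab: "a \<in> homog A 0" "b \<in> homog A 1" "C = I +>\<^bsub>A\<^esub> a" "C = I +>\<^bsub>A\<^esub> b"
        by (auto simp: super_quotient_def)
      then have "a \<ominus>\<^bsub>A\<^esub> b \<in> I" using coset_eq_iff homog_closed by metis
      then have "a \<in> I" using graded_split[of a "\<ominus>\<^bsub>A\<^esub> b"] ab by (simp add: a_minus_def)
      then show "C \<in> {\<zero>\<^bsub>super_quotient A I\<^esub>}" using const ab by (simp add: super_quotient_def)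
    qed
  qed (auto simp: super_quotient_def A_RCOSETS_def')
qed

text \<open>Homogeneous elements of the quotient are cosets of homogeneous elements, so every
  assignment lifts, and a value is zero in the quotient exactly when its lift lies in the
  ideal.\<close>

lemma super_quotient_satisfies_iff:
  fixes A :: "('f::field, 'a) superalgebra"
  assumes "graded_ideal I A"
  shows "super_satisfies (super_quotient A I) f \<longleftrightarrow>
    (\<forall>\<pi> \<rho>. (\<forall>x. \<rho> x \<in> homog A (\<pi> x)) \<longrightarrow> eval_superization A \<pi> \<rho> f \<in> I)"
proof -
  interpret graded_ideal I A by fact
  let ?Q = "super_quotient A I"
  note sQ = super_quotient_is_superalgebra[OF assms]
  have zero: "\<zero>\<^bsub>?Q\<^esub> = I" by (simp add: super_quotient_def)
  have eval: "eval_superization ?Q \<pi> (\<lambda>x. I +>\<^bsub>A\<^esub> \<rho> x) f = \<zero>\<^bsub>?Q\<^esub> \<longleftrightarrow> eval_superization A \<pi> \<rho> f \<in> I"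
    if \<rho>: "\<forall>x. \<rho> x \<in> homog A (\<pi> x)" for \<pi> \<rho>
  proof -
    have "eval_superization ?Q \<pi> (\<lambda>x. I +>\<^bsub>A\<^esub> \<rho> x) f = I +>\<^bsub>A\<^esub> eval_superization A \<pi> \<rho> f"
      using \<rho> by (intro alg_hom_eval_superization[symmetric] quotient_hom[OF assms] is_superalgebra_axioms sQ) auto
    moreover have "I +>\<^bsub>A\<^esub> y = I \<longleftrightarrow> y \<in> I" if "y \<in> carrier A" for y
      using I.a_rcos_const I.a_rcos_self that by metis
    ultimately show ?thesis using zero eval_superization_closed \<rho> by simp
  qed
  show ?thesis
  proof
    assume *: "super_satisfies ?Q f"
    show "\<forall>\<pi> \<rho>. (\<forall>x. \<rho> x \<in> homog A (\<pi> x)) \<longrightarrow> eval_superization A \<pi> \<rho> f \<in> I"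
    proof (intro allI impI)
      fix \<pi> :: "nat \<Rightarrow> bit" and \<rho> assume \<rho>: "\<forall>x. \<rho> x \<in> homog A (\<pi> x)"
      then have "\<forall>x. I +>\<^bsub>A\<^esub> \<rho> x \<in> homog ?Q (\<pi> x)" by (simp add: super_quotient_def)
      then have "eval_superization ?Q \<pi> (\<lambda>x. I +>\<^bsub>A\<^esub> \<rho> x) f = \<zero>\<^bsub>?Q\<^esub>"
        by (intro *[unfolded super_satisfies_def, rule_format]) simp
      then show "eval_superization A \<pi> \<rho> f \<in> I" using eval[OF \<rho>] by simp
    qed
  next
    assume *: "\<forall>\<pi> \<rho>. (\<forall>x. \<rho> x \<in> homog A (\<pi> x)) \<longrightarrow> eval_superization A \<pi> \<rho> f \<in> I"
    show "super_satisfies ?Q f" unfolding super_satisfies_def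
    proof (intro allI impI)
      fix \<pi> :: "nat \<Rightarrow> bit" and \<rho> assume \<rho>: "\<forall>x. \<rho> x \<in> homog ?Q (\<pi> x)"
      then have "\<exists>a. a \<in> homog A (\<pi> x) \<and> \<rho> x = I +>\<^bsub>A\<^esub> a" for x
        by (auto simp: super_quotient_def)
      then obtain \<rho>' where \<rho>': "\<forall>x. \<rho>' x \<in> homog A (\<pi> x)" "\<rho> = (\<lambda>x. I +>\<^bsub>A\<^esub> \<rho>' x)" by metis
      then show "eval_superization ?Q \<pi> \<rho> f = \<zero>\<^bsub>?Q\<^esub>" using * eval by blast
    qed
  qed
qed

lemma graded_ideal_Inter:
  fixes A :: "('f::field, 'a) superalgebra"
  assumes A: "is_superalgebra A" and ne: "\<I> \<noteq> {}" and I: "\<And>I. I \<in> \<I> \<Longrightarrow> graded_ideal I A"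
  shows "graded_ideal (\<Inter>\<I>) A"
proof -
  interpret is_superalgebra A by fact
  have z: "\<zero>\<^bsub>A\<^esub> \<in> J" if "J \<in> \<I>" for J
    using abelian_subgroup.axioms(1)[OF graded_ideal.ideal_abelian_subgroup[OF I[OF that]]]
    by (rule additive_subgroup.zero_closed)
  show ?thesis
  proof (rule graded_idealI)
    show "submodule (\<Inter>\<I>) (ring_of_type_algebra :: 'f ring) A"
    proof (rule submoduleI)
      show "\<Inter>\<I> \<subseteq> carrier A" using ne graded_ideal.ideal_subset[OF I] by blast
    qed (use z in \<open>auto dest: I intro: graded_ideal.ideal_minus graded_ideal.ideal_add graded_ideal.ideal_scale\<close>)
    show "x \<in> \<Inter>\<I> \<and> y \<in> \<Inter>\<I>" if "x \<in> homog A 0" "y \<in> homog A 1" "x \<oplus>\<^bsub>A\<^esub> y \<in> \<Inter>\<I>" for x y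
      using that graded_ideal.graded_split[OF I] by (meson InterD InterI)
  qed (auto dest: I intro: graded_ideal.ideal_mult_left graded_ideal.ideal_mult_right)
qed

section \<open>The free superalgebras\<close>

lemma free_superalgebra_sel [simp]:
  "carrier (free_superalgebra r s) = free_carrier r s"
  "monoid.mult (free_superalgebra r s) = (\<star>)"
  "ring.zero (free_superalgebra r s) = 0"
  "add (free_superalgebra r s) = (+)"
  "module.smult (free_superalgebra r s) = nscale"
  by (simp_all add: free_superalgebra_def)

lemma homog_free_superalgebra: "homog (free_superalgebra r s) i =
    {p \<in> free_carrier r s. \<forall>w\<in>Poly_Mapping.keys p. nword_parity w = i}"
  by (simp add: free_superalgebra_def)

lemma keys_npoly_mult: "w \<in> Poly_Mapping.keys (p \<star> q) \<Longrightarrow>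
    \<exists>u\<in>Poly_Mapping.keys p. \<exists>v\<in>Poly_Mapping.keys q. w = Juxt u v"
proof (rule ccontr)
  assume w: "w \<in> Poly_Mapping.keys (p \<star> q)" and
    n: "\<not> (\<exists>u\<in>Poly_Mapping.keys p. \<exists>v\<in>Poly_Mapping.keys q. w = Juxt u v)"
  have "Poly_Mapping.lookup (p \<star> q) w = 0"
    unfolding npoly_mult_def lookup_sum using n
    by (intro sum.neutral ballI) (auto simp: lookup_single when_def)
  then show False using w by (simp add: in_keys_iff)
qed

lemma nword_parity_Juxt: "nword_parity (Juxt u v) = nword_parity u + nword_parity v"
  by (simp add: nword_parity_def)

lemma free_carrier_add: "p \<in> free_carrier r s \<Longrightarrow> q \<in> free_carrier r s \<Longrightarrow> p + q \<in> free_carrier r s"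
  using Poly_Mapping.keys_add[of p q] unfolding free_carrier_def by blast

lemma free_carrier_scale: "p \<in> free_carrier r s \<Longrightarrow> nscale c p \<in> free_carrier r s"
  using keys_nscale[of c p] unfolding free_carrier_def by blast

lemma free_carrier_mult:
  assumes "p \<in> free_carrier r s" "q \<in> free_carrier r s" shows "p \<star> q \<in> free_carrier r s"
  using assms unfolding free_carrier_def by (fastforce dest!: keys_npoly_mult)

lemma free_carrier_zero: "0 \<in> free_carrier r s"
  by (simp add: free_carrier_def)

lemma free_carrier_restrict:
  "p \<in> free_carrier r s \<Longrightarrow> Poly_Mapping.mapp (\<lambda>w c. if P w then c else 0) p \<in> free_carrier r s"
  by (auto simp: free_carrier_def in_keys_iff lookup_mapp when_def split: if_splits)

lemma nonassoc_algebra_free: "nonassoc_algebra (free_superalgebra r s :: ('f::field, _) superalgebra)"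
proof -
  let ?F = "free_superalgebra r s :: ('f, _) superalgebra"
  have ag: "abelian_group ?F"
  proof (rule abelian_groupI)
    show "\<exists>y\<in>carrier ?F. y \<oplus>\<^bsub>?F\<^esub> x = \<zero>\<^bsub>?F\<^esub>" if "x \<in> carrier ?F" for x
      by (rule bexI[of _ "nscale (-1) x"]) (use that in \<open>auto simp: nscale_minus_one intro: free_carrier_scale[of _ _ _ "-1", unfolded nscale_minus_one]\<close>)
  qed (auto simp: free_carrier_add free_carrier_zero add_ac)
  have "module (ring_of_type_algebra :: 'f ring) ?F"
  proof (rule moduleI[OF _ ag])
    show "cring (ring_of_type_algebra :: 'f ring)" by (rule cring_from_type_algebra)
  qed (auto simp: free_carrier_scale nscale_add nscale_add_left)
  then show ?thesis
    by (rule nonassoc_algebra.intro, unfold_locales)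
      (auto simp: free_carrier_mult npoly_mult_add_left npoly_mult_add_right
        npoly_mult_scale_left npoly_mult_scale_right)
qed

lemma is_superalgebra_free: "is_superalgebra (free_superalgebra r s :: ('f::field, _) superalgebra)"
proof -
  let ?F = "free_superalgebra r s :: ('f, _) superalgebra"
  interpret nonassoc_algebra ?F by (rule nonassoc_algebra_free)
  show ?thesis
  proof (rule is_superalgebra.intro[OF nonassoc_algebra_axioms], rule is_superalgebra_axioms.intro)
    fix i
    have sc: "nscale c x \<in> homog ?F i" if "x \<in> homog ?F i" for x and c :: 'f
      using that keys_nscale[of c x] unfolding homog_free_superalgebra
      by (auto simp: free_carrier_scale)
    show "submodule (homog ?F i) (ring_of_type_algebra :: 'f ring) ?F"
    proof (rule submoduleI)
      show "homog ?F i \<subseteq> carrier ?F" by (auto simp: homog_free_superalgebra)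
      show "\<zero>\<^bsub>?F\<^esub> \<in> homog ?F i" by (simp add: homog_free_superalgebra free_carrier_zero)
      show "\<ominus>\<^bsub>?F\<^esub> a \<in> homog ?F i" if "a \<in> homog ?F i" for a
        using sc[OF that, of "-1"] scale_minus_one[of a] that by (auto simp: homog_free_superalgebra)
      show "a \<oplus>\<^bsub>?F\<^esub> b \<in> homog ?F i" if "a \<in> homog ?F i" "b \<in> homog ?F i" for a b
        using that Poly_Mapping.keys_add[of a b] unfolding homog_free_superalgebra
        by (auto simp: free_carrier_add)
      show "a \<odot>\<^bsub>?F\<^esub> x \<in> homog ?F i" if "x \<in> homog ?F i" for a x using sc[OF that] by simp
    qed
  next
    show "carrier ?F = homog ?F 0 <+>\<^bsub>?F\<^esub> homog ?F 1"
    proof (intro equalityI subsetI)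
      fix p assume p: "p \<in> carrier ?F"
      let ?r = "\<lambda>i. Poly_Mapping.mapp (\<lambda>w c. if nword_parity w = i then c else 0) p"
      have "?r i \<in> homog ?F i" for i
        using p by (auto simp: homog_free_superalgebra free_carrier_restrict in_keys_iff lookup_mapp when_def split: if_splits)
      moreover have "p = ?r 0 + ?r 1"
        by (rule poly_mapping_eqI) (auto simp: lookup_add lookup_mapp when_def in_keys_iff)
      ultimately show "p \<in> homog ?F 0 <+>\<^bsub>?F\<^esub> homog ?F 1"
        unfolding homog_sum_iff free_superalgebra_sel by blast
    qed (auto simp: homog_sum_iff homog_free_superalgebra free_carrier_add)
    have "p = 0" if "\<forall>w\<in>Poly_Mapping.keys p. nword_parity w = 0" "\<forall>w\<in>Poly_Mapping.keys p. nword_parity w = 1"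
      for p :: "(nat + nat, 'f) npoly"
      using that by (metis keys_eq_empty equals0I zero_neq_one)
    then show "homog ?F 0 \<inter> homog ?F 1 = {\<zero>\<^bsub>?F\<^esub>}"
      by (auto simp: homog_free_superalgebra free_carrier_zero)
    show "x \<otimes>\<^bsub>?F\<^esub> y \<in> homog ?F (i + j)" if "x \<in> homog ?F i" "y \<in> homog ?F j" for x y i j
      using that by (auto simp: homog_free_superalgebra free_carrier_mult nword_parity_Juxt dest!: keys_npoly_mult)
  qed
qed

abbreviation free_alt :: "nat \<Rightarrow> nat \<Rightarrow> ('f::field_char_0, (nat + nat, 'f) npoly set) superalgebra" where
  "free_alt \<equiv> free_super_in alt_metabelian"

definition free_alt_ideal :: "nat \<Rightarrow> nat \<Rightarrow> (nat + nat, 'f::field_char_0) npoly set" where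
  "free_alt_ideal r s = \<Inter> {I. graded_ideal I (free_superalgebra r s) \<and>
     super_quotient (free_superalgebra r s) I \<in> super_class alt_metabelian}"

lemma free_alt_quotient: "free_alt r s = super_quotient (free_superalgebra r s) (free_alt_ideal r s)"
  by (simp add: free_super_in_def free_alt_ideal_def)

text \<open>The condition asks that certain fixed values lie in \<open>I\<close>, so it survives
  intersections. This is why the least admissible ideal, and with it the free superalgebra,
  exists.\<close>

lemma quotient_in_super_class_iff:
  assumes "graded_ideal I (free_superalgebra r s :: ('f::field_char_0, _) superalgebra)"
  shows "super_quotient (free_superalgebra r s) I \<in> super_class alt_metabelian \<longleftrightarrow>
    (\<forall>f\<in>{lin_alt_left, lin_alt_right, metab}. \<forall>\<pi> \<rho>.
      (\<forall>x. \<rho> x \<in> homog (free_superalgebra r s :: ('f, _) superalgebra) (\<pi> x)) \<longrightarrow>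
      eval_superization (free_superalgebra r s) \<pi> \<rho> f \<in> I)"
  using super_quotient_is_superalgebra[OF assms]
  by (simp add: super_class_alt_metabelian_iff super_quotient_satisfies_iff[OF assms])

lemma graded_ideal_carrier:
  fixes A :: "('f::field, 'a) superalgebra"
  assumes "is_superalgebra A" shows "graded_ideal (carrier A) A"
proof -
  interpret is_superalgebra A by fact
  show ?thesis by (rule graded_idealI) (auto intro: carrier_is_submodule)
qed

lemma free_alt_ideal_graded:
  "graded_ideal (free_alt_ideal r s) (free_superalgebra r s :: ('f::field_char_0, _) superalgebra)"
  unfolding free_alt_ideal_def
proof (rule graded_ideal_Inter[OF is_superalgebra_free])
  let ?F = "free_superalgebra r s :: ('f, _) superalgebra"
  interpret is_superalgebra ?F by (rule is_superalgebra_free)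
  \<comment> \<open>The whole algebra is an admissible ideal, so the family being intersected is not
    empty.\<close>
  have "graded_ideal (carrier ?F) ?F" by (rule graded_ideal_carrier[OF is_superalgebra_free])
  moreover from this have "super_quotient ?F (carrier ?F) \<in> super_class alt_metabelian"
    using eval_superization_closed by (subst quotient_in_super_class_iff) blast+
  ultimately show "{I. graded_ideal I ?F \<and> super_quotient ?F I \<in> super_class alt_metabelian} \<noteq> {}"
    by blast
qed auto

theorem free_alt_in_super_class: "(free_alt r s :: ('f::field_char_0, _) superalgebra) \<in> super_class alt_metabelian"
proof -
  let ?F = "free_superalgebra r s :: ('f, _) superalgebra"
  note g = free_alt_ideal_graded[of r s, where 'f='f]
  show ?thesis unfolding free_alt_quotient quotient_in_super_class_iff[OF g]
  proof (intro ballI allI impI)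
    fix f :: "(nat, 'f) npoly" and \<pi> and \<rho> :: "nat \<Rightarrow> (nat + nat, 'f) npoly"
    assume *: "f \<in> {lin_alt_left, lin_alt_right, metab}" "\<forall>x. \<rho> x \<in> homog ?F (\<pi> x)"
    show "eval_superization ?F \<pi> \<rho> f \<in> free_alt_ideal r s"
      unfolding free_alt_ideal_def
    proof (rule InterI)
      fix I assume "I \<in> {I. graded_ideal I ?F \<and> super_quotient ?F I \<in> super_class alt_metabelian}"
      then have I: "graded_ideal I ?F" "super_quotient ?F I \<in> super_class alt_metabelian" by auto
      show "eval_superization ?F \<pi> \<rho> f \<in> I"
        using I(2) * unfolding quotient_in_super_class_iff[OF I(1)] by blast
    qed
  qed
qed

definition gen_parity :: "nat + nat \<Rightarrow> bit" where
  "gen_parity x = (case x of Inl _ \<Rightarrow> 0 | Inr _ \<Rightarrow> 1)"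

lemma nword_parity_simps [simp]:
  "nword_parity (Letter x) = gen_parity x"
  "nword_parity (Juxt u v) = nword_parity u + nword_parity v"
  by (simp_all add: nword_parity_def gen_parity_def)

text \<open>The universal property in the form needed: send the generators to \<open>g\<close>. The
  kernel of the induced map is an admissible ideal, hence contains the one defining the free
  superalgebra, and a superidentity evaluated at generators is carried to \<open>M\<close>.\<close>

theorem free_alt_universal:
  fixes M :: "('f::field_char_0, 'm) superalgebra" and g :: "nat + nat \<Rightarrow> 'm"
  assumes M: "M \<in> super_class alt_metabelian" and g: "\<And>x. g x \<in> homog M (gen_parity x)"
    and f: "super_satisfies (free_alt r s :: ('f, _) superalgebra) f"
    and h: "\<And>i. h i \<in> Inl ` {..<r} \<union> Inr ` {..<s}"
  shows "eval_superization M (\<lambda>i. gen_parity (h i)) (\<lambda>i. g (h i)) f = \<zero>\<^bsub>M\<^esub>"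
proof -
  let ?F = "free_superalgebra r s :: ('f, _) superalgebra"
  interpret F: is_superalgebra ?F by (rule is_superalgebra_free)
  have sM: "is_superalgebra M" using M by (simp add: super_class_def)
  interpret M: is_superalgebra M by fact
  define \<phi> where "\<phi> p = eval_npoly M g p" for p :: "(nat + nat, 'f) npoly"
  have gM: "range g \<subseteq> carrier M" using g M.homog_closed by blast
  have \<phi>: "alg_hom ?F M \<phi>"
    unfolding alg_hom_def \<phi>_def using gM by (auto simp: M.eval_npoly_add M.eval_npoly_mult M.eval_npoly_scale)
  have wh: "eval_nword M g w \<in> homog M (nword_parity w)" for w
  proof (induction w)
    case (Juxt u v)
    then show ?case unfolding eval_nword.simps nword_parity_simps by (rule M.homog_mult)
  qed (simp add: g)
  have \<phi>h: "\<phi> p \<in> homog M i" if "p \<in> homog ?F i" for p i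
    unfolding \<phi>_def eval_npoly_def
    using that wh by (intro M.homog_finsum M.homog_scale) (auto simp: homog_free_superalgebra)
  \<comment> \<open>The kernel of \<open>\<phi>\<close>. It is graded since \<open>\<phi>\<close>
    preserves parity, and its quotient is in the class since the defining superidentities hold in
    \<open>M\<close>.\<close>
  define I where "I = {p \<in> carrier ?F. \<phi> p = \<zero>\<^bsub>M\<^esub>}"
  have zero: "\<phi> \<zero>\<^bsub>?F\<^esub> = \<zero>\<^bsub>M\<^esub>"
    by (rule alg_hom_zero[OF \<phi> F.nonassoc_algebra_axioms M.nonassoc_algebra_axioms])
  note h' = alg_homD[OF \<phi>]
  have I: "graded_ideal I ?F"
  proof (rule F.graded_idealI)
    show "submodule I (ring_of_type_algebra :: 'f ring) ?F"
    proof (rule F.submoduleI)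
      show "\<ominus>\<^bsub>?F\<^esub> a \<in> I" if "a \<in> I" for a
        using that h'(4)[of a "-1"] F.scale_minus_one[of a] by (auto simp: I_def simp del: free_superalgebra_sel)
    qed (auto simp: I_def zero h' simp del: free_superalgebra_sel)
    show "x \<in> I \<and> y \<in> I" if xy: "x \<in> homog ?F 0" "y \<in> homog ?F 1" "x \<oplus>\<^bsub>?F\<^esub> y \<in> I" for x y
    proof -
      have c: "x \<in> carrier ?F" "y \<in> carrier ?F" using xy F.homog_closed by blast+
      have "\<phi> x \<oplus>\<^bsub>M\<^esub> \<phi> y = \<zero>\<^bsub>M\<^esub> \<oplus>\<^bsub>M\<^esub> \<zero>\<^bsub>M\<^esub>"
        using xy c by (simp add: I_def h'(2)[symmetric] del: free_superalgebra_sel)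
      then have "\<phi> x = \<zero>\<^bsub>M\<^esub>" "\<phi> y = \<zero>\<^bsub>M\<^esub>"
        using M.homog_unique[of "\<phi> x" "\<phi> y" "\<zero>\<^bsub>M\<^esub>" "\<zero>\<^bsub>M\<^esub>"] \<phi>h xy by auto
      then show ?thesis using c by (simp add: I_def del: free_superalgebra_sel)
    qed
  qed (auto simp: I_def h' simp del: free_superalgebra_sel)
  have ev: "\<phi> (eval_superization ?F \<pi> \<rho> f) = eval_superization M \<pi> (\<lambda>x. \<phi> (\<rho> x)) f"
    if "\<And>x. \<rho> x \<in> homog ?F (\<pi> x)" for \<pi> \<rho> f
    by (rule alg_hom_eval_superization[OF \<phi> is_superalgebra_free sM that])
  have "super_quotient ?F I \<in> super_class alt_metabelian"
    unfolding quotient_in_super_class_iff[OF I]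
  proof (intro ballI allI impI)
    fix f' :: "(nat, 'f) npoly" and \<pi> and \<rho> :: "nat \<Rightarrow> (nat + nat, 'f) npoly"
    assume *: "f' \<in> {lin_alt_left, lin_alt_right, metab}" "\<forall>x. \<rho> x \<in> homog ?F (\<pi> x)"
    have "super_satisfies M f'" using M * super_class_alt_metabelian_iff by blast
    then have "eval_superization M \<pi> (\<lambda>x. \<phi> (\<rho> x)) f' = \<zero>\<^bsub>M\<^esub>"
      by (rule super_satisfies_def[THEN iffD1, rule_format]) (use * \<phi>h in auto)
    then show "eval_superization ?F \<pi> \<rho> f' \<in> I"
      using ev * F.eval_superization_closed[of \<rho> \<pi> f'] by (simp add: I_def del: free_superalgebra_sel)
  qed
  then have J: "free_alt_ideal r s \<subseteq> I" using I by (auto simp: free_alt_ideal_def)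
  have v: "npoly_var (h i) \<in> homog ?F (gen_parity (h i))" for i
    using h[of i] by (auto simp: homog_free_superalgebra npoly_var_def free_carrier_def)
  have "eval_superization ?F (\<lambda>i. gen_parity (h i)) (\<lambda>i. npoly_var (h i)) f \<in> free_alt_ideal r s"
    by (rule f[unfolded free_alt_quotient super_quotient_satisfies_iff[OF free_alt_ideal_graded], rule_format])
      (rule v)
  then have "\<phi> (eval_superization ?F (\<lambda>i. gen_parity (h i)) (\<lambda>i. npoly_var (h i)) f) = \<zero>\<^bsub>M\<^esub>"
    using J by (auto simp: I_def)
  moreover have "\<phi> (npoly_var x) = g x" for x
    unfolding \<phi>_def using gM by simp
  ultimately show ?thesis using ev[of "\<lambda>i. npoly_var (h i)", OF v] by simp
qed

lemma rank_supervariety_subset: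
  assumes "(r, s) \<noteq> (0, 0)"
  shows "rank_supervariety alt_metabelian r s \<subseteq> (super_class alt_metabelian :: ('f::field_char_0, 'a) superalgebra set)"
proof
  fix A :: "('f, 'a) superalgebra"
  assume "A \<in> rank_supervariety alt_metabelian r s"
  then have A: "is_superalgebra A"
    "\<And>f. multilinear f \<Longrightarrow> super_satisfies (free_alt r s :: ('f, _) superalgebra) f \<Longrightarrow> super_satisfies A f"
    using assms by (auto simp: rank_supervariety_def supervariety_generated_by_def)
  have "multilinear (lin_alt_left :: (nat, 'f) npoly)" "multilinear (lin_alt_right :: (nat, 'f) npoly)"
    "multilinear (metab :: (nat, 'f) npoly)"
    using multilinear_linearizations multilinear_iff by blast+
  then show "A \<in> super_class alt_metabelian"
    using A free_alt_in_super_class[of r s, where 'f='f] by (simp add: super_class_alt_metabelian_iff)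
qed

text \<open>Members of the T-ideal hold in the entire class, so once every superidentity of the free
  superalgebra is in the T-ideal, no member of the class is excluded.\<close>

lemma rank_supervariety_eqI:
  assumes "(r, s) \<noteq> (0, 0)"
    and "\<And>f :: (nat, 'f::field_char_0) npoly. multilinear f \<Longrightarrow>
      super_satisfies (free_alt r s :: ('f, _) superalgebra) f \<Longrightarrow> f \<in> alt_ideal"
  shows "rank_supervariety alt_metabelian r s = (super_class alt_metabelian :: ('f, 'a) superalgebra set)"
proof (rule equalityI[OF rank_supervariety_subset[OF assms(1)]], rule subsetI)
  fix A :: "('f, 'a) superalgebra"
  assume A: "A \<in> super_class alt_metabelian"
  then have "is_superalgebra A" by (simp add: super_class_def)
  then show "A \<in> rank_supervariety alt_metabelian r s"
    using assms super_class_alt_ideal[OF A]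
    by (auto simp: rank_supervariety_def supervariety_generated_by_def)
qed

section \<open>The free alternative metabelian algebra\<close>

lemma nscale_diff: "nscale c (p - q) = nscale c p - nscale c q"
  by (rule poly_mapping_eqI) (simp add: lookup_minus right_diff_distrib)

definition alt_eq :: "(nat, 'f::field_char_0) npoly \<Rightarrow> (nat, 'f) npoly \<Rightarrow> bool" where
  "alt_eq p q \<longleftrightarrow> p - q \<in> alt_ideal"

\<comment> \<open>The relatively free algebra on countably many generators. Computation in it is
  computation modulo the T-ideal, and each law proved below holds for all its elements.\<close>
quotient_type (overloaded) 'f alt_free = "(nat, 'f::field_char_0) npoly" / alt_eq
proof (rule equivpI)
  show "reflp (alt_eq :: (nat, 'f) npoly \<Rightarrow> _)" by (rule reflpI) (simp add: alt_eq_def alt_zero)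
  show "symp (alt_eq :: (nat, 'f) npoly \<Rightarrow> _)"
  proof (rule sympI)
    fix p q :: "(nat, 'f) npoly" assume "alt_eq p q"
    then show "alt_eq q p" using alt_minus[of "p - q"] by (simp add: alt_eq_def)
  qed
  show "transp (alt_eq :: (nat, 'f) npoly \<Rightarrow> _)"
  proof (rule transpI)
    fix p q r :: "(nat, 'f) npoly" assume "alt_eq p q" "alt_eq q r"
    then show "alt_eq p r" using alt_add[of "p - q" "q - r"] by (simp add: alt_eq_def)
  qed
qed

instantiation alt_free :: (field_char_0) ab_group_add
begin

lift_definition zero_alt_free :: "'a alt_free" is 0 .

lift_definition plus_alt_free :: "'a alt_free \<Rightarrow> 'a alt_free \<Rightarrow> 'a alt_free" is "(+)"
  using alt_add by (force simp: alt_eq_def algebra_simps)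

lift_definition uminus_alt_free :: "'a alt_free \<Rightarrow> 'a alt_free" is "uminus"
  using alt_minus by (force simp: alt_eq_def)

lift_definition minus_alt_free :: "'a alt_free \<Rightarrow> 'a alt_free \<Rightarrow> 'a alt_free" is "(-)"
  using alt_diff by (force simp: alt_eq_def algebra_simps)

instance
  by standard (transfer; simp add: alt_eq_def alt_zero algebra_simps)+

end

instantiation alt_free :: (field_char_0) times
begin

lift_definition times_alt_free :: "'a alt_free \<Rightarrow> 'a alt_free \<Rightarrow> 'a alt_free" is "(\<star>)"
proof -
  fix p p' q q' :: "(nat, 'a) npoly" assume "alt_eq p p'" "alt_eq q q'"
  then have "(p - p') \<star> q + p' \<star> (q - q') \<in> alt_ideal"
    unfolding alt_eq_def by (intro alt_add alt_mult_left alt_mult_right)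
  then show "alt_eq (p \<star> q) (p' \<star> q')"
    by (simp add: alt_eq_def npoly_mult_diff_left npoly_mult_diff_right)
qed

instance ..

end

lift_definition alt_scale :: "'f::field_char_0 \<Rightarrow> 'f alt_free \<Rightarrow> 'f alt_free" is nscale
proof -
  fix c :: 'f and p q :: "(nat, 'f) npoly" assume "alt_eq p q"
  then have "nscale c (p - q) \<in> alt_ideal" unfolding alt_eq_def by (rule alt_scale)
  then show "alt_eq (nscale c p) (nscale c q)"
    by (simp add: alt_eq_def nscale_diff)
qed

interpretation alt_free: vector_space alt_scale
  by standard (transfer; simp add: alt_eq_def nscale_add nscale_add_left alt_zero)+

lemma abs_eq_zero_iff: "abs_alt_free p = 0 \<longleftrightarrow> p \<in> alt_ideal"
  unfolding zero_alt_free_def alt_free.abs_eq_iff by (simp add: alt_eq_def)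

lemma abs_add: "abs_alt_free (p + q) = abs_alt_free p + abs_alt_free q"
  by (simp add: plus_alt_free.abs_eq)

lemma abs_diff: "abs_alt_free (p - q) = abs_alt_free p - abs_alt_free q"
  by (simp add: minus_alt_free.abs_eq)

lemma abs_mult: "abs_alt_free (p \<star> q) = abs_alt_free p * abs_alt_free q"
  by (simp add: times_alt_free.abs_eq)

lemma abs_scale: "abs_alt_free (nscale c p) = alt_scale c (abs_alt_free p)"
  by (simp add: alt_scale.abs_eq)

section \<open>Consequences of the alternative and metabelian laws\<close>

context
  fixes a b c d :: "'f::field_char_0 alt_free"
begin

lemma af_add_left: "(a + b) * c = a * c + b * c"
  by transfer (simp add: alt_eq_def npoly_mult_add_left alt_zero)

lemma af_add_right: "c * (a + b) = c * a + c * b"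
  by transfer (simp add: alt_eq_def npoly_mult_add_right alt_zero)

lemma af_alt_left: "(a * a) * b = a * (a * b)"
  by transfer (use alt_left in \<open>simp add: alt_eq_def associator_def\<close>)

lemma af_alt_right: "(a * b) * b = a * (b * b)"
  by transfer (use alt_right in \<open>simp add: alt_eq_def associator_def\<close>)

lemma af_metab: "(a * b) * (c * d) = 0"
  by transfer (simp add: alt_eq_def alt_metab)

lemma af_scale_left: "alt_scale k a * b = alt_scale k (a * b)"
  by transfer (simp add: alt_eq_def npoly_mult_scale_left alt_zero)

lemma af_scale_right: "a * alt_scale k b = alt_scale k (a * b)"
  by transfer (simp add: alt_eq_def npoly_mult_scale_right alt_zero)

end

context
  fixes a b c :: "'f::field_char_0 alt_free"
begin

lemma af_zero_left [simp]: "0 * a = 0"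
  using af_scale_left[of 0 0 a] by simp

lemma af_zero_right [simp]: "a * 0 = 0"
  using af_scale_right[of a 0 0] by simp

lemma af_minus_left: "(- a) * b = - (a * b)"
  using af_scale_left[of "-1" a b] by simp

lemma af_minus_right: "a * (- b) = - (a * b)"
  using af_scale_right[of a "-1" b] by simp

end

context
  fixes a b c :: "'f::field_char_0 alt_free"
begin

lemma af_diff_left: "(a - b) * c = a * c - b * c"
  using af_add_left[of a "- b" c] af_minus_left by simp

lemma af_diff_right: "c * (a - b) = c * a - c * b"
  using af_add_right[of c a "- b"] af_minus_right by simp

end

lemmas af_distrib = af_add_left af_add_right af_minus_left af_minus_right af_diff_left af_diff_right

lemma af_torsion_free:
  fixes x :: "'f::field_char_0 alt_free"
  assumes "x + x = 0" shows "x = 0"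
proof -
  have "alt_scale 2 x = x + x" using alt_free.scale_left_distrib[of 1 1 x] by simp
  then show ?thesis using assms by simp
qed

context
  fixes x y z t :: "'f::field_char_0 alt_free"
begin

lemma af_swap_left: "(x * y) * z - x * (y * z) + ((y * x) * z - y * (x * z)) = 0"
  using af_alt_left[of "x + y" z] af_alt_left[of x z] af_alt_left[of y z]
  by (simp add: af_distrib algebra_simps)

lemma af_swap_right: "(x * y) * z - x * (y * z) + ((x * z) * y - x * (z * y)) = 0"
  using af_alt_right[of x "y + z"] af_alt_right[of x y] af_alt_right[of x z]
  by (simp add: af_distrib algebra_simps)

end

context
  fixes x y z t :: "'f::field_char_0 alt_free"
begin

lemma af_flexible: "(x * y) * x = x * (y * x)"
  using af_swap_left[of x y x] af_alt_right[of y x] by (simp add: algebra_simps)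

lemma af_jordan_left: "(x * y) * z + (y * x) * z = x * (y * z) + y * (x * z)"
  using af_swap_left[of x y z] by (simp add: algebra_simps)

lemma af_jordan_right: "x * (y * z) + x * (z * y) = (x * y) * z + (x * z) * y"
  using af_swap_right[of x y z] by (simp add: algebra_simps)

end

text \<open>The square of the algebra. Multiplication operators behave simply on it because it
  annihilates itself.\<close>

inductive_set square_ideal :: "'f::field_char_0 alt_free set" where
  sq_mult: "a * b \<in> square_ideal"
| sq_add: "a \<in> square_ideal \<Longrightarrow> b \<in> square_ideal \<Longrightarrow> a + b \<in> square_ideal"

lemma sq_metab:
  assumes "a \<in> square_ideal" "b \<in> square_ideal" shows "a * b = 0"
  using assms(1)
proof (induction)
  case (sq_mult p q)
  show ?case using assms(2) by induction (simp_all add: af_metab af_add_right)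
qed (simp add: af_add_left)

context
  fixes x y w :: "'f::field_char_0 alt_free"
  assumes w: "w \<in> square_ideal"
begin

text \<open>Right alternativity linearized in \<open>x\<close>, \<open>y\<close>; the terms
  \<open>w (x y)\<close> and \<open>w (y x)\<close> vanish since both factors lie in the
  square.\<close>

lemma RR_skew: "(w * x) * y = - ((w * y) * x)"
  using af_swap_right[of w x y] sq_metab[OF w sq_mult] by (simp add: eq_neg_iff_add_eq_0)

text \<open>Expand both linearized Jordan-type laws with \<open>w\<close> in the outer and inner
  position and drop the terms in which \<open>w\<close> meets \<open>x y\<close>. A pair of left
  multiplications can thus be traded for a pair of right ones.\<close>

lemma LL_eq_RR: "x * (y * w) = - ((w * x) * y)"
proof -
  have "(w * x) * y + (x * w) * y = w * (x * y) + x * (w * y)"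
    by (rule af_jordan_left)
  moreover have "x * (w * y) + x * (y * w) = (x * w) * y + (x * y) * w" by (rule af_jordan_right)
  ultimately have "(w * x) * y + (x * w) * y = (x * w) * y - x * (y * w)"
    using sq_metab[OF w sq_mult] sq_metab[OF sq_mult w] by (simp add: algebra_simps)
  then show ?thesis by (simp add: algebra_simps eq_neg_iff_add_eq_0)
qed

text \<open>Left alternativity with \<open>w (x y) = 0\<close>. It moves a left multiplication
  inside a right one at the cost of a term with right multiplications only.\<close>

lemma LR_commute: "x * (w * y) = (x * w) * y + (w * x) * y"
  using af_jordan_left[of w x y] sq_metab[OF w sq_mult] by (simp add: algebra_simps)

end

text \<open>Anticommutation of right multiplications reduces the claim to
  \<open>((x x) t) x\<close>, which left alternativity and flexibility turn into the product
  \<open>(x x) (t x)\<close> of two products.\<close>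

lemma cube_annihilates: "((x * x) * x) * t = 0" for x t :: "'f::field_char_0 alt_free"
proof -
  have "((x * x) * x) * t = - (((x * x) * t) * x)" by (rule RR_skew[OF sq_mult])
  also have "((x * x) * t) * x = x * (x * (t * x))" by (simp add: af_alt_left af_flexible)
  also have "\<dots> = (x * x) * (t * x)" by (simp add: af_alt_left)
  also have "\<dots> = 0" by (rule af_metab)
  finally show ?thesis by simp
qed

text \<open>The complete linearization of \<open>(x x) x\<close>.\<close>

definition polar_cube :: "'f::field_char_0 alt_free \<Rightarrow> 'f alt_free \<Rightarrow> 'f alt_free \<Rightarrow> 'f alt_free" where
  "polar_cube x y z = (x * y) * z + (x * z) * y + (y * x) * z + (y * z) * x + (z * x) * y + (z * y) * x"

text \<open>Polarization: the polar cube is the inclusion-exclusion combination of the cubes of the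
  partial sums of \<open>x\<close>, \<open>y\<close>, \<open>z\<close>.\<close>

lemma polar_cube_annihilates: "polar_cube x y z * t = 0"
proof -
  have "polar_cube x y z * t =
      (((x + y + z) * (x + y + z)) * (x + y + z)) * t - (((x + y) * (x + y)) * (x + y)) * t
      - (((x + z) * (x + z)) * (x + z)) * t - (((y + z) * (y + z)) * (y + z)) * t
      + ((x * x) * x) * t + ((y * y) * y) * t + ((z * z) * z) * t"
    unfolding polar_cube_def by (simp add: af_distrib algebra_simps)
  then show ?thesis by (simp only: cube_annihilates) simp
qed

text \<open>By the middle Moufang identity the product equals \<open>(x t) (z x)\<close>, which is
  zero by metabelianity. The proof derives this case from the linearized alternative laws and the
  annihilation of cubes.\<close>

lemma moufang_square: "(x * (t * z)) * x = 0" for x t z :: "'f::field_char_0 alt_free"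
proof -
  let ?v = "x * x"
  note sq = sq_mult
  \<comment> \<open>The associator is skew-symmetric, hence invariant under cyclic shifts.\<close>
  have 1: "(z * t) * x - z * (t * x) = (x * z) * t - x * (z * t)"
  proof -
    have "((z * t) * x - z * (t * x) + ((z * x) * t - z * (x * t))) -
        ((z * x) * t - z * (x * t) + ((x * z) * t - x * (z * t))) = 0"
      unfolding af_swap_left af_swap_right by simp
    then show ?thesis by (simp add: algebra_simps)
  qed
  have "x * ((z * t) * x) = x * (z * (t * x)) + x * ((x * z) * t) - x * (x * (z * t))"
  proof -
    have "(z * t) * x = z * (t * x) + (x * z) * t - x * (z * t)" using 1 by (simp add: algebra_simps)
    then show ?thesis by (simp add: af_distrib)
  qed
  also have "x * (x * (z * t)) = 0" using af_alt_left[of x "z * t"] af_metab[of x x z t] by simp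
  also have "x * (z * (t * x)) = - ((t * ?v) * z)" using LL_eq_RR[OF sq, of x z t x] RR_skew[OF sq, of t x x z]
    by (simp add: af_alt_right)
  also have "x * ((x * z) * t) = (?v * z) * t + (x * (z * x)) * t"
    using LR_commute[OF sq, of x x z t] by (simp add: af_alt_left af_flexible)
  \<comment> \<open>With two equal arguments the polar cube is twice the sum of three terms, two of
    which stand on the left. Since it annihilates \<open>t\<close>, they can be replaced by minus
    the third.\<close>
  also have "(?v * z) * t + (x * (z * x)) * t = - ((z * ?v) * t)"
  proof -
    have "polar_cube x x z = (?v * z + x * (z * x) + z * ?v) + (?v * z + x * (z * x) + z * ?v)"
      unfolding polar_cube_def by (simp add: af_flexible af_alt_right algebra_simps)
    then have "((?v * z + x * (z * x) + z * ?v) * t) + ((?v * z + x * (z * x) + z * ?v) * t) = 0"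
      using polar_cube_annihilates[of x x z t] by (simp add: af_add_left)
    then have "(?v * z + x * (z * x) + z * ?v) * t = 0" by (rule af_torsion_free)
    then show ?thesis by (simp add: af_add_left eq_neg_iff_add_eq_0)
  qed
  finally have 2: "x * ((z * t) * x) = - ((t * ?v) * z) - (z * ?v) * t" by simp
  have 3: "(z * ?v) * t = z * (?v * t) - (?v * z) * t" "(t * ?v) * z = t * (?v * z) - (?v * t) * z"
    using LR_commute[OF sq, of z x x t] LR_commute[OF sq, of t x x z] by (simp_all add: algebra_simps)
  have 4: "z * (?v * t) = - (((x * t) * z) * x)" "t * (?v * z) = - (((x * z) * t) * x)"
    using LL_eq_RR[OF sq, of z x x t] LL_eq_RR[OF sq, of t x x z] by (simp_all add: af_alt_left)
  have "x * ((z * t) * x) = ((x * t) * z) * x + ((x * z) * t) * x"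
    unfolding 2 3 4 using RR_skew[OF sq, of x x t z] by (simp add: algebra_simps)
  then have 5: "(x * (z * t)) * x = ((x * t) * z) * x + ((x * z) * t) * x"
    by (simp add: af_flexible)
  \<comment> \<open>Right alternativity multiplied by \<open>x\<close> has the right side of fact 5
    on its right; subtracting leaves the claim.\<close>
  have "x * (z * t) + x * (t * z) = (x * z) * t + (x * t) * z" by (rule af_jordan_right)
  then have "(x * (z * t)) * x + (x * (t * z)) * x = ((x * z) * t) * x + ((x * t) * z) * x"
    by (metis af_add_left)
  then show ?thesis using 5 by (simp add: algebra_simps)
qed

text \<open>Linearization of \<open>moufang_square\<close> in \<open>x\<close>, extended from
  products to their sums.\<close>

lemma LR_skew:
  fixes x y w :: "'f::field_char_0 alt_free"
  assumes "w \<in> square_ideal" shows "(x * w) * y = - ((y * w) * x)"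
  using assms
proof induction
  case (sq_mult a b)
  show ?case
    using moufang_square[of "x + y" a b] moufang_square[of x a b] moufang_square[of y a b]
    by (simp add: af_distrib eq_neg_iff_add_eq_0 algebra_simps)
qed (simp add: af_distrib)

text \<open>Of the six terms two are products of two elements of the square, and the other four
  cancel in pairs by the skewness of right multiplications and of mixed ones. Hence the symmetrized
  cube survives only on arguments that are not products.\<close>

lemma polar_cube_square:
  assumes "w \<in> square_ideal" shows "polar_cube w x y = 0" "polar_cube x w y = 0" "polar_cube x y w = 0"
  unfolding polar_cube_def
  using RR_skew[OF assms, of x y] LR_skew[OF assms, of x y] sq_metab[OF sq_mult assms] by simp_all

section \<open>Normal forms\<close>

definition gen :: "nat \<Rightarrow> 'f::field_char_0 alt_free" where
  "gen i = abs_alt_free (npoly_var i)"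

primrec word_class :: "nat nword \<Rightarrow> 'f::field_char_0 alt_free" where
  "word_class (Letter i) = gen i"
| "word_class (Juxt u v) = word_class u * word_class v"

lemma abs_single:
  fixes c :: "'f::field_char_0"
  shows "abs_alt_free (Poly_Mapping.single w c) = alt_scale c (word_class w)"
proof -
  have "abs_alt_free (Poly_Mapping.single w 1) = (word_class w :: 'f alt_free)"
    by (induction w)
      (simp_all add: gen_def npoly_var_def npoly_mult_single[of _ 1 _ 1, simplified, symmetric] abs_mult)
  then show ?thesis using abs_scale[of c "Poly_Mapping.single w 1"] by simp
qed

lemma abs_sum: "abs_alt_free (\<Sum>i\<in>I. f i) = (\<Sum>i\<in>I. abs_alt_free (f i))"
  by (induction I rule: infinite_finite_induct) (simp_all add: abs_add zero_alt_free_def)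

lemma abs_expand:
  "abs_alt_free p = (\<Sum>w\<in>Poly_Mapping.keys p. alt_scale (Poly_Mapping.lookup p w) (word_class w))"
  by (subst npoly_expand) (simp only: abs_sum abs_single)

definition rmul :: "'f::field_char_0 alt_free \<Rightarrow> nat list \<Rightarrow> 'f alt_free" where
  "rmul w zs = foldl (\<lambda>x z. x * gen z) w zs"

lemma rmul_simps [simp]:
  "rmul w [] = w" "rmul w (z # zs) = rmul (w * gen z) zs" "rmul w (zs @ zs') = rmul (rmul w zs) zs'"
  by (simp_all add: rmul_def)

lemma rmul_linear:
  "rmul (x + y) zs = rmul x zs + rmul y zs" "rmul (alt_scale c x) zs = alt_scale c (rmul x zs)"
  "rmul (- x) zs = - rmul x zs" "rmul (x - y) zs = rmul x zs - rmul y zs"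
  by (induction zs arbitrary: x y) (simp_all add: af_distrib af_scale_left)

lemma rmul_square: "w \<in> square_ideal \<Longrightarrow> rmul w zs \<in> square_ideal"
  by (induction zs arbitrary: w) (simp_all add: sq_mult)

lemma span_image_mult_right:
  assumes "x \<in> alt_free.span S" "\<And>s. s \<in> S \<Longrightarrow> s * y \<in> alt_free.span T"
  shows "x * y \<in> alt_free.span T"
  using assms(1)
proof (induction rule: alt_free.span_induct_alt)
  case (step c b z)
  then show ?case using assms(2)
    by (simp add: af_add_left af_scale_left alt_free.span_add alt_free.span_scale)
qed (simp add: alt_free.span_zero)

lemma span_image_mult_left:
  assumes "x \<in> alt_free.span S" "\<And>s. s \<in> S \<Longrightarrow> y * s \<in> alt_free.span T"
  shows "y * x \<in> alt_free.span T"
  using assms(1)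
proof (induction rule: alt_free.span_induct_alt)
  case (step c b z)
  then show ?case using assms(2)
    by (simp add: af_add_right af_scale_right alt_free.span_add alt_free.span_scale)
qed (simp add: alt_free.span_zero)

lemma span_trans:
  "x \<in> alt_free.span S \<Longrightarrow> (\<And>s. s \<in> S \<Longrightarrow> s \<in> alt_free.span T) \<Longrightarrow> x \<in> alt_free.span T"
  using alt_free.span_minimal[of S "alt_free.span T"] alt_free.subspace_span by blast

text \<open>Pushes a left multiplication through a string of right multiplications to the innermost
  place by repeated use of \<open>LR_commute\<close>; the correction terms contain right
  multiplications only.\<close>

lemma left_mult_rmul:
  fixes w :: "'f::field_char_0 alt_free"
  assumes w: "w \<in> square_ideal"
  shows "gen k * rmul w zs - rmul (gen k * w) zs \<in> alt_free.span {rmul w zs' |zs'. mset zs' = add_mset k (mset zs)}"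
proof (induction zs rule: rev_induct)
  case Nil
  then show ?case by (simp add: alt_free.span_zero)
next
  case (snoc d zs)
  let ?S = "\<lambda>zs. {rmul w zs' |zs'. mset zs' = add_mset k (mset zs)}"
  have "(gen k * rmul w zs - rmul (gen k * w) zs) * gen d \<in> alt_free.span (?S (zs @ [d]))"
  proof (rule span_image_mult_right[OF snoc])
    fix s assume "s \<in> ?S zs"
    then obtain zs' where zs': "s = rmul w zs'" "mset zs' = add_mset k (mset zs)" by auto
    then have "s * gen d = rmul w (zs' @ [d])" "mset (zs' @ [d]) = add_mset k (mset (zs @ [d]))" by simp_all
    then show "s * gen d \<in> alt_free.span (?S (zs @ [d]))" by (intro alt_free.span_base) blast
  qed
  moreover have "(rmul w zs * gen k) * gen d \<in> alt_free.span (?S (zs @ [d]))"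
  proof (intro alt_free.span_base CollectI exI conjI)
    show "(rmul w zs * gen k) * gen d = rmul w (zs @ [k, d])" by simp
  qed simp
  ultimately have "(gen k * rmul w zs - rmul (gen k * w) zs) * gen d + (rmul w zs * gen k) * gen d
      \<in> alt_free.span (?S (zs @ [d]))" by (rule alt_free.span_add)
  then show ?case
    using LR_commute[OF rmul_square[OF w], of "gen k" zs "gen d"] by (simp add: af_distrib algebra_simps)
qed

text \<open>Monomials of degree at least 3 with letters \<open>M\<close>, built from a product of
  two generators by right multiplications, preceded by at most one left multiplication.\<close>

definition op_words :: "nat multiset \<Rightarrow> 'f::field_char_0 alt_free set" where
  "op_words M = {rmul (gen i * gen j) zs |i j zs. zs \<noteq> [] \<and> mset (i # j # zs) = M} \<union>
     {rmul (gen k * (gen i * gen j)) zs |i j k zs. mset (k # i # j # zs) = M}"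

lemma op_words_right:
  assumes "x \<in> op_words M" shows "x * gen k \<in> op_words (add_mset k M)"
proof -
  consider i j zs where "x = rmul (gen i * gen j) zs" "zs \<noteq> []" "mset (i # j # zs) = M"
    | i j l zs where "x = rmul (gen l * (gen i * gen j)) zs" "mset (l # i # j # zs) = M"
    using assms unfolding op_words_def by blast
  then show ?thesis
  proof cases
    case 1
    then have "x * gen k = rmul (gen i * gen j) (zs @ [k])" "mset (i # j # zs @ [k]) = add_mset k M"
      by auto
    then show ?thesis unfolding op_words_def by blast
  next
    case 2
    then have "x * gen k = rmul (gen l * (gen i * gen j)) (zs @ [k])" "mset (l # i # j # zs @ [k]) = add_mset k M"
      by auto
    then show ?thesis unfolding op_words_def by blast
  qed
qed

lemma op_words_left:
  fixes x :: "'f::field_char_0 alt_free"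
  assumes "x \<in> op_words M" shows "gen k * x \<in> alt_free.span (op_words (add_mset k M))"
proof -
  let ?T = "alt_free.span (op_words (add_mset k M)) :: 'f alt_free set"
  consider i j zs where "x = rmul (gen i * gen j) zs" "zs \<noteq> []" "mset (i # j # zs) = M"
    | i j l zs where "x = rmul (gen l * (gen i * gen j)) zs" "mset (l # i # j # zs) = M"
    using assms unfolding op_words_def by blast
  then show ?thesis
  proof cases
    case 1
    have "gen k * x - rmul (gen k * (gen i * gen j)) zs \<in> ?T" unfolding 1
    proof (rule span_trans[OF left_mult_rmul[OF sq_mult]])
      fix s :: "'f alt_free" assume "s \<in> {rmul (gen i * gen j) zs' |zs'. mset zs' = add_mset k (mset zs)}"
      then obtain zs' where "s = rmul (gen i * gen j) zs'" "mset zs' = add_mset k (mset zs)" by blast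
      moreover from this have "zs' \<noteq> []" "mset (i # j # zs') = add_mset k M" using 1 by auto
      ultimately have "s \<in> op_words (add_mset k M)" unfolding op_words_def by blast
      then show "s \<in> ?T" by (rule alt_free.span_base)
    qed
    moreover have "mset (k # i # j # zs) = add_mset k M" using 1 by simp
    then have "rmul (gen k * (gen i * gen j)) zs \<in> ?T"
      by (intro alt_free.span_base) (unfold op_words_def, blast)
    ultimately have "(gen k * x - rmul (gen k * (gen i * gen j)) zs) + rmul (gen k * (gen i * gen j)) zs \<in> ?T"
      by (rule alt_free.span_add)
    then show ?thesis by simp
  next
    case 2
    have "gen k * x - rmul (gen k * (gen l * (gen i * gen j))) zs \<in> ?T" unfolding 2
    proof (rule span_trans[OF left_mult_rmul[OF sq_mult]])
      fix s :: "'f alt_free" assume "s \<in> {rmul (gen l * (gen i * gen j)) zs' |zs'. mset zs' = add_mset k (mset zs)}"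
      then obtain zs' where "s = rmul (gen l * (gen i * gen j)) zs'" "mset zs' = add_mset k (mset zs)" by blast
      moreover from this have "mset (l # i # j # zs') = add_mset k M" using 2 by auto
      ultimately have "s \<in> op_words (add_mset k M)" unfolding op_words_def by blast
      then show "s \<in> ?T" by (rule alt_free.span_base)
    qed
    moreover have "rmul (gen k * (gen l * (gen i * gen j))) zs \<in> ?T"
    proof -
      \<comment> \<open>The left multiplication that reaches the innermost place meets the one
        already there, and \<open>LL_eq_RR\<close> converts both into right multiplications.\<close>
      have "rmul (gen k * (gen l * (gen i * gen j))) zs = - (rmul (gen i * gen j) (k # l # zs) :: 'f alt_free)"
        using LL_eq_RR[OF sq_mult, of "gen k :: 'f alt_free" "gen l" "gen i" "gen j"]
        by (simp add: rmul_linear)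
      moreover have "mset (i # j # k # l # zs) = add_mset k M" using 2 by auto
      then have "rmul (gen i * gen j) (k # l # zs) \<in> ?T"
        by (intro alt_free.span_base) (unfold op_words_def, blast)
      ultimately show ?thesis by (simp add: alt_free.span_neg del: rmul_simps)
    qed
    ultimately have "(gen k * x - rmul (gen k * (gen l * (gen i * gen j))) zs) + rmul (gen k * (gen l * (gen i * gen j))) zs \<in> ?T"
      by (rule alt_free.span_add)
    then show ?thesis by simp
  qed
qed

lemma letters_nonempty: "letters w \<noteq> []"
  by (induction w) auto

lemma length_letters_1: "length (letters w) = 1 \<Longrightarrow> \<exists>i. w = Letter i"
proof (cases w)
  case (Juxt u v)
  assume "length (letters w) = 1"
  moreover have "length (letters u) > 0" "length (letters v) > 0" using letters_nonempty by auto
  ultimately show ?thesis using Juxt by simp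
qed simp

lemma length_letters_2: "length (letters w) = 2 \<Longrightarrow> \<exists>i j. w = Juxt (Letter i) (Letter j)"
proof (cases w)
  case (Juxt u v)
  assume "length (letters w) = 2"
  moreover have "length (letters u) > 0" "length (letters v) > 0" using letters_nonempty by auto
  moreover have "length (letters w) = length (letters u) + length (letters v)" using Juxt by simp
  ultimately have "length (letters u) = 1" "length (letters v) = 1" by linarith+
  then show ?thesis using Juxt length_letters_1 by blast
qed simp

text \<open>Induction over the word: if both factors are products the class is zero, and otherwise
  one factor is a letter, which acts as a left or a right multiplication.\<close>

lemma word_class_in_op_words:
  "length (letters w) \<ge> 3 \<Longrightarrow> (word_class w :: 'f::field_char_0 alt_free) \<in> alt_free.span (op_words (mset (letters w)))"
proof (induction w)
  case (Juxt u v)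
  show ?case
  proof (cases u)
    case u: (Letter k)
    show ?thesis
    proof (cases "length (letters v) \<ge> 3")
      case True
      have "gen k * (word_class v :: 'f alt_free) \<in> alt_free.span (op_words (add_mset k (mset (letters v))))"
        by (rule span_image_mult_left[OF Juxt.IH(2)[OF True]], intro op_words_left)
      then show ?thesis using u by simp
    next
      case False
      then have "length (letters v) = 2" using Juxt.prems u by simp
      then obtain i j where v: "v = Juxt (Letter i) (Letter j)"
        using length_letters_2 by blast
      have "(rmul (gen k * (gen i * gen j)) [] :: 'f alt_free) \<in> op_words (mset [k, i, j])"
        unfolding op_words_def by blast
      then show ?thesis using u v by (simp add: alt_free.span_base)
    qed
  next
    case u: (Juxt u1 u2)
    show ?thesis
    proof (cases v)
      case v: (Letter k)
      show ?thesis
      proof (cases "length (letters u) \<ge> 3")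
        case True
        have "(word_class u :: 'f alt_free) * gen k \<in> alt_free.span (op_words (add_mset k (mset (letters u))))"
          by (rule span_image_mult_right[OF Juxt.IH(1)[OF True]], intro alt_free.span_base op_words_right)
        then show ?thesis using v by simp
      next
        case False
        moreover have "length (letters u) + 1 \<ge> 3" using Juxt.prems v by simp
        ultimately have "length (letters u) = 2" by linarith
        then obtain i j where "u = Juxt (Letter i) (Letter j)" using length_letters_2 by blast
        moreover have "(rmul (gen i * gen j) [k] :: 'f alt_free) \<in> op_words (mset [i, j, k])"
          unfolding op_words_def by blast
        ultimately show ?thesis using v by (simp add: alt_free.span_base)
      qed
    next
      case (Juxt v1 v2)
      then show ?thesis using u by (simp add: af_metab alt_free.span_zero)
    qed
  qed
qed simp


section \<open>Skew-symmetric words\<close>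

text \<open>\<open>u3\<close> and \<open>v3\<close> are chosen so that symmetrizing in the last two
  arguments yields exactly the polar cube. After one more multiplication this is zero, so both
  become skew-symmetric in \<open>a\<close> and \<open>b\<close>, with \<open>y\<close> as the
  distinguished argument.\<close>

definition u3 :: "'f::field_char_0 alt_free \<Rightarrow> 'f alt_free \<Rightarrow> 'f alt_free \<Rightarrow> 'f alt_free" where
  "u3 y a b = (y * a) * b + b * (y * a + a * y)"

definition v3 :: "'f::field_char_0 alt_free \<Rightarrow> 'f alt_free \<Rightarrow> 'f alt_free \<Rightarrow> 'f alt_free" where
  "v3 y a b = (y * a + a * y) * b + b * (a * y)"

lemma u3_v3_square: "u3 y a b \<in> square_ideal" "v3 y a b \<in> square_ideal"
  by (auto simp: u3_def v3_def intro: sq_mult sq_add)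

lemma u3_swap: "u3 y a b + u3 y b a = polar_cube y a b"
proof -
  \<comment> \<open>Four instances of the linearized alternative laws, whose sum is the difference
    of the two sides.\<close>
  have "b * (a * y) + a * (b * y) - ((b * a) * y + (a * b) * y) = 0"
    "b * (y * a) + y * (b * a) - ((b * y) * a + (y * b) * a) = 0"
    "a * (y * b) + y * (a * b) - ((a * y) * b + (y * a) * b) = 0"
    "(y * a) * b + (y * b) * a - (y * (a * b) + y * (b * a)) = 0"
    using af_jordan_left[of b a y] af_jordan_left[of b y a] af_jordan_left[of a y b] af_jordan_right[of y a b]
    by simp_all
  moreover have "u3 y a b + u3 y b a - polar_cube y a b =
      (b * (a * y) + a * (b * y) - ((b * a) * y + (a * b) * y))
      + (b * (y * a) + y * (b * a) - ((b * y) * a + (y * b) * a))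
      + (a * (y * b) + y * (a * b) - ((a * y) * b + (y * a) * b))
      + ((y * a) * b + (y * b) * a - (y * (a * b) + y * (b * a)))"
    by (simp add: u3_def polar_cube_def af_distrib algebra_simps)
  ultimately have "u3 y a b + u3 y b a - polar_cube y a b = 0" by (simp only: add_0)
  then show ?thesis by simp
qed

lemma v3_swap: "v3 y a b + v3 y b a = polar_cube y a b"
proof -
  have "v3 y a b + v3 y b a - polar_cube y a b = b * (a * y) + a * (b * y) - ((b * a) * y + (a * b) * y)"
    by (simp add: v3_def polar_cube_def af_distrib algebra_simps)
  also have "\<dots> = 0" using af_jordan_left[of b a y] by simp
  finally show ?thesis by simp
qed

definition u_word :: "nat \<Rightarrow> nat list \<Rightarrow> 'f::field_char_0 alt_free" where
  "u_word y zs = rmul (u3 (gen y) (gen (zs ! 0)) (gen (zs ! 1))) (drop 2 zs)"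

definition v_word :: "nat \<Rightarrow> nat list \<Rightarrow> 'f::field_char_0 alt_free" where
  "v_word y zs = rmul (v3 (gen y) (gen (zs ! 0)) (gen (zs ! 1))) (drop 2 zs)"

lemma third_scale: "x + x + x = y \<Longrightarrow> x = alt_scale (1/3) y"
proof -
  assume *: "x + x + x = y"
  have "alt_scale 3 x = alt_scale (1 + 1 + 1) x" by simp
  also have "\<dots> = x + x + x" by (simp only: alt_free.scale_left_distrib alt_free.scale_one)
  finally have "alt_scale (1/3) y = alt_scale (1/3) (alt_scale 3 x)" using * by simp
  then show ?thesis by simp
qed

text \<open>Solving \<open>U = p + 2 q\<close> and \<open>V = 2 p + q\<close>, where \<open>U\<close> and \<open>V\<close> are the symmetrizations
  of \<^const>\<open>u3\<close> and \<^const>\<open>v3\<close> in the first two arguments, \<open>p = (y a + a y) b\<close> and \<open>q = b (y a + a y)\<close>.\<close>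

lemma words3_from_u3_v3:
  fixes y a b :: "'f::field_char_0 alt_free"
  shows "(y * a) * b = u3 y a b - alt_scale (1/3) (u3 y a b + u3 y a b + u3 a y b + u3 a y b - v3 y a b - v3 a y b)"
    "b * (a * y) = v3 y a b - alt_scale (1/3) (v3 y a b + v3 y a b + v3 a y b + v3 a y b - u3 y a b - u3 a y b)"
proof -
  have "b * (y * a + a * y) = alt_scale (1/3) (u3 y a b + u3 y a b + u3 a y b + u3 a y b - v3 y a b - v3 a y b)"
    by (rule third_scale) (simp add: u3_def v3_def af_distrib algebra_simps)
  then show "(y * a) * b = u3 y a b - alt_scale (1/3) (u3 y a b + u3 y a b + u3 a y b + u3 a y b - v3 y a b - v3 a y b)"
    by (simp add: u3_def)
  have "(y * a + a * y) * b = alt_scale (1/3) (v3 y a b + v3 y a b + v3 a y b + v3 a y b - u3 y a b - u3 a y b)"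
    by (rule third_scale) (simp add: u3_def v3_def af_distrib algebra_simps)
  then show "b * (a * y) = v3 y a b - alt_scale (1/3) (v3 y a b + v3 y a b + v3 a y b + v3 a y b - u3 y a b - u3 a y b)"
    by (simp add: v3_def)
qed

definition uv_words :: "nat multiset \<Rightarrow> 'f::field_char_0 alt_free set" where
  "uv_words M = {u_word y zs |y zs. length zs \<ge> 2 \<and> mset (y # zs) = M} \<union>
     {v_word y zs |y zs. length zs \<ge> 2 \<and> mset (y # zs) = M}"

lemma op_words_in_uv_words:
  fixes x :: "'f::field_char_0 alt_free"
  assumes "x \<in> op_words M" shows "x \<in> alt_free.span (uv_words M)"
proof -
  have gens: "rmul (u3 (gen y) (gen a) (gen b)) zs \<in> alt_free.span (uv_words M :: 'f alt_free set)"
    "rmul (v3 (gen y) (gen a) (gen b)) zs \<in> alt_free.span (uv_words M :: 'f alt_free set)"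
    if "mset (y # a # b # zs) = M" for y a b zs
  proof -
    have "u_word y (a # b # zs) \<in> (uv_words M :: 'f alt_free set)" "v_word y (a # b # zs) \<in> (uv_words M :: 'f alt_free set)"
      using that unfolding uv_words_def by fastforce+
    then show "rmul (u3 (gen y) (gen a) (gen b)) zs \<in> alt_free.span (uv_words M :: 'f alt_free set)"
      "rmul (v3 (gen y) (gen a) (gen b)) zs \<in> alt_free.span (uv_words M :: 'f alt_free set)"
      by (auto simp: u_word_def v_word_def intro: alt_free.span_base)
  qed
  consider i j k zs where "x = rmul ((gen i * gen j) * gen k) zs" "mset (i # j # k # zs) = M"
    | i j k zs where "x = rmul (gen k * (gen i * gen j)) zs" "mset (k # i # j # zs) = M"
    using assms unfolding op_words_def by (auto simp: neq_Nil_conv)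
  then show ?thesis
  proof cases
    case 1
    then have "mset (i # j # k # zs) = M" "mset (j # i # k # zs) = M" by (simp_all add: add_mset_commute)
    then show ?thesis using 1 unfolding words3_from_u3_v3(1)[of "gen i :: 'f alt_free"] rmul_linear 
      by (simp only: rmul_linear)
        (intro alt_free.span_diff alt_free.span_scale alt_free.span_add gens; assumption)
  next
    case 2
    then have "mset (i # j # k # zs) = M" "mset (j # i # k # zs) = M" by (simp_all add: add_mset_commute)
    then show ?thesis using 2 unfolding words3_from_u3_v3(2)[of "gen k :: 'f alt_free"] rmul_linear
      by (simp only: rmul_linear)
        (intro alt_free.span_diff alt_free.span_scale alt_free.span_add gens; assumption)
  qed
qed

text \<open>An adjacent swap may hit the two arguments inside \<open>u3\<close> or
  \<open>v3\<close>, straddle their end, or lie among the outer right multiplications; each position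
  has its own source of skewness. At least three letters are needed because the first position works
  only after a further multiplication.\<close>

lemma u_word_skew:
  assumes "length (xs @ a # b # ys) \<ge> 3"
  shows "u_word y (xs @ a # b # ys) = - (u_word y (xs @ b # a # ys) :: 'f::field_char_0 alt_free)"
    and "v_word y (xs @ a # b # ys) = - (v_word y (xs @ b # a # ys) :: 'f alt_free)"
proof -
  note sq = u3_v3_square
  have later: "rmul (x * gen a * gen b) ys = - rmul (x * gen b * gen a) ys" if "x \<in> square_ideal" for x :: "'f alt_free"
    using RR_skew[OF that, of "gen a" "gen b"] by (simp add: rmul_linear)
  consider "xs = []" | p where "xs = [p]" | p q r where "xs = p # q # r" by (metis list.exhaust)
  then have "u_word y (xs @ a # b # ys) = - (u_word y (xs @ b # a # ys) :: 'f alt_free) \<and>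
    v_word y (xs @ a # b # ys) = - (v_word y (xs @ b # a # ys) :: 'f alt_free)"
  proof cases
    \<comment> \<open>Swap inside the core: the symmetrization is a polar cube, and the next letter
      \<open>c\<close> kills it.\<close>
    case 1
    then obtain c r where ys: "ys = c # r" using assms by (cases ys) auto
    have "u3 (gen y) (gen a) (gen b) * gen c + u3 (gen y) (gen b) (gen a) * gen c = (0 :: 'f alt_free)"
      "v3 (gen y) (gen a) (gen b) * gen c + v3 (gen y) (gen b) (gen a) * gen c = (0 :: 'f alt_free)"
      by (simp_all only: af_add_left[symmetric] u3_swap v3_swap polar_cube_annihilates)
    then have "u3 (gen y) (gen a) (gen b) * gen c = - (u3 (gen y) (gen b) (gen a) * gen c :: 'f alt_free)"
      "v3 (gen y) (gen a) (gen b) * gen c = - (v3 (gen y) (gen b) (gen a) * gen c :: 'f alt_free)"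
      by (simp_all add: eq_neg_iff_add_eq_0)
    then show ?thesis using 1 ys by (simp add: u_word_def v_word_def rmul_linear)
  next
    case 2
    \<comment> \<open>Swap across the end of the core: \<open>a\<close> is the outer factor of every
      term of the core, so right multiplication by \<open>b\<close> produces only
      \<open>RR_skew\<close> and \<open>LR_skew\<close> patterns on the products of \<open>y\<close>
      and \<open>p\<close>.\<close>
    let ?s = "gen y * gen p + gen p * gen y :: 'f alt_free"
    have s: "?s \<in> square_ideal" by (intro sq_add sq_mult)
    have "u3 (gen y) (gen p) (gen a) * gen b = - (u3 (gen y) (gen p) (gen b) * gen a :: 'f alt_free)"
      "v3 (gen y) (gen p) (gen a) * gen b = - (v3 (gen y) (gen p) (gen b) * gen a :: 'f alt_free)"
      using RR_skew[OF sq_mult, of "gen y :: 'f alt_free" "gen p" "gen a" "gen b"] LR_skew[OF s, of "gen a" "gen b"]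
        RR_skew[OF s, of "gen a" "gen b"] LR_skew[OF sq_mult, of "gen a :: 'f alt_free" "gen p" "gen y" "gen b"]
      by (simp_all add: u3_def v3_def af_add_left)
    then show ?thesis using 2 by (simp add: u_word_def v_word_def rmul_linear)
  next
    case 3
    then show ?thesis using later[OF rmul_square[OF sq(1)]] later[OF rmul_square[OF sq(2)]]
      by (simp add: u_word_def v_word_def)
  qed
  then show "u_word y (xs @ a # b # ys) = - (u_word y (xs @ b # a # ys) :: 'f alt_free)"
    "v_word y (xs @ a # b # ys) = - (v_word y (xs @ b # a # ys) :: 'f alt_free)" by auto
qed

text \<open>Adjacent transpositions generate all permutations, so skewness under them determines the
  value up to sign from the multiset of letters. The sign itself is irrelevant for spanning
  arguments.\<close>

lemma skew_list_perm:
  fixes g :: "'a list \<Rightarrow> 'b::ab_group_add"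
  assumes skew: "\<And>xs a b ys. length (xs @ a # b # ys) \<ge> k \<Longrightarrow> g (xs @ a # b # ys) = - g (xs @ b # a # ys)"
    and "mset xs = mset ys" "length xs \<ge> k"
  shows "g xs = g ys \<or> g xs = - g ys"
proof -
  have front: "g (pre @ p @ x # q) = g (pre @ x # p @ q) \<or> g (pre @ p @ x # q) = - g (pre @ x # p @ q)"
    if "length (pre @ p @ x # q) \<ge> k" for pre p x q
    using that
  proof (induction p arbitrary: q rule: rev_induct)
    case (snoc c p)
    have "g ((pre @ p) @ c # x # q) = - g ((pre @ p) @ x # c # q)"
      by (rule skew) (use snoc.prems in simp)
    then show ?case using snoc.IH[of "c # q"] snoc.prems by auto
  qed simp
  have "g (pre @ xs) = g (pre @ ys) \<or> g (pre @ xs) = - g (pre @ ys)"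
    if "mset xs = mset ys" "length (pre @ xs) \<ge> k" for pre xs ys
    using that
  proof (induction xs arbitrary: pre ys)
    case (Cons x xs)
    then have "x \<in> set ys" by (metis list.set_intros(1) set_mset_mset)
    then obtain p q where ys: "ys = p @ x # q" by (meson split_list)
    then have "mset xs = mset (p @ q)" using Cons.prems by simp
    then have "g ((pre @ [x]) @ xs) = g ((pre @ [x]) @ p @ q) \<or> g ((pre @ [x]) @ xs) = - g ((pre @ [x]) @ p @ q)"
      using Cons.prems by (intro Cons.IH) auto
    moreover have "length (pre @ p @ x # q) \<ge> k"
      using Cons.prems ys by (metis length_append mset_eq_length)
    ultimately show ?case using front[of pre p x q] ys by auto
  qed simp
  from this[of xs ys "[]"] show ?thesis using assms by simp
qed

lemma u_word_perm:
  assumes "mset xs = mset ys" "length xs \<ge> 3"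
  shows "u_word y xs = (u_word y ys :: 'f::field_char_0 alt_free) \<or> u_word y xs = - (u_word y ys :: 'f alt_free)"
    and "v_word y xs = (v_word y ys :: 'f alt_free) \<or> v_word y xs = - (v_word y ys :: 'f alt_free)"
  using skew_list_perm[of 3 "u_word y :: _ \<Rightarrow> 'f alt_free", OF u_word_skew(1) assms]
    skew_list_perm[of 3 "v_word y :: _ \<Rightarrow> 'f alt_free", OF u_word_skew(2) assms] by auto

definition others :: "nat \<Rightarrow> nat \<Rightarrow> nat list" where
  "others n m = filter (\<lambda>i. i \<noteq> m) [0..<n]"

lemma mset_others: "m < n \<Longrightarrow> mset (m # others n m) = mset [0..<n]"
  by (rule set_eq_iff_mset_eq_distinct[THEN iffD1]) (auto simp: others_def)

text \<open>The operator words are rewritten through \<open>u3\<close> and \<open>v3\<close>, and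
  skewness then lets the letters other than the distinguished one be sorted. Degree at least 4
  leaves three such letters, as \<open>u_word_skew\<close> requires.\<close>

theorem normal_form:
  fixes f :: "(nat, 'f::field_char_0) npoly"
  assumes f: "multilinear_in n f" and n: "n \<ge> 4"
  shows "\<exists>\<alpha> \<beta>. abs_alt_free f =
    (\<Sum>m<n. alt_scale (\<alpha> m) (u_word m (others n m)) + alt_scale (\<beta> m) (v_word m (others n m)))"
proof -
  define C :: "'f alt_free set" where "C = {x. \<exists>\<alpha> \<beta>. x =
    (\<Sum>m<n. alt_scale (\<alpha> m) (u_word m (others n m)) + alt_scale (\<beta> m) (v_word m (others n m)))}"
  have sub: "alt_free.subspace C"
  proof (rule alt_free.subspaceI)
    show "0 \<in> C" unfolding C_def by (intro CollectI exI[of _ "\<lambda>_. 0"]) simp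
    show "x + y \<in> C" if "x \<in> C" "y \<in> C" for x y
    proof -
      from that obtain a b a' b' where
        "x = (\<Sum>m<n. alt_scale (a m) (u_word m (others n m)) + alt_scale (b m) (v_word m (others n m)))"
        "y = (\<Sum>m<n. alt_scale (a' m) (u_word m (others n m)) + alt_scale (b' m) (v_word m (others n m)))"
        unfolding C_def by blast
      then have "x + y = (\<Sum>m<n. alt_scale (a m + a' m) (u_word m (others n m)) + alt_scale (b m + b' m) (v_word m (others n m)))"
        by (simp add: sum.distrib[symmetric] alt_free.scale_left_distrib algebra_simps)
      then show ?thesis unfolding C_def by (intro CollectI exI)
    qed
    show "alt_scale c x \<in> C" if "x \<in> C" for c x
    proof -
      from that obtain a b where
        "x = (\<Sum>m<n. alt_scale (a m) (u_word m (others n m)) + alt_scale (b m) (v_word m (others n m)))"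
        unfolding C_def by blast
      then have "alt_scale c x = (\<Sum>m<n. alt_scale (c * a m) (u_word m (others n m)) + alt_scale (c * b m) (v_word m (others n m)))"
        by (simp add: alt_free.scale_sum_right alt_free.scale_right_distrib)
      then show ?thesis unfolding C_def by (intro CollectI exI)
    qed
  qed
  have base: "alt_scale a (u_word m (others n m)) + alt_scale b (v_word m (others n m)) \<in> C" if "m < n" for m a b
    unfolding C_def
  proof (intro CollectI exI)
    show "alt_scale a (u_word m (others n m)) + alt_scale b (v_word m (others n m)) =
      (\<Sum>i<n. alt_scale (if i = m then a else 0) (u_word i (others n i)) +
        alt_scale (if i = m then b else 0) (v_word i (others n i)))"
      by (subst sum.remove[of _ m]) (use that in auto)
  qed
  have "uv_words (mset [0..<n]) \<subseteq> C"
  proof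
    fix x :: "'f alt_free" assume "x \<in> uv_words (mset [0..<n])"
    then obtain y zs where x: "x = u_word y zs \<or> x = v_word y zs" and M: "mset (y # zs) = mset [0..<n]"
      unfolding uv_words_def by blast
    have "y \<in> set [0..<n]" using M by (metis list.set_intros(1) set_mset_mset)
    then have y: "y < n" by simp
    have perm: "mset zs = mset (others n y)" using trans[OF M sym[OF mset_others[OF y]]] by simp
    have "length (y # zs) = n" using M by (metis length_upt minus_nat.diff_0 size_mset)
    then have "length zs \<ge> 3" using n by simp
    from u_word_perm[OF perm this, of y, where 'f='f] have
      "u_word y zs = alt_scale 1 (u_word y (others n y) :: 'f alt_free) + alt_scale 0 (v_word y (others n y)) \<or>
       u_word y zs = alt_scale (-1) (u_word y (others n y) :: 'f alt_free) + alt_scale 0 (v_word y (others n y))"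
      "v_word y zs = alt_scale 0 (u_word y (others n y) :: 'f alt_free) + alt_scale 1 (v_word y (others n y)) \<or>
       v_word y zs = alt_scale 0 (u_word y (others n y) :: 'f alt_free) + alt_scale (-1) (v_word y (others n y))"
      by auto
    then show "x \<in> C" using x base[OF y] by metis
  qed
  then have span: "alt_free.span (uv_words (mset [0..<n])) \<subseteq> C" using sub by (rule alt_free.span_minimal)
  have "(word_class w :: 'f alt_free) \<in> C" if "w \<in> Poly_Mapping.keys f" for w
  proof -
    have w: "distinct (letters w)" "set (letters w) = {..<n}" using f that by (auto simp: multilinear_in_def)
    have "mset (letters w) = mset [0..<n]"
      by (rule set_eq_iff_mset_eq_distinct[THEN iffD1, OF w(1) distinct_upt])
        (simp add: w(2) atLeast0LessThan)
    moreover have "length (letters w) = n" using w by (metis card_lessThan distinct_card)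
    ultimately have "(word_class w :: 'f alt_free) \<in> alt_free.span (op_words (mset [0..<n]))"
      using word_class_in_op_words[of w] n by simp
    then have "word_class w \<in> alt_free.span (uv_words (mset [0..<n]) :: 'f alt_free set)"
      by (rule span_trans) (rule op_words_in_uv_words)
    then show ?thesis using span by blast
  qed
  then have "abs_alt_free f \<in> C"
    unfolding abs_expand by (intro alt_free.subspace_sum[OF sub] alt_free.subspace_scale[OF sub])
  then show ?thesis unfolding C_def by blast
qed

section \<open>Two model superalgebras\<close>

definition super_sign :: "bit \<Rightarrow> bit \<Rightarrow> 'f::field" where
  "super_sign i j = (if i = 1 \<and> j = 1 then - 1 else 1)"

lemma super_sign_simps [simp]:
  "super_sign 0 j = 1" "super_sign i 0 = 1" "super_sign 1 1 = -1"
  by (simp_all add: super_sign_def)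

lemma koszul_sign_3:
  "koszul_sign \<pi> (Juxt (Juxt (Letter 0) (Letter 1)) (Letter 2)) = 1"
  "koszul_sign \<pi> (Juxt (Letter 0) (Juxt (Letter 1) (Letter 2))) = 1"
  "koszul_sign \<pi> (Juxt (Juxt (Letter 1) (Letter 0)) (Letter 2)) = super_sign (\<pi> 0) (\<pi> 1)"
  "koszul_sign \<pi> (Juxt (Letter 1) (Juxt (Letter 0) (Letter 2))) = super_sign (\<pi> 0) (\<pi> 1)"
  "koszul_sign \<pi> (Juxt (Juxt (Letter 0) (Letter 2)) (Letter 1)) = super_sign (\<pi> 1) (\<pi> 2)"
  "koszul_sign \<pi> (Juxt (Letter 0) (Juxt (Letter 2) (Letter 1))) = super_sign (\<pi> 1) (\<pi> 2)"
  by (simp_all add: koszul_sign_letters koszul_factor_def super_sign_def)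

lemma koszul_sign_metab:
  "koszul_sign \<pi> (Juxt (Juxt (Letter 0) (Letter 1)) (Juxt (Letter 2) (Letter 3))) = 1"
  by (simp_all add: koszul_sign_letters koszul_factor_def)

context is_superalgebra
begin

lemma eval_superization_lin:
  assumes "\<And>x. \<rho> x \<in> homog A (\<pi> x)"
  shows "eval_superization A \<pi> \<rho> lin_alt_left =
      assoc (\<rho> 0) (\<rho> 1) (\<rho> 2) \<oplus> super_sign (\<pi> 0) (\<pi> 1) \<odot> assoc (\<rho> 1) (\<rho> 0) (\<rho> 2)"
    and "eval_superization A \<pi> \<rho> lin_alt_right =
      assoc (\<rho> 0) (\<rho> 1) (\<rho> 2) \<oplus> super_sign (\<pi> 1) (\<pi> 2) \<odot> assoc (\<rho> 0) (\<rho> 2) (\<rho> 1)"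
    and "eval_superization A \<pi> \<rho> metab = (\<rho> 0 \<otimes> \<rho> 1) \<otimes> (\<rho> 2 \<otimes> \<rho> 3)"
proof -
  have c: "\<rho> x \<in> carrier A" for x using assms homog_closed by blast
  then have r: "range \<rho> \<subseteq> carrier A" by auto
  note ex = eval_superization_eq npoly_expand_defs sign_twist_add sign_twist_diff sign_twist_single
  show "eval_superization A \<pi> \<rho> metab = (\<rho> 0 \<otimes> \<rho> 1) \<otimes> (\<rho> 2 \<otimes> \<rho> 3)"
    unfolding ex koszul_sign_metab using c r by simp
  show "eval_superization A \<pi> \<rho> lin_alt_left =
      assoc (\<rho> 0) (\<rho> 1) (\<rho> 2) \<oplus> super_sign (\<pi> 0) (\<pi> 1) \<odot> assoc (\<rho> 1) (\<rho> 0) (\<rho> 2)"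
    unfolding ex koszul_sign_3 assoc_def using c r
    by (simp add: eval_npoly_add eval_npoly_diff a_minus_def scale_add_right
        scale_minus_one[symmetric] scale_scale del: One_nat_def)
  show "eval_superization A \<pi> \<rho> lin_alt_right =
      assoc (\<rho> 0) (\<rho> 1) (\<rho> 2) \<oplus> super_sign (\<pi> 1) (\<pi> 2) \<odot> assoc (\<rho> 0) (\<rho> 2) (\<rho> 1)"
    unfolding ex koszul_sign_3 assoc_def using c r
    by (simp add: eval_npoly_add eval_npoly_diff a_minus_def scale_add_right
        scale_minus_one[symmetric] scale_scale del: One_nat_def)
qed

end

lemma super_class_altI:
  fixes A :: "('f::field_char_0, 'a) superalgebra"
  assumes A: "is_superalgebra A"
    and left: "\<And>a b c i j k. \<lbrakk>a \<in> homog A i; b \<in> homog A j; c \<in> homog A k\<rbrakk> \<Longrightarrow>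
      nonassoc_algebra.assoc A a b c \<oplus>\<^bsub>A\<^esub> super_sign i j \<odot>\<^bsub>A\<^esub> nonassoc_algebra.assoc A b a c = \<zero>\<^bsub>A\<^esub>"
    and right: "\<And>a b c i j k. \<lbrakk>a \<in> homog A i; b \<in> homog A j; c \<in> homog A k\<rbrakk> \<Longrightarrow>
      nonassoc_algebra.assoc A a b c \<oplus>\<^bsub>A\<^esub> super_sign j k \<odot>\<^bsub>A\<^esub> nonassoc_algebra.assoc A a c b = \<zero>\<^bsub>A\<^esub>"
    and met: "\<And>a b c d. \<lbrakk>a \<in> carrier A; b \<in> carrier A; c \<in> carrier A; d \<in> carrier A\<rbrakk> \<Longrightarrow>
      (a \<otimes>\<^bsub>A\<^esub> b) \<otimes>\<^bsub>A\<^esub> (c \<otimes>\<^bsub>A\<^esub> d) = \<zero>\<^bsub>A\<^esub>"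
  shows "A \<in> super_class alt_metabelian"
proof -
  interpret is_superalgebra A by fact
  show ?thesis unfolding super_class_alt_metabelian_iff super_satisfies_def
  proof (intro conjI allI impI A)
    fix \<pi> :: "nat \<Rightarrow> bit" and \<rho> assume \<rho>: "\<forall>x. \<rho> x \<in> homog A (\<pi> x)"
    then have h: "\<rho> x \<in> homog A (\<pi> x)" for x by blast
    show "eval_superization A \<pi> \<rho> lin_alt_left = \<zero>\<^bsub>A\<^esub>"
      unfolding eval_superization_lin(1)[OF h] by (rule left[OF h h h])
    show "eval_superization A \<pi> \<rho> lin_alt_right = \<zero>\<^bsub>A\<^esub>"
      unfolding eval_superization_lin(2)[OF h] by (rule right[OF h h h])
    show "eval_superization A \<pi> \<rho> metab = \<zero>\<^bsub>A\<^esub>"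
      unfolding eval_superization_lin(3)[OF h] by (intro met homog_closed[OF h])
  qed
qed

definition type_super :: "('v::ab_group_add \<Rightarrow> 'v \<Rightarrow> 'v) \<Rightarrow> ('f::field \<Rightarrow> 'v \<Rightarrow> 'v) \<Rightarrow> (bit \<Rightarrow> 'v set) \<Rightarrow>
    ('f, 'v) superalgebra" where
  "type_super m sc h = \<lparr>carrier = UNIV, monoid.mult = m, monoid.one = 0, ring.zero = 0, add = (+),
     module.smult = sc, homog = h\<rparr>"

lemma type_super_sel [simp]:
  "carrier (type_super m sc h) = UNIV" "monoid.mult (type_super m sc h) = m"
  "ring.zero (type_super m sc h) = 0" "add (type_super m sc h) = (+)"
  "module.smult (type_super m sc h) = sc" "homog (type_super m sc h) = h"
  by (simp_all add: type_super_def)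

lemma is_superalgebra_type_super:
  fixes sc :: "'f::field \<Rightarrow> 'v::ab_group_add \<Rightarrow> 'v"
  assumes vs: "vector_space sc"
    and m: "\<And>x y z. m (x + y) z = m x z + m y z" "\<And>x y z. m x (y + z) = m x y + m x z"
      "\<And>c x y. m (sc c x) y = sc c (m x y)" "\<And>c x y. m x (sc c y) = sc c (m x y)"
    and h: "\<And>i. 0 \<in> h i" "\<And>i x y. x \<in> h i \<Longrightarrow> y \<in> h i \<Longrightarrow> x + y \<in> h i" "\<And>i c x. x \<in> h i \<Longrightarrow> sc c x \<in> h i"
    and sum: "\<And>x. \<exists>a\<in>h 0. \<exists>b\<in>h 1. x = a + b" and int: "\<And>x. x \<in> h 0 \<Longrightarrow> x \<in> h 1 \<Longrightarrow> x = 0"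
    and gr: "\<And>x y i j. x \<in> h i \<Longrightarrow> y \<in> h j \<Longrightarrow> m x y \<in> h (i + j)"
  shows "is_superalgebra (type_super m sc h)"
proof -
  let ?A = "type_super m sc h"
  interpret vector_space sc by fact
  have ag: "abelian_group ?A"
    by (rule abelian_groupI) (auto simp: add_ac intro: exI[of _ "- x" for x] left_minus)
  have "module (ring_of_type_algebra :: 'f ring) ?A"
    by (rule moduleI[OF cring_from_type_algebra ag]) (auto simp: scale_right_distrib scale_left_distrib)
  then have na: "nonassoc_algebra ?A"
    by (rule nonassoc_algebra.intro, unfold_locales) (auto simp: m)
  interpret A: nonassoc_algebra ?A by fact
  show ?thesis
  proof (rule is_superalgebra.intro[OF na], rule is_superalgebra_axioms.intro)
    fix i
    show "submodule (homog ?A i) (ring_of_type_algebra :: 'f ring) ?A"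
    proof (rule A.submoduleI)
      show "\<ominus>\<^bsub>?A\<^esub> a \<in> homog ?A i" if "a \<in> homog ?A i" for a
        using that h(3)[of a i "-1"] A.scale_minus_one[of a] by simp
    qed (auto simp: h)
  next
    show "carrier ?A = homog ?A 0 <+>\<^bsub>?A\<^esub> homog ?A 1"
      using sum by (auto simp: set_eq_iff homog_sum_iff)
    show "homog ?A 0 \<inter> homog ?A 1 = {\<zero>\<^bsub>?A\<^esub>}" using h(1) int by auto
    show "x \<otimes>\<^bsub>?A\<^esub> y \<in> homog ?A (i + j)" if "x \<in> homog ?A i" "y \<in> homog ?A j" for x y i j
      using gr that unfolding type_super_sel .
  qed
qed

text \<open>The first model is the split null extension, by a bimodule with basis \<open>e\<^sub>0, f\<^sub>0\<close> (even),
  \<open>e\<^sub>1, f\<^sub>1\<close> (odd), of the line spanned by an odd \<open>x\<close> with \<open>x x = 0\<close>. Right multiplication by \<open>x\<close>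
  swaps \<open>e\<^sub>0\<close> with \<open>e\<^sub>1\<close> and \<open>f\<^sub>0\<close> with \<open>f\<^sub>1\<close>; left multiplication by \<open>x\<close> sends
  \<open>e\<^sub>0, f\<^sub>0, e\<^sub>1, f\<^sub>1\<close> to \<open>f\<^sub>1, - e\<^sub>1 - f\<^sub>1, e\<^sub>0 + f\<^sub>0, - e\<^sub>0\<close>.
  The coordinates are ordered \<open>x, e\<^sub>0, f\<^sub>0, e\<^sub>1, f\<^sub>1\<close>.\<close>

type_synonym 'f tuple5 = "'f \<times> 'f \<times> 'f \<times> 'f \<times> 'f"

fun bimod_mult :: "'f::field tuple5 \<Rightarrow> 'f tuple5 \<Rightarrow> 'f tuple5" where
  "bimod_mult (x, a, b, c, d) (x', a', b', c', d') =
     (0, x' * c + x * (c' - d'), x' * d + x * c', x' * a - x * b', x' * b + x * (a' - b'))"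

fun scale5 :: "'f::field \<Rightarrow> 'f tuple5 \<Rightarrow> 'f tuple5" where
  "scale5 k (x, a, b, c, d) = (k * x, k * a, k * b, k * c, k * d)"

definition bimod_homog :: "bit \<Rightarrow> 'f::field tuple5 set" where
  "bimod_homog i = (if i = 0 then {(x, a, b, c, d). x = 0 \<and> c = 0 \<and> d = 0} else {(x, a, b, c, d). a = 0 \<and> b = 0})"

definition bimod_algebra :: "('f::field_char_0, 'f tuple5) superalgebra" where
  "bimod_algebra = type_super bimod_mult scale5 bimod_homog"

lemma bimod_is_superalgebra: "is_superalgebra (bimod_algebra :: ('f::field_char_0, _) superalgebra)"
  unfolding bimod_algebra_def
proof (rule is_superalgebra_type_super)
  show "vector_space (scale5 :: 'f \<Rightarrow> _)"
    by standard (auto simp: plus_prod_def algebra_simps)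
  show "\<exists>a\<in>bimod_homog 0. \<exists>b\<in>bimod_homog 1. x = a + b" for x :: "'f tuple5"
  proof -
    obtain p a b c d where x: "x = (p, a, b, c, d)" by (cases x) auto
    show ?thesis
      by (rule bexI[of _ "(0, a, b, 0, 0)"], rule bexI[of _ "(p, 0, 0, c, d)"])
        (auto simp: x bimod_homog_def)
  qed
  show "bimod_mult x y \<in> bimod_homog (i + j)" if "x \<in> bimod_homog i" "y \<in> bimod_homog j" for x y :: "'f tuple5" and i j
    using that by (cases i; cases j) (auto simp: bimod_homog_def)
qed (auto simp: bimod_homog_def zero_prod_def plus_prod_def algebra_simps split: if_splits)

lemma bimod_in_super_class: "bimod_algebra \<in> (super_class alt_metabelian :: ('f::field_char_0, _) superalgebra set)"
proof (rule super_class_altI[OF bimod_is_superalgebra])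
  let ?A = "bimod_algebra :: ('f, _) superalgebra"
  interpret is_superalgebra ?A by (rule bimod_is_superalgebra)
  have neg: "\<ominus>\<^bsub>?A\<^esub> v = - v" for v
    by (rule M.minus_equality) (simp_all add: bimod_algebra_def)
  have minus: "u \<ominus>\<^bsub>?A\<^esub> v = u - v" for u v
    by (simp only: a_minus_def neg) (simp add: bimod_algebra_def)
  {
    fix a b c :: "'f tuple5" and i j k
    assume "a \<in> homog ?A i" "b \<in> homog ?A j" "c \<in> homog ?A k"
    then show "assoc a b c \<oplus>\<^bsub>?A\<^esub> super_sign i j \<odot>\<^bsub>?A\<^esub> assoc b a c = \<zero>\<^bsub>?A\<^esub>"
      and "assoc a b c \<oplus>\<^bsub>?A\<^esub> super_sign j k \<odot>\<^bsub>?A\<^esub> assoc a c b = \<zero>\<^bsub>?A\<^esub>"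
      unfolding assoc_def minus unfolding bimod_algebra_def
      by (cases i; cases j; cases k; auto simp: bimod_homog_def zero_prod_def minus_prod_def algebra_simps)+
  next
    fix a b c d :: "'f tuple5"
    show "(a \<otimes>\<^bsub>?A\<^esub> b) \<otimes>\<^bsub>?A\<^esub> (c \<otimes>\<^bsub>?A\<^esub> d) = \<zero>\<^bsub>?A\<^esub>"
      by (cases a; cases b; cases c; cases d) (simp add: bimod_algebra_def zero_prod_def)
  }
qed

text \<open>The second model consists of the strictly upper triangular \<open>4 \<times> 4\<close> matrices, with
  coordinates \<open>12, 13, 14, 23, 24, 34\<close>; the entry \<open>ij\<close> has parity \<open>d i + d j\<close>.\<close>

type_synonym 'f tuple6 = "'f \<times> 'f \<times> 'f \<times> 'f \<times> 'f \<times> 'f"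

fun tri_mult :: "'f::field tuple6 \<Rightarrow> 'f tuple6 \<Rightarrow> 'f tuple6" where
  "tri_mult (a12, a13, a14, a23, a24, a34) (b12, b13, b14, b23, b24, b34) =
     (0, a12 * b23, a12 * b24 + a13 * b34, 0, a23 * b34, 0)"

fun scale6 :: "'f::field \<Rightarrow> 'f tuple6 \<Rightarrow> 'f tuple6" where
  "scale6 k (a, b, c, d, e, f) = (k * a, k * b, k * c, k * d, k * e, k * f)"

definition tri_homog :: "(nat \<Rightarrow> bit) \<Rightarrow> bit \<Rightarrow> 'f::field tuple6 set" where
  "tri_homog d i = {(a12, a13, a14, a23, a24, a34).
     (d 1 + d 2 \<noteq> i \<longrightarrow> a12 = 0) \<and> (d 1 + d 3 \<noteq> i \<longrightarrow> a13 = 0) \<and> (d 1 + d 4 \<noteq> i \<longrightarrow> a14 = 0) \<and>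
     (d 2 + d 3 \<noteq> i \<longrightarrow> a23 = 0) \<and> (d 2 + d 4 \<noteq> i \<longrightarrow> a24 = 0) \<and> (d 3 + d 4 \<noteq> i \<longrightarrow> a34 = 0)}"

definition tri_algebra :: "(nat \<Rightarrow> bit) \<Rightarrow> ('f::field_char_0, 'f tuple6) superalgebra" where
  "tri_algebra d = type_super tri_mult scale6 (tri_homog d)"

lemma tri_is_superalgebra: "is_superalgebra (tri_algebra d :: ('f::field_char_0, _) superalgebra)"
  unfolding tri_algebra_def
proof (rule is_superalgebra_type_super)
  show "vector_space (scale6 :: 'f \<Rightarrow> _)"
    by standard (auto simp: plus_prod_def algebra_simps)
  have split: "(if b = 0 then p else 0) + (if b = 1 then p else 0) = p" for b :: bit and p :: 'f
    by (cases b) auto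
  have bit01: "b \<noteq> 0 \<or> b \<noteq> 1" for b :: bit using zero_neq_one by metis
  show "\<exists>a\<in>tri_homog d 0. \<exists>b\<in>tri_homog d 1. x = a + b" for x :: "'f tuple6"
  proof -
    obtain p q r s t u where x: "x = (p, q, r, s, t, u)" by (cases x) auto
    let ?c = "\<lambda>i. (if d 1 + d 2 = i then p else 0, if d 1 + d 3 = i then q else 0, if d 1 + d 4 = i then r else 0,
      if d 2 + d 3 = i then s else 0, if d 2 + d 4 = i then t else 0, if d 3 + d 4 = i then u else 0)"
    have "?c i \<in> tri_homog d i" for i by (simp add: tri_homog_def)
    moreover have "x = ?c 0 + ?c 1" by (simp only: x add_Pair split)
    ultimately show ?thesis by blast
  qed
  show "tri_mult x y \<in> tri_homog d (i + j)" if "x \<in> tri_homog d i" "y \<in> tri_homog d j" for x y :: "'f tuple6" and i j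
  proof -
    have path: "d p + d q = i \<Longrightarrow> d q + d r = j \<Longrightarrow> d p + d r = i + j" for p q r
      by (cases "d p"; cases "d q"; cases "d r") auto
    obtain a12 a13 a14 a23 a24 a34 where x: "x = (a12, a13, a14, a23, a24, a34)" by (cases x) auto
    obtain b12 b13 b14 b23 b24 b34 where y: "y = (b12, b13, b14, b23, b24, b34)" by (cases y) auto
    have xs: "d 1 + d 2 \<noteq> i \<Longrightarrow> a12 = 0" "d 1 + d 3 \<noteq> i \<Longrightarrow> a13 = 0" "d 2 + d 3 \<noteq> i \<Longrightarrow> a23 = 0"
      using that(1) unfolding x tri_homog_def mem_Collect_eq prod.case by blast+
    have ys: "d 2 + d 3 \<noteq> j \<Longrightarrow> b23 = 0" "d 2 + d 4 \<noteq> j \<Longrightarrow> b24 = 0" "d 3 + d 4 \<noteq> j \<Longrightarrow> b34 = 0"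
      using that(2) unfolding y tri_homog_def mem_Collect_eq prod.case by blast+
    have "d 1 + d 3 \<noteq> i + j \<Longrightarrow> a12 * b23 = 0" using xs(1) ys(1) path mult_eq_0_iff by metis
    moreover have "d 1 + d 4 \<noteq> i + j \<Longrightarrow> a12 * b24 = 0" using xs(1) ys(2) path mult_eq_0_iff by metis
    moreover have "d 1 + d 4 \<noteq> i + j \<Longrightarrow> a13 * b34 = 0" using xs(2) ys(3) path mult_eq_0_iff by metis
    moreover have "d 2 + d 4 \<noteq> i + j \<Longrightarrow> a23 * b34 = 0" using xs(3) ys(3) path mult_eq_0_iff by metis
    ultimately show ?thesis unfolding x y tri_homog_def tri_mult.simps mem_Collect_eq prod.case
      by (metis add.right_neutral)
  qed
  show "x = 0" if "x \<in> tri_homog d 0" "x \<in> tri_homog d 1" for x :: "'f tuple6"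
  proof -
    obtain p q r s t u where x: "x = (p, q, r, s, t, u)" by (cases x) auto
    have "p = 0" "q = 0" "r = 0" "s = 0" "t = 0" "u = 0"
      using that bit01 unfolding x tri_homog_def mem_Collect_eq prod.case by blast+
    then show ?thesis unfolding x zero_prod_def by simp
  qed
  fix x y z :: "'f tuple6" and c i
  show "tri_mult (x + y) z = tri_mult x z + tri_mult y z"
    by (cases x; cases y; cases z) (simp add: distrib_right)
  show "tri_mult x (y + z) = tri_mult x y + tri_mult x z"
    by (cases x; cases y; cases z) (simp add: distrib_left)
  show "tri_mult (scale6 c x) y = scale6 c (tri_mult x y)" "tri_mult x (scale6 c y) = scale6 c (tri_mult x y)"
    by (cases x; cases y; simp add: algebra_simps)+
  show "0 \<in> tri_homog d i" by (simp add: tri_homog_def zero_prod_def)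
  obtain p q r s t u where x: "x = (p, q, r, s, t, u)" by (cases x) auto
  obtain p' q' r' s' t' u' where y: "y = (p', q', r', s', t', u')" by (cases y) auto
  assume h: "x \<in> tri_homog d i"
  show "scale6 c x \<in> tri_homog d i"
    using h unfolding x tri_homog_def scale6.simps mem_Collect_eq prod.case by (metis mult_zero_right)
  assume "y \<in> tri_homog d i"
  with h show "x + y \<in> tri_homog d i"
    unfolding x y tri_homog_def add_Pair mem_Collect_eq prod.case by (metis add.right_neutral)
qed

text \<open>Matrix multiplication is associative, so all associators vanish, and a product of two
  products would need an entry four steps above the diagonal.\<close>

lemma tri_in_super_class: "tri_algebra d \<in> (super_class alt_metabelian :: ('f::field_char_0, _) superalgebra set)"
proof (rule super_class_altI[OF tri_is_superalgebra])
  let ?A = "tri_algebra d :: ('f, _) superalgebra"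
  interpret is_superalgebra ?A by (rule tri_is_superalgebra)
  have assoc: "assoc a b c = \<zero>\<^bsub>?A\<^esub>" for a b c
  proof -
    have "(a \<otimes>\<^bsub>?A\<^esub> b) \<otimes>\<^bsub>?A\<^esub> c = a \<otimes>\<^bsub>?A\<^esub> (b \<otimes>\<^bsub>?A\<^esub> c)"
      by (cases a; cases b; cases c) (simp add: tri_algebra_def algebra_simps)
    then show ?thesis unfolding assoc_def using M.r_neg by (simp add: a_minus_def tri_algebra_def)
  qed
  fix a b c d' :: "'f tuple6" and i j
  show "assoc a b c \<oplus>\<^bsub>?A\<^esub> super_sign i j \<odot>\<^bsub>?A\<^esub> assoc b a c = \<zero>\<^bsub>?A\<^esub>"
    "assoc a b c \<oplus>\<^bsub>?A\<^esub> super_sign i j \<odot>\<^bsub>?A\<^esub> assoc a c b = \<zero>\<^bsub>?A\<^esub>"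
    unfolding assoc by simp_all
  show "(a \<otimes>\<^bsub>?A\<^esub> b) \<otimes>\<^bsub>?A\<^esub> (c \<otimes>\<^bsub>?A\<^esub> d') = \<zero>\<^bsub>?A\<^esub>"
    by (cases a; cases b; cases c; cases d') (simp add: tri_algebra_def zero_prod_def)
qed

section \<open>Detecting identities in the models\<close>

lemma finsum_type_super:
  assumes "is_superalgebra (type_super m sc h)"
  shows "finsum (type_super m sc h) f K = sum f K"
proof -
  interpret is_superalgebra "type_super m sc h" by fact
  show ?thesis
    by (induction K rule: infinite_finite_induct) (simp_all add: M.finsum_infinite M.finsum_insert)
qed

lemma eval_superization_type_super:
  assumes A: "is_superalgebra (type_super m sc h)" and K: "finite K" "Poly_Mapping.keys f \<subseteq> K"
  shows "eval_superization (type_super m sc h) \<pi> \<rho> f =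
    (\<Sum>w\<in>K. sc (koszul_sign \<pi> w * Poly_Mapping.lookup f w) (eval_nword (type_super m sc h) \<rho> w))"
proof -
  interpret is_superalgebra "type_super m sc h" by (rule A)
  show ?thesis
    unfolding eval_superization_eq using K
    by (subst eval_npoly_superset[of _ K]) (simp_all add: finsum_type_super[OF A])
qed

definition bx :: "'f::field_char_0 tuple5" where "bx = (1, 0, 0, 0, 0)"

definition by_elt :: "bit \<Rightarrow> 'f::field_char_0 tuple5" where
  "by_elt \<epsilon> = (if \<epsilon> = 0 then (0, 1, 0, 0, 0) else (0, 0, 0, 1, 0))"

text \<open>One variable is mapped to a bimodule element of chosen parity and all others to the odd
  element \<open>x\<close>. This is all that can be done with one generator besides
  \<open>x\<close>, and it separates the normal forms.\<close>

definition probe :: "bit \<Rightarrow> nat \<Rightarrow> nat \<Rightarrow> 'f::field_char_0 tuple5" where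
  "probe \<epsilon> k i = (if i = k then by_elt \<epsilon> else bx)"

definition probe_parity :: "bit \<Rightarrow> nat \<Rightarrow> nat \<Rightarrow> bit" where
  "probe_parity \<epsilon> k i = (if i = k then \<epsilon> else 1)"

abbreviation probe_eval :: "bit \<Rightarrow> nat \<Rightarrow> (nat, 'f::field_char_0) npoly \<Rightarrow> 'f tuple5" where
  "probe_eval \<epsilon> k f \<equiv> eval_superization bimod_algebra (probe_parity \<epsilon> k) (probe \<epsilon> k) f"

lemma bimod_sel [simp]:
  "carrier bimod_algebra = UNIV" "monoid.mult bimod_algebra = bimod_mult"
  "ring.zero bimod_algebra = 0" "add bimod_algebra = (+)"
  "module.smult bimod_algebra = scale5" "homog bimod_algebra = bimod_homog"
  by (simp_all add: bimod_algebra_def)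

lemma bx_homog: "bx \<in> bimod_homog 1" and by_homog: "by_elt \<epsilon> \<in> bimod_homog \<epsilon>"
  by (cases \<epsilon>; simp add: bx_def by_elt_def bimod_homog_def)+

lemma probe_homog: "probe \<epsilon> k i \<in> bimod_homog (probe_parity \<epsilon> k i)"
  by (simp add: probe_def probe_parity_def bx_homog by_homog)

lemma
  fixes p q :: "(nat, 'f::field_char_0) npoly"
  shows probe_eval_add: "probe_eval \<epsilon> k (p + q) = probe_eval \<epsilon> k p + probe_eval \<epsilon> k q"
    and probe_eval_scale: "probe_eval \<epsilon> k (nscale c p) = scale5 c (probe_eval \<epsilon> k p)"
    and probe_eval_single: "probe_eval \<epsilon> k (Poly_Mapping.single w c) =
      scale5 (koszul_sign (probe_parity \<epsilon> k) w * c) (eval_nword bimod_algebra (probe \<epsilon> k) w)"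
proof -
  interpret is_superalgebra "bimod_algebra :: ('f, _) superalgebra" by (rule bimod_is_superalgebra)
  show "probe_eval \<epsilon> k (p + q) = probe_eval \<epsilon> k p + probe_eval \<epsilon> k q"
    and "probe_eval \<epsilon> k (nscale c p) = scale5 c (probe_eval \<epsilon> k p)"
    and "probe_eval \<epsilon> k (Poly_Mapping.single w c) =
      scale5 (koszul_sign (probe_parity \<epsilon> k) w * c) (eval_nword bimod_algebra (probe \<epsilon> k) w)"
    unfolding eval_superization_eq sign_twist_add sign_twist_scale sign_twist_single
    by (simp_all add: eval_npoly_add eval_npoly_scale)
qed

lemma probe_eval_zero: "probe_eval \<epsilon> k (0 :: (nat, 'f::field_char_0) npoly) = 0"
  using probe_eval_single[of \<epsilon> k "Letter 0" "0 :: 'f"]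
  by (cases "probe \<epsilon> k 0 :: 'f tuple5") (simp add: zero_prod_def)

lemma probe_eval_sum: "probe_eval \<epsilon> k (\<Sum>i\<in>I. p i) = (\<Sum>i\<in>I. probe_eval \<epsilon> k (p i))"
proof (induction I rule: infinite_finite_induct)
  case (insert x F)
  then show ?case by (simp add: probe_eval_add)
qed (simp_all add: probe_eval_zero)

lemma probe_eval_alt_ideal:
  assumes "p \<in> alt_ideal" "multilinear_in n p" shows "probe_eval \<epsilon> k p = 0"
proof -
  have "super_satisfies bimod_algebra p"
    using super_class_alt_ideal[OF bimod_in_super_class assms(1)] assms(2) multilinear_iff by blast
  then have "probe_eval \<epsilon> k p = \<zero>\<^bsub>bimod_algebra\<^esub>"
    by (rule super_satisfies_def[THEN iffD1, rule_format]) (simp add: probe_homog)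
  then show ?thesis by simp
qed

definition app_word :: "nat nword \<Rightarrow> nat list \<Rightarrow> nat nword" where
  "app_word w zs = foldl (\<lambda>w z. Juxt w (Letter z)) w zs"

lemma letters_app_word: "letters (app_word w zs) = letters w @ zs"
  unfolding app_word_def by (induction zs arbitrary: w) auto

lemma word_class_app_word: "word_class (app_word w zs) = rmul (word_class w) zs"
  unfolding app_word_def by (induction zs arbitrary: w) auto

text \<open>A polynomial representative of \<open>u_word\<close>; values in a model are attached to
  polynomials, not to classes modulo the T-ideal.\<close>

definition u_poly :: "nat \<Rightarrow> nat list \<Rightarrow> (nat, 'f::field_char_0) npoly" where
  "u_poly y zs = (let a = Letter (zs ! 0); b = Letter (zs ! 1) in
     Poly_Mapping.single (app_word (Juxt (Juxt (Letter y) a) b) (drop 2 zs)) 1 +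
     Poly_Mapping.single (app_word (Juxt b (Juxt (Letter y) a)) (drop 2 zs)) 1 +
     Poly_Mapping.single (app_word (Juxt b (Juxt a (Letter y))) (drop 2 zs)) 1)"

definition v_poly :: "nat \<Rightarrow> nat list \<Rightarrow> (nat, 'f::field_char_0) npoly" where
  "v_poly y zs = (let a = Letter (zs ! 0); b = Letter (zs ! 1) in
     Poly_Mapping.single (app_word (Juxt (Juxt (Letter y) a) b) (drop 2 zs)) 1 +
     Poly_Mapping.single (app_word (Juxt (Juxt a (Letter y)) b) (drop 2 zs)) 1 +
     Poly_Mapping.single (app_word (Juxt b (Juxt a (Letter y))) (drop 2 zs)) 1)"

lemma abs_u_poly: "abs_alt_free (u_poly y zs) = u_word y zs"
  by (simp add: u_poly_def Let_def abs_add abs_single word_class_app_word u_word_def u3_def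
      rmul_linear af_distrib add.assoc)

lemma abs_v_poly: "abs_alt_free (v_poly y zs) = v_word y zs"
  by (simp add: v_poly_def Let_def abs_add abs_single word_class_app_word v_word_def v3_def
      rmul_linear af_distrib add.assoc)

lemma multilinear_uv_poly:
  assumes "mset (y # zs) = mset [0..<n]" "length zs \<ge> 2"
  shows "multilinear_in n (u_poly y zs :: (nat, 'f::field_char_0) npoly)"
    and "multilinear_in n (v_poly y zs :: (nat, 'f) npoly)"
proof -
  obtain a b r where zs: "zs = a # b # r" using assms(2) by (cases zs; cases "tl zs") auto
  have d: "distinct (y # zs)" using assms(1) by (metis distinct_upt mset_eq_imp_distinct_iff)
  have s: "set (y # zs) = {..<n}" using assms(1) by (metis set_mset_mset atLeast_upt)
  show "multilinear_in n (u_poly y zs :: (nat, 'f) npoly)" "multilinear_in n (v_poly y zs :: (nat, 'f) npoly)"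
    unfolding u_poly_def v_poly_def Let_def zs
    by (intro multilinear_in_add multilinear_in_single;
      use d s in \<open>auto simp: zs letters_app_word\<close>)+
qed

definition rx :: "'f::field_char_0 tuple5 \<Rightarrow> 'f tuple5" where "rx w = bimod_mult w bx"

lemma rx_simp: "rx (x, a, b, c, d) = (0, c, d, a, b)"
  by (simp add: rx_def bx_def)

lemma eval_app_word:
  "k \<notin> set zs \<Longrightarrow> eval_nword bimod_algebra (probe \<epsilon> k) (app_word w zs) =
     (rx ^^ length zs) (eval_nword bimod_algebra (probe \<epsilon> k) w)"
  unfolding app_word_def
  by (induction zs arbitrary: w) (auto simp: probe_def rx_def funpow_swap1)

lemma eval_app_word_zero:
  "eval_nword bimod_algebra \<rho> w = 0 \<Longrightarrow> eval_nword bimod_algebra \<rho> (app_word w zs) = 0"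
proof -
  have "bimod_mult 0 v = 0" for v :: "'a tuple5" by (cases v) (simp add: zero_prod_def)
  then show "eval_nword bimod_algebra \<rho> w = 0 \<Longrightarrow> eval_nword bimod_algebra \<rho> (app_word w zs) = 0"
    unfolding app_word_def by (induction zs arbitrary: w) auto
qed

lemma bx_square: "bimod_mult bx bx = 0"
  by (simp add: bx_def zero_prod_def)

lemma bimod_mult_zero: "bimod_mult 0 v = 0" "bimod_mult v 0 = 0"
  by (cases v; simp add: zero_prod_def)+

lemma scale5_zero: "scale5 c 0 = 0"
  by (simp add: zero_prod_def)

text \<open>Each of the three summands contains a product of the variables \<open>y\<close> and
  \<open>zs ! 0\<close>. Both are sent to \<open>x\<close>, and \<open>x x = 0\<close>.\<close>

lemma probe_eval_uv_zero:
  assumes "y \<noteq> k" "zs ! 0 \<noteq> k"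
  shows "probe_eval \<epsilon> k (u_poly y zs) = (0 :: 'f::field_char_0 tuple5)" "probe_eval \<epsilon> k (v_poly y zs) = (0 :: 'f tuple5)"
  unfolding u_poly_def v_poly_def Let_def probe_eval_add probe_eval_single
  using assms by (simp_all add: eval_app_word_zero probe_def bx_square bimod_mult_zero scale5_zero)

lemma koszul_factor_swap:
  assumes "x \<noteq> y" shows "koszul_factor \<pi> y x = super_sign (\<pi> x) (\<pi> y) * (koszul_factor \<pi> x y :: 'f::field)"
  using assms by (auto simp: koszul_factor_def super_sign_def)

lemma list_koszul_nonzero: "list_koszul \<pi> xs \<noteq> (0 :: 'f::field)"
  by (induction xs) (auto simp: koszul_factor_def prod_list_zero_iff)

lemma rx_funpow_linear:
  "(rx ^^ n) (x + y) = (rx ^^ n) x + (rx ^^ n) y" "(rx ^^ n) (scale5 c x) = scale5 c ((rx ^^ n) x)"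
proof (induction n)
  case (Suc n)
  have "rx (x + y) = rx x + rx y" "rx (scale5 c x) = scale5 c (rx x)" for x y and c :: 'a
    by (cases x; cases y; simp add: rx_simp)+
  with Suc show "(rx ^^ Suc n) (x + y) = (rx ^^ Suc n) x + (rx ^^ Suc n) y"
    "(rx ^^ Suc n) (scale5 c x) = scale5 c ((rx ^^ Suc n) x)" by simp_all
qed simp_all

lemma rx_funpow_injective: "(rx ^^ n) (0, a, b, c, d) = 0 \<Longrightarrow> (a, b, c, d) = 0"
  by (induction n arbitrary: a b c d) (auto simp: funpow_Suc_right rx_simp zero_prod_def simp del: funpow.simps)

text \<open>The superized \<open>u3\<close> at the bimodule element of parity
  \<open>\<epsilon>\<close> and two copies of \<open>x\<close>, up to the Koszul sign of the sorted
  word, in the coordinates of \<open>bimod_algebra\<close>.\<close>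

definition u_value :: "bit \<Rightarrow> 'f::field_char_0 tuple5" where
  "u_value \<epsilon> = (if \<epsilon> = 0 then (0, 1, -1, 0, 0) else (0, 0, 0, 2, 1))"

definition v_value :: "bit \<Rightarrow> 'f::field_char_0 tuple5" where
  "v_value \<epsilon> = (if \<epsilon> = 0 then (0, 2, 1, 0, 0) else (0, 0, 0, 1, -1))"

text \<open>The Koszul signs of the three summands are compared with that of the word
  \<open>k # zs\<close>, which becomes a common factor; the remaining letters act by right
  multiplication by \<open>x\<close>.\<close>

lemma probe_eval_uv_value:
  assumes d: "distinct (k # zs)" and l: "length zs \<ge> 2"
  shows "probe_eval \<epsilon> k (u_poly k zs) = scale5 (list_koszul (probe_parity \<epsilon> k) (k # zs)) ((rx ^^ (length zs - 2)) (u_value \<epsilon> :: 'f::field_char_0 tuple5))"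
    and "probe_eval \<epsilon> k (v_poly k zs) = scale5 (list_koszul (probe_parity \<epsilon> k) (k # zs)) ((rx ^^ (length zs - 2)) (v_value \<epsilon> :: 'f tuple5))"
proof -
  obtain a b r where zs: "zs = a # b # r" using l by (cases zs; cases "tl zs") auto
  have ne: "a \<noteq> k" "b \<noteq> k" "a \<noteq> b" "k \<notin> set r" using d zs by auto
  let ?\<pi> = "probe_parity \<epsilon> k"
  have p: "?\<pi> k = \<epsilon>" "?\<pi> a = 1" "?\<pi> b = 1" using ne by (auto simp: probe_parity_def)
  have kf: "koszul_factor ?\<pi> a k = super_sign \<epsilon> 1 * (koszul_factor ?\<pi> k a :: 'f)"
    "koszul_factor ?\<pi> b k = super_sign \<epsilon> 1 * (koszul_factor ?\<pi> k b :: 'f)"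
    "koszul_factor ?\<pi> b a = - (koszul_factor ?\<pi> a b :: 'f)"
    using koszul_factor_swap[of k a ?\<pi>, where 'f='f] koszul_factor_swap[of k b ?\<pi>, where 'f='f]
      koszul_factor_swap[of a b ?\<pi>, where 'f='f] ne p by (auto simp: super_sign_def)
  let ?C = "list_koszul ?\<pi> (k # a # b # r) :: 'f"
  have s2: "super_sign \<epsilon> 1 * super_sign \<epsilon> 1 = (1 :: 'f)" by (simp add: super_sign_def)
  \<comment> \<open>Only the relative order of \<open>k\<close>, \<open>a\<close>, \<open>b\<close>
    changes: passing \<open>a\<close> or \<open>b\<close> over \<open>k\<close> costs
    \<open>super_sign \<epsilon> 1\<close>, and exchanging the odd \<open>a\<close> and
    \<open>b\<close> costs \<open>-1\<close>.\<close>
  have K: "list_koszul ?\<pi> (b # k # a # r) = ?C * (- super_sign \<epsilon> 1)"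
    "list_koszul ?\<pi> (b # a # k # r) = ?C * (-1)" "list_koszul ?\<pi> (a # k # b # r) = ?C * super_sign \<epsilon> 1"
    using s2 by (auto simp: kf algebra_simps)
  have e: "eval_nword bimod_algebra (probe \<epsilon> k) (Letter k) = by_elt \<epsilon>"
    "eval_nword bimod_algebra (probe \<epsilon> k) (Letter a) = bx" "eval_nword bimod_algebra (probe \<epsilon> k) (Letter b) = bx"
    using ne by (auto simp: probe_def)
  have val: "bimod_mult (bimod_mult (by_elt \<epsilon>) bx) bx + scale5 (- super_sign \<epsilon> 1) (bimod_mult bx (bimod_mult (by_elt \<epsilon>) bx))
      + scale5 (-1) (bimod_mult bx (bimod_mult bx (by_elt \<epsilon>))) = (u_value \<epsilon> :: 'f tuple5)"
    "bimod_mult (bimod_mult (by_elt \<epsilon>) bx) bx + scale5 (super_sign \<epsilon> 1) (bimod_mult (bimod_mult bx (by_elt \<epsilon>)) bx)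
      + scale5 (-1) (bimod_mult bx (bimod_mult bx (by_elt \<epsilon>))) = (v_value \<epsilon> :: 'f tuple5)"
    by (cases \<epsilon>; simp add: by_elt_def bx_def u_value_def v_value_def super_sign_def)+
  have sc: "scale5 (c * c') x = scale5 c (scale5 c' x)" "scale5 c (x + y) = scale5 c x + scale5 c y"
    for c c' :: 'f and x y by (cases x; cases y; simp add: algebra_simps)+
  show "probe_eval \<epsilon> k (u_poly k zs) = scale5 (list_koszul ?\<pi> (k # zs)) ((rx ^^ (length zs - 2)) (u_value \<epsilon> :: 'f tuple5))"
    unfolding val(1)[symmetric] rx_funpow_linear u_poly_def zs Let_def probe_eval_add probe_eval_single
      koszul_sign_letters letters_app_word
    using ne(4)
    by (simp add: eval_app_word e del: list_koszul.simps eval_nword.simps(1)) (simp only: K sc)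
  show "probe_eval \<epsilon> k (v_poly k zs) = scale5 (list_koszul ?\<pi> (k # zs)) ((rx ^^ (length zs - 2)) (v_value \<epsilon> :: 'f tuple5))"
    unfolding val(2)[symmetric] rx_funpow_linear v_poly_def zs Let_def probe_eval_add probe_eval_single
      koszul_sign_letters letters_app_word
    using ne(4)
    by (simp add: eval_app_word e del: list_koszul.simps eval_nword.simps(1)) (simp only: K sc)
qed

text \<open>Right multiplication by \<open>x\<close> is injective on the bimodule, so it can be
  stripped off. The two remaining coordinate equations lead to 3 times a coefficient being zero, for
  either parity.\<close>

lemma uv_values_independent:
  assumes "scale5 \<alpha> (scale5 C ((rx ^^ j) (u_value \<epsilon>))) + scale5 \<beta> (scale5 C ((rx ^^ j) (v_value \<epsilon>))) = 0"
    and "C \<noteq> (0 :: 'f::field_char_0)"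
  shows "\<alpha> = 0" "\<beta> = 0"
proof -
  have "(rx ^^ j) (scale5 (\<alpha> * C) (u_value \<epsilon>) + scale5 (\<beta> * C) (v_value \<epsilon>)) = 0"
  proof -
    have "scale5 \<alpha> (scale5 C x) = scale5 (\<alpha> * C) x" for \<alpha> C :: 'f and x by (cases x) (simp add: mult.assoc)
    then show ?thesis using assms(1) by (simp add: rx_funpow_linear)
  qed
  moreover obtain a b c d where eq: "scale5 (\<alpha> * C) (u_value \<epsilon>) + scale5 (\<beta> * C) (v_value \<epsilon>) = (0, a, b, c, d)"
    by (cases \<epsilon>) (simp_all add: u_value_def v_value_def)
  ultimately have "(a, b, c, d) = 0" by (intro rx_funpow_injective[of j]) simp
  then have z: "scale5 (\<alpha> * C) (u_value \<epsilon>) + scale5 (\<beta> * C) (v_value \<epsilon>) = 0"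
    using eq by (simp add: zero_prod_def)
  have three: "x = 0" if "3 * x = 0" for x :: 'f using that by simp
  have "\<alpha> * C = 0 \<and> \<beta> * C = 0"
  proof (cases \<epsilon>)
    case zero
    then have 1: "\<alpha> * C + 2 * (\<beta> * C) = 0" "\<beta> * C - \<alpha> * C = 0"
      using z by (simp_all add: u_value_def v_value_def zero_prod_def algebra_simps)
    then have "3 * (\<beta> * C) = 0" by Groebner_Basis.algebra
    then have "\<beta> * C = 0" by (rule three)
    moreover from this have "\<alpha> * C = 0" using 1 by Groebner_Basis.algebra
    ultimately show ?thesis by simp
  next
    case one
    then have 1: "2 * (\<alpha> * C) + \<beta> * C = 0" "\<alpha> * C - \<beta> * C = 0"
      using z by (simp_all add: u_value_def v_value_def zero_prod_def algebra_simps)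
    then have "3 * (\<alpha> * C) = 0" by Groebner_Basis.algebra
    then have "\<alpha> * C = 0" by (rule three)
    moreover from this have "\<beta> * C = 0" using 1 by Groebner_Basis.algebra
    ultimately show ?thesis by simp
  qed
  then show "\<alpha> = 0" "\<beta> = 0" using assms(2) by auto
qed

text \<open>In the normal form of \<open>f\<close> the probe at \<open>k\<close> annihilates every
  term with distinguished variable other than \<open>k\<close> and gives independent values to the
  two terms belonging to \<open>k\<close>, so all coefficients vanish.\<close>

theorem probe_detects_high_degree:
  fixes f :: "(nat, 'f::field_char_0) npoly"
  assumes f: "multilinear_in n f" and n: "n \<ge> 4" and z: "\<And>k. probe_eval \<epsilon> k f = 0"
  shows "f \<in> alt_ideal"
proof -
  obtain \<alpha> \<beta> where nf: "abs_alt_free f =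
    (\<Sum>m<n. alt_scale (\<alpha> m) (u_word m (others n m)) + alt_scale (\<beta> m) (v_word m (others n m)))"
    using normal_form[OF f n] by blast
  \<comment> \<open>A polynomial lift of the normal form. It differs from \<open>f\<close> by a
    member of the T-ideal, which all probes annihilate, so the probes of \<open>p\<close> vanish as
    well.\<close>
  define p where "p = (\<Sum>m<n. nscale (\<alpha> m) (u_poly m (others n m)) + nscale (\<beta> m) (v_poly m (others n m)))"
  have "abs_alt_free p = abs_alt_free f"
    unfolding p_def nf by (simp add: abs_sum abs_add abs_scale abs_u_poly abs_v_poly)
  then have fp: "f - p \<in> alt_ideal" by (simp add: abs_diff flip: abs_eq_zero_iff)
  have len: "length (others n m) = n - 1" if "m < n" for m
    using mset_others[OF that] by (metis One_nat_def diff_Suc_1 length_Cons length_upt minus_nat.diff_0 size_mset)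
  have ml: "multilinear_in n (u_poly m (others n m) :: (nat, 'f) npoly)"
    "multilinear_in n (v_poly m (others n m) :: (nat, 'f) npoly)" if "m < n" for m
  proof -
    have "length (others n m) \<ge> 2" using len[OF that] n by linarith
    then show "multilinear_in n (u_poly m (others n m) :: (nat, 'f) npoly)"
      "multilinear_in n (v_poly m (others n m) :: (nat, 'f) npoly)"
      by (rule multilinear_uv_poly[OF mset_others[OF that]])+
  qed
  have mz: "multilinear_in n (0 :: (nat, 'f) npoly)" by (simp add: multilinear_in_def)
  have mp: "multilinear_in n p"
  proof -
    have "multilinear_in n (\<Sum>m\<in>I. nscale (\<alpha> m) (u_poly m (others n m)) + nscale (\<beta> m) (v_poly m (others n m)))"
      if "finite I" "I \<subseteq> {..<n}" for I
      using that by (induction I) (auto intro!: mz multilinear_in_add multilinear_in_scale ml)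
    then show ?thesis unfolding p_def by simp
  qed
  have ep: "probe_eval \<epsilon> k p = 0" for k
  proof -
    have "probe_eval \<epsilon> k (f - p) = 0"
      by (rule probe_eval_alt_ideal[OF fp multilinear_in_diff[OF f mp]])
    moreover have "probe_eval \<epsilon> k f = probe_eval \<epsilon> k (f - p) + probe_eval \<epsilon> k p"
      by (simp flip: probe_eval_add)
    ultimately show ?thesis using z by simp
  qed
  have zero: "probe_eval \<epsilon> k (u_poly m (others n m)) = (0 :: 'f tuple5) \<and>
      probe_eval \<epsilon> k (v_poly m (others n m)) = (0 :: 'f tuple5)" if "m < n" "m \<noteq> k" for m k
  proof (cases "others n m ! 0 = k")
    case False
    then show ?thesis using probe_eval_uv_zero \<open>m \<noteq> k\<close> by blast
  next
    \<comment> \<open>If the probed variable is the first of the remaining letters, skewness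
      exchanges it with the second one; the vanishing of the summands then applies to the exchanged
      word.\<close>
    case True
    obtain a b ys where zs: "others n m = a # b # ys"
      using len[OF \<open>m < n\<close>] n by (cases "others n m"; cases "tl (others n m)") auto
    have M: "mset (m # b # a # ys) = mset [0..<n]"
      using mset_others[OF \<open>m < n\<close>] zs by (simp add: add_mset_commute)
    have "distinct (m # b # a # ys)" using M by (metis distinct_upt mset_eq_imp_distinct_iff)
    then have "b \<noteq> k" using True zs by auto
    have l: "length ([] @ a # b # ys) \<ge> 3" using len[OF \<open>m < n\<close>] zs n by auto
    have "u_poly m (others n m) + u_poly m (b # a # ys) \<in> (alt_ideal :: (nat, 'f) npoly set)"
      "v_poly m (others n m) + v_poly m (b # a # ys) \<in> (alt_ideal :: (nat, 'f) npoly set)"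
      using u_word_skew[OF l, of m, where 'f='f] zs
      by (simp_all add: abs_add abs_u_poly abs_v_poly flip: abs_eq_zero_iff)
    moreover have "multilinear_in n (u_poly m (b # a # ys) :: (nat, 'f) npoly)"
      "multilinear_in n (v_poly m (b # a # ys) :: (nat, 'f) npoly)"
      by (rule multilinear_uv_poly[OF M]; simp)+
    ultimately have "probe_eval \<epsilon> k (u_poly m (others n m) + u_poly m (b # a # ys)) = (0 :: 'f tuple5)"
      "probe_eval \<epsilon> k (v_poly m (others n m) + v_poly m (b # a # ys)) = (0 :: 'f tuple5)"
      using ml[OF \<open>m < n\<close>] by (blast intro: probe_eval_alt_ideal multilinear_in_add)+
    moreover have "probe_eval \<epsilon> k (u_poly m (b # a # ys)) = (0 :: 'f tuple5)"
      "probe_eval \<epsilon> k (v_poly m (b # a # ys)) = (0 :: 'f tuple5)"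
      using probe_eval_uv_zero[of m k "b # a # ys"] \<open>m \<noteq> k\<close> \<open>b \<noteq> k\<close> by simp_all
    ultimately show ?thesis by (simp add: probe_eval_add)
  qed
  have "\<alpha> k = 0 \<and> \<beta> k = 0" if k: "k < n" for k
  proof -
    let ?E = "\<lambda>m. scale5 (\<alpha> m) (probe_eval \<epsilon> k (u_poly m (others n m))) + scale5 (\<beta> m) (probe_eval \<epsilon> k (v_poly m (others n m)))"
    have "0 = (\<Sum>m<n. ?E m)"
      using ep[of k] unfolding p_def by (simp add: probe_eval_sum probe_eval_add probe_eval_scale)
    also have "\<dots> = ?E k + (\<Sum>m\<in>{..<n} - {k}. ?E m)" using k by (simp add: sum.remove)
    also have "(\<Sum>m\<in>{..<n} - {k}. ?E m) = 0" using zero by (intro sum.neutral) (auto simp: scale5_zero)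
    finally have *: "?E k = 0" by simp
    have "distinct (k # others n k)" using mset_others[OF k] by (metis distinct_upt mset_eq_imp_distinct_iff)
    moreover have "length (others n k) \<ge> 2" using len[OF k] n by linarith
    ultimately show ?thesis
      using * uv_values_independent[of "\<alpha> k" _ _ \<epsilon> "\<beta> k", OF _ list_koszul_nonzero]
      by (simp only: probe_eval_uv_value)
  qed
  then have "abs_alt_free f = 0" unfolding nf by simp
  then show ?thesis by (simp add: abs_eq_zero_iff)
qed

section \<open>Detection in degrees up to three\<close>

lemma word_length_3:
  assumes "length (letters w) = 3"
  shows "\<exists>i j k. w = Juxt (Juxt (Letter i) (Letter j)) (Letter k) \<or> w = Juxt (Letter i) (Juxt (Letter j) (Letter k))"
proof (cases w)
  case (Juxt u v)
  have "length (letters u) > 0" "length (letters v) > 0" using letters_nonempty by auto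
  moreover have "length (letters u) + length (letters v) = 3" using assms Juxt by simp
  ultimately have "length (letters u) = 2 \<and> length (letters v) = 1 \<or> length (letters u) = 1 \<and> length (letters v) = 2"
    by linarith
  then show ?thesis
  proof
    assume "length (letters u) = 2 \<and> length (letters v) = 1"
    then show ?thesis using length_letters_2[of u] length_letters_1[of v] Juxt by blast
  next
    assume "length (letters u) = 1 \<and> length (letters v) = 2"
    then show ?thesis using length_letters_1[of u] length_letters_2[of v] Juxt by blast
  qed
qed (use assms in simp)

definition words2 :: "nat nword set" where
  "words2 = {Juxt (Letter 0) (Letter 1), Juxt (Letter 1) (Letter 0)}"

definition rword :: "nat \<Rightarrow> nat \<Rightarrow> nat \<Rightarrow> nat nword" where
  "rword i j k = Juxt (Juxt (Letter i) (Letter j)) (Letter k)"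

definition lword :: "nat \<Rightarrow> nat \<Rightarrow> nat \<Rightarrow> nat nword" where
  "lword i j k = Juxt (Letter i) (Juxt (Letter j) (Letter k))"

definition words3 :: "nat nword set" where
  "words3 = {rword 0 1 2, rword 0 2 1, rword 1 0 2, rword 1 2 0, rword 2 0 1, rword 2 1 0,
     lword 0 1 2, lword 0 2 1, lword 1 0 2, lword 1 2 0, lword 2 0 1, lword 2 1 0}"

lemma multilinear_words2:
  assumes "multilinear_in 2 f" shows "Poly_Mapping.keys f \<subseteq> words2"
proof
  fix w assume "w \<in> Poly_Mapping.keys f"
  then have w: "distinct (letters w)" "set (letters w) = {0, 1}"
    using assms by (auto simp: multilinear_in_def numeral_2_eq_2 lessThan_Suc)
  then have "length (letters w) = 2" using distinct_card by fastforce
  then obtain i j where "w = Juxt (Letter i) (Letter j)" using length_letters_2 by blast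
  then show "w \<in> words2" using w by (auto simp: words2_def doubleton_eq_iff)
qed

lemma multilinear_words3:
  assumes "multilinear_in 3 f" shows "Poly_Mapping.keys f \<subseteq> words3"
proof
  fix w assume "w \<in> Poly_Mapping.keys f"
  then have w: "distinct (letters w)" "set (letters w) = {0, 1, 2}"
    using assms by (auto simp: multilinear_in_def numeral_3_eq_3 numeral_2_eq_2 lessThan_Suc)
  then have "length (letters w) = card {0, 1, 2 :: nat}" using distinct_card by metis
  then have "length (letters w) = 3" by simp
  then obtain i j k where ijk: "w = rword i j k \<or> w = lword i j k"
    using word_length_3 unfolding rword_def lword_def by blast
  then have lw: "letters w = [i, j, k]" by (elim disjE) (simp_all add: rword_def lword_def)
  have d: "distinct [i, j, k]" using w(1) unfolding lw .
  have e: "{i, j, k} = {0, 1, 2}" using w(2) unfolding lw list.set .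
  have "i \<in> {0, 1, 2}" "j \<in> {0, 1, 2}" "k \<in> {0, 1, 2}" by (simp_all only: e[symmetric] insert_iff simp_thms)
  then have "(i, j, k) \<in> {(0, 1, 2), (0, 2, 1), (1, 0, 2), (1, 2, 0), (2, 0, 1), (2, 1, 0)}" using d by auto
  then show "w \<in> words3" using ijk unfolding words3_def by auto
qed

lemma probe_eval_expand:
  fixes f :: "(nat, 'f::field_char_0) npoly"
  assumes "finite K" "Poly_Mapping.keys f \<subseteq> K"
  shows "probe_eval \<epsilon> k f = (\<Sum>w\<in>K. scale5 (koszul_sign (probe_parity \<epsilon> k) w * Poly_Mapping.lookup f w)
    (eval_nword bimod_algebra (probe \<epsilon> k) w))"
  unfolding bimod_algebra_def
  by (rule eval_superization_type_super[OF bimod_is_superalgebra[unfolded bimod_algebra_def] assms])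

text \<open>Here \<open>c\<close> and \<open>d\<close> are the coefficients of the words bracketed
  to the left and to the right. The hypotheses are two coordinates for each of the three even probes
  and the sum of all coefficients. The conclusions are rational combinations of them; the displayed
  multipliers are these combinations times 6.\<close>

lemma degree3_system_0:
  fixes c012 c021 c102 c120 c201 c210 d012 d021 d102 d120 d201 d210 :: "'f::field_char_0"
  assumes "c012 - c021 + d102 - d201 - d120 + d210 = 0" "c102 - c201 + d102 - d201 = 0" "c102 - c120 + d012 - d210 - d021 + d201 = 0" "c012 - c210 + d012 - d210 = 0" "c201 - c210 + d021 - d120 - d012 + d102 = 0" "c021 - c120 + d021 - d120 = 0" "c012 + c021 + c102 + c120 + c201 + c210 + d012 + d021 + d102 + d120 + d201 + d210 = 0"
  shows "c012 + d012 = 0" "c021 + d021 = 0" "c102 + d102 = 0" "c120 + d120 = 0" "c201 + d201 = 0" "c210 + d210 = 0" "d012 - d021 - d102 + d120 + d201 - d210 = 0"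
proof -
  have six: "x = 0" if "6 * x = 0" for x :: 'f using that by simp
  have "6 * (c012 + d012) = (2) * (c012 - c021 + d102 - d201 - d120 + d210) + (-1) * (c102 - c201 + d102 - d201) + (3) * (c012 - c210 + d012 - d210) + (-2) * (c201 - c210 + d021 - d120 - d012 + d102) + (1) * (c021 - c120 + d021 - d120) + (1) * (c012 + c021 + c102 + c120 + c201 + c210 + d012 + d021 + d102 + d120 + d201 + d210)"
    by (simp add: algebra_simps)
  then show "c012 + d012 = 0" unfolding assms by - (rule six, simp)
  have "6 * (c021 + d021) = (-2) * (c012 - c021 + d102 - d201 - d120 + d210) + (1) * (c102 - c201 + d102 - d201) + (-2) * (c102 - c120 + d012 - d210 - d021 + d201) + (1) * (c012 - c210 + d012 - d210) + (3) * (c021 - c120 + d021 - d120) + (1) * (c012 + c021 + c102 + c120 + c201 + c210 + d012 + d021 + d102 + d120 + d201 + d210)"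
    by (simp add: algebra_simps)
  then show "c021 + d021 = 0" unfolding assms by - (rule six, simp)
  have "6 * (c102 + d102) = (3) * (c102 - c201 + d102 - d201) + (2) * (c102 - c120 + d012 - d210 - d021 + d201) + (-1) * (c012 - c210 + d012 - d210) + (2) * (c201 - c210 + d021 - d120 - d012 + d102) + (-1) * (c021 - c120 + d021 - d120) + (1) * (c012 + c021 + c102 + c120 + c201 + c210 + d012 + d021 + d102 + d120 + d201 + d210)"
    by (simp add: algebra_simps)
  then show "c102 + d102 = 0" unfolding assms by - (rule six, simp)
  have "6 * (c120 + d120) = (-2) * (c012 - c021 + d102 - d201 - d120 + d210) + (1) * (c102 - c201 + d102 - d201) + (-2) * (c102 - c120 + d012 - d210 - d021 + d201) + (1) * (c012 - c210 + d012 - d210) + (-3) * (c021 - c120 + d021 - d120) + (1) * (c012 + c021 + c102 + c120 + c201 + c210 + d012 + d021 + d102 + d120 + d201 + d210)"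
    by (simp add: algebra_simps)
  then show "c120 + d120 = 0" unfolding assms by - (rule six, simp)
  have "6 * (c201 + d201) = (-3) * (c102 - c201 + d102 - d201) + (2) * (c102 - c120 + d012 - d210 - d021 + d201) + (-1) * (c012 - c210 + d012 - d210) + (2) * (c201 - c210 + d021 - d120 - d012 + d102) + (-1) * (c021 - c120 + d021 - d120) + (1) * (c012 + c021 + c102 + c120 + c201 + c210 + d012 + d021 + d102 + d120 + d201 + d210)"
    by (simp add: algebra_simps)
  then show "c201 + d201 = 0" unfolding assms by - (rule six, simp)
  have "6 * (c210 + d210) = (2) * (c012 - c021 + d102 - d201 - d120 + d210) + (-1) * (c102 - c201 + d102 - d201) + (-3) * (c012 - c210 + d012 - d210) + (-2) * (c201 - c210 + d021 - d120 - d012 + d102) + (1) * (c021 - c120 + d021 - d120) + (1) * (c012 + c021 + c102 + c120 + c201 + c210 + d012 + d021 + d102 + d120 + d201 + d210)"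
    by (simp add: algebra_simps)
  then show "c210 + d210 = 0" unfolding assms by - (rule six, simp)
  have "6 * (d012 - d021 - d102 + d120 + d201 - d210) = (-2) * (c012 - c021 + d102 - d201 - d120 + d210) + (-2) * (c102 - c201 + d102 - d201) + (2) * (c102 - c120 + d012 - d210 - d021 + d201) + (2) * (c012 - c210 + d012 - d210) + (-2) * (c201 - c210 + d021 - d120 - d012 + d102) + (-2) * (c021 - c120 + d021 - d120)"
    by (simp add: algebra_simps)
  then show "d012 - d021 - d102 + d120 + d201 - d210 = 0" unfolding assms by - (rule six, simp)
qed

text \<open>The same system for the odd probe, whose Koszul signs change the equations but not their
  consequences.\<close>

lemma degree3_system_1:
  fixes c012 c021 c102 c120 c201 c210 d012 d021 d102 d120 d201 d210 :: "'f::field_char_0"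
  assumes "c012 - c021 - c102 + c201 - d120 + d210 = 0" "- c102 + c201 - d102 + d201 = 0" "- c102 + c120 + c012 - c210 + d021 - d201 = 0" "c012 - c210 + d012 - d210 = 0" "c201 - c210 - c021 + c120 - d012 + d102 = 0" "- c021 + c120 - d021 + d120 = 0" "c012 + c021 + c102 + c120 + c201 + c210 + d012 + d021 + d102 + d120 + d201 + d210 = 0"
  shows "c012 + d012 = 0" "c021 + d021 = 0" "c102 + d102 = 0" "c120 + d120 = 0" "c201 + d201 = 0" "c210 + d210 = 0" "d012 - d021 - d102 + d120 + d201 - d210 = 0"
proof -
  have six: "x = 0" if "6 * x = 0" for x :: 'f using that by simp
  have "6 * (c012 + d012) = (2) * (c012 - c021 - c102 + c201 - d120 + d210) + (-1) * (- c102 + c201 - d102 + d201) + (3) * (c012 - c210 + d012 - d210) + (-2) * (c201 - c210 - c021 + c120 - d012 + d102) + (1) * (- c021 + c120 - d021 + d120) + (1) * (c012 + c021 + c102 + c120 + c201 + c210 + d012 + d021 + d102 + d120 + d201 + d210)"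
    by (simp add: algebra_simps)
  then show "c012 + d012 = 0" unfolding assms by - (rule six, simp)
  have "6 * (c021 + d021) = (-2) * (c012 - c021 - c102 + c201 - d120 + d210) + (1) * (- c102 + c201 - d102 + d201) + (2) * (- c102 + c120 + c012 - c210 + d021 - d201) + (-1) * (c012 - c210 + d012 - d210) + (-3) * (- c021 + c120 - d021 + d120) + (1) * (c012 + c021 + c102 + c120 + c201 + c210 + d012 + d021 + d102 + d120 + d201 + d210)"
    by (simp add: algebra_simps)
  then show "c021 + d021 = 0" unfolding assms by - (rule six, simp)
  have "6 * (c102 + d102) = (-3) * (- c102 + c201 - d102 + d201) + (-2) * (- c102 + c120 + c012 - c210 + d021 - d201) + (1) * (c012 - c210 + d012 - d210) + (2) * (c201 - c210 - c021 + c120 - d012 + d102) + (-1) * (- c021 + c120 - d021 + d120) + (1) * (c012 + c021 + c102 + c120 + c201 + c210 + d012 + d021 + d102 + d120 + d201 + d210)"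
    by (simp add: algebra_simps)
  then show "c102 + d102 = 0" unfolding assms by - (rule six, simp)
  have "6 * (c120 + d120) = (-2) * (c012 - c021 - c102 + c201 - d120 + d210) + (1) * (- c102 + c201 - d102 + d201) + (2) * (- c102 + c120 + c012 - c210 + d021 - d201) + (-1) * (c012 - c210 + d012 - d210) + (3) * (- c021 + c120 - d021 + d120) + (1) * (c012 + c021 + c102 + c120 + c201 + c210 + d012 + d021 + d102 + d120 + d201 + d210)"
    by (simp add: algebra_simps)
  then show "c120 + d120 = 0" unfolding assms by - (rule six, simp)
  have "6 * (c201 + d201) = (3) * (- c102 + c201 - d102 + d201) + (-2) * (- c102 + c120 + c012 - c210 + d021 - d201) + (1) * (c012 - c210 + d012 - d210) + (2) * (c201 - c210 - c021 + c120 - d012 + d102) + (-1) * (- c021 + c120 - d021 + d120) + (1) * (c012 + c021 + c102 + c120 + c201 + c210 + d012 + d021 + d102 + d120 + d201 + d210)"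
    by (simp add: algebra_simps)
  then show "c201 + d201 = 0" unfolding assms by - (rule six, simp)
  have "6 * (c210 + d210) = (2) * (c012 - c021 - c102 + c201 - d120 + d210) + (-1) * (- c102 + c201 - d102 + d201) + (-3) * (c012 - c210 + d012 - d210) + (-2) * (c201 - c210 - c021 + c120 - d012 + d102) + (1) * (- c021 + c120 - d021 + d120) + (1) * (c012 + c021 + c102 + c120 + c201 + c210 + d012 + d021 + d102 + d120 + d201 + d210)"
    by (simp add: algebra_simps)
  then show "c210 + d210 = 0" unfolding assms by - (rule six, simp)
  have "6 * (d012 - d021 - d102 + d120 + d201 - d210) = (-2) * (c012 - c021 - c102 + c201 - d120 + d210) + (4) * (- c102 + c201 - d102 + d201) + (-2) * (- c102 + c120 + c012 - c210 + d021 - d201) + (4) * (c012 - c210 + d012 - d210) + (-2) * (c201 - c210 - c021 + c120 - d012 + d102) + (4) * (- c021 + c120 - d021 + d120)"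
    by (simp add: algebra_simps)
  then show "d012 - d021 - d102 + d120 + d201 - d210 = 0" unfolding assms by - (rule six, simp)
qed

text \<open>Six probe equations and the coefficient sum force \<open>f\<close> to be a combination
  of associators whose signed coefficients sum to zero. Such a combination vanishes in an
  alternative algebra, as the associator is skew-symmetric.\<close>

theorem probe_detects_degree_3:
  fixes f :: "(nat, 'f::field_char_0) npoly"
  assumes f: "multilinear_in 3 f" and z: "\<And>k. probe_eval \<epsilon> k f = 0"
    and s: "(\<Sum>w\<in>words3. Poly_Mapping.lookup f w) = 0"
  shows "f \<in> alt_ideal"
proof -
  let ?c = "\<lambda>i j k. Poly_Mapping.lookup f (rword i j k)" and ?d = "\<lambda>i j k. Poly_Mapping.lookup f (lword i j k)"
  have fin: "finite words3" by (simp add: words3_def)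
  note ex = probe_eval_expand[OF fin multilinear_words3[OF f]]
  have inj: "rword i j k = rword i' j' k' \<longleftrightarrow> i = i' \<and> j = j' \<and> k = k'"
    "lword i j k = lword i' j' k' \<longleftrightarrow> i = i' \<and> j = j' \<and> k = k'"
    "rword i j k \<noteq> lword i' j' k'" "lword i j k \<noteq> rword i' j' k'" for i j k i' j' k'
    by (auto simp: rword_def lword_def)
  have ev: "eval_nword bimod_algebra \<rho> (rword i j k) = bimod_mult (bimod_mult (\<rho> i) (\<rho> j)) (\<rho> k)"
    "eval_nword bimod_algebra \<rho> (lword i j k) = bimod_mult (\<rho> i) (bimod_mult (\<rho> j) (\<rho> k))" for \<rho> :: "nat \<Rightarrow> 'f tuple5" and i j k
    by (simp_all add: rword_def lword_def)
  have ks: "koszul_sign \<pi> (rword i j k) = koszul_factor \<pi> i j * koszul_factor \<pi> i k * (koszul_factor \<pi> j k :: 'f)"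
    "koszul_sign \<pi> (lword i j k) = koszul_factor \<pi> i j * koszul_factor \<pi> i k * (koszul_factor \<pi> j k :: 'f)" for \<pi> i j k
    by (simp_all add: rword_def lword_def koszul_sign_letters)
  note expand = words3_def inj ev ks koszul_factor_def probe_parity_def probe_def bx_def by_elt_def
  have total: "?c 0 1 2 + ?c 0 2 1 + ?c 1 0 2 + ?c 1 2 0 + ?c 2 0 1 + ?c 2 1 0 + ?d 0 1 2 + ?d 0 2 1 + ?d 1 0 2 + ?d 1 2 0 + ?d 2 0 1 + ?d 2 1 0 = 0"
    using s by (simp add: words3_def inj add_ac)
  have sol: "(?c 0 1 2 + ?d 0 1 2 = 0 \<and> ?c 0 2 1 + ?d 0 2 1 = 0 \<and> ?c 1 0 2 + ?d 1 0 2 = 0 \<and> ?c 1 2 0 + ?d 1 2 0 = 0 \<and> ?c 2 0 1 + ?d 2 0 1 = 0 \<and> ?c 2 1 0 + ?d 2 1 0 = 0) \<and> ?d 0 1 2 - ?d 0 2 1 - ?d 1 0 2 + ?d 1 2 0 + ?d 2 0 1 - ?d 2 1 0 = 0"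
  proof (cases \<epsilon>)

    case zero
    have e0: "?c 0 1 2 - ?c 0 2 1 + ?d 1 0 2 - ?d 2 0 1 - ?d 1 2 0 + ?d 2 1 0 = 0" "?c 1 0 2 - ?c 2 0 1 + ?d 1 0 2 - ?d 2 0 1 = 0"
      using z[of 0] unfolding ex zero by (simp_all add: expand zero_prod_def algebra_simps)
    have e1: "?c 1 0 2 - ?c 1 2 0 + ?d 0 1 2 - ?d 2 1 0 - ?d 0 2 1 + ?d 2 0 1 = 0" "?c 0 1 2 - ?c 2 1 0 + ?d 0 1 2 - ?d 2 1 0 = 0"
      using z[of 1] unfolding ex zero by (simp_all add: expand zero_prod_def algebra_simps)
    have e2: "?c 2 0 1 - ?c 2 1 0 + ?d 0 2 1 - ?d 1 2 0 - ?d 0 1 2 + ?d 1 0 2 = 0" "?c 0 2 1 - ?c 1 2 0 + ?d 0 2 1 - ?d 1 2 0 = 0"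
      using z[of 2] unfolding ex zero by (simp_all add: expand zero_prod_def algebra_simps)

    show ?thesis using degree3_system_0[OF e0 e1 e2 total] by blast

  next

    case one
    have e0: "?c 0 1 2 - ?c 0 2 1 - ?c 1 0 2 + ?c 2 0 1 - ?d 1 2 0 + ?d 2 1 0 = 0" "- ?c 1 0 2 + ?c 2 0 1 - ?d 1 0 2 + ?d 2 0 1 = 0"
      using z[of 0] unfolding ex one by (simp_all add: expand zero_prod_def algebra_simps)
    have e1: "- ?c 1 0 2 + ?c 1 2 0 + ?c 0 1 2 - ?c 2 1 0 + ?d 0 2 1 - ?d 2 0 1 = 0" "?c 0 1 2 - ?c 2 1 0 + ?d 0 1 2 - ?d 2 1 0 = 0"
      using z[of 1] unfolding ex one by (simp_all add: expand zero_prod_def algebra_simps)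
    have e2: "?c 2 0 1 - ?c 2 1 0 - ?c 0 2 1 + ?c 1 2 0 - ?d 0 1 2 + ?d 1 0 2 = 0" "- ?c 0 2 1 + ?c 1 2 0 - ?d 0 2 1 + ?d 1 2 0 = 0"
      using z[of 2] unfolding ex one by (simp_all add: expand zero_prod_def algebra_simps)

    show ?thesis using degree3_system_1[OF e0 e1 e2 total] by blast

  qed

  \<comment> \<open>The associators of generators. Trading right-bracketed words for left-bracketed
    ones and associators, and reducing all associators to that of 0, 1, 2, leaves only the signed
    sum of the \<open>d\<close> coefficients.\<close>
  define a where "a i j k = (gen i * gen j * gen k - gen i * (gen j * gen k) :: 'f alt_free)" for i j k
  have left: "word_class (lword i j k) = word_class (rword i j k) - a i j k" for i j k
    by (simp add: rword_def lword_def a_def)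
  have skew: "a j i k = - a i j k" "a i k j = - a i j k" for i j k
    unfolding a_def by (rule minus_unique[symmetric], rule af_swap_left af_swap_right)+
  have a: "a 0 2 1 = - a 0 1 2" "a 1 0 2 = - a 0 1 2" "a 1 2 0 = a 0 1 2" "a 2 0 1 = a 0 1 2" "a 2 1 0 = - a 0 1 2"
    using skew(2)[of 0 2 1] skew(1)[of 1 0 2] skew(2)[of 1 2 0] skew(1)[of 2 0 1] skew(2)[of 2 1 0] by simp_all
  have d: "?d i j k = - ?c i j k" if "?c i j k + ?d i j k = 0" for i j k
    using that by (simp add: add_eq_0_iff)
  have "abs_alt_free f = (\<Sum>w\<in>words3. alt_scale (Poly_Mapping.lookup f w) (word_class w))"
    unfolding abs_expand using multilinear_words3[OF f] fin
    by (intro sum.mono_neutral_left) (auto simp: in_keys_iff)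
  also have "\<dots> = alt_scale (?c 0 1 2) (word_class (rword 0 1 2)) + alt_scale (?c 0 2 1) (word_class (rword 0 2 1)) + alt_scale (?c 1 0 2) (word_class (rword 1 0 2)) + alt_scale (?c 1 2 0) (word_class (rword 1 2 0)) + alt_scale (?c 2 0 1) (word_class (rword 2 0 1)) + alt_scale (?c 2 1 0) (word_class (rword 2 1 0)) + alt_scale (?d 0 1 2) (word_class (lword 0 1 2)) + alt_scale (?d 0 2 1) (word_class (lword 0 2 1)) + alt_scale (?d 1 0 2) (word_class (lword 1 0 2)) + alt_scale (?d 1 2 0) (word_class (lword 1 2 0)) + alt_scale (?d 2 0 1) (word_class (lword 2 0 1)) + alt_scale (?d 2 1 0) (word_class (lword 2 1 0))"
    by (simp add: words3_def inj add_ac)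
  also have "\<dots> = - alt_scale (?d 0 1 2 - ?d 0 2 1 - ?d 1 0 2 + ?d 1 2 0 + ?d 2 0 1 - ?d 2 1 0) (a 0 1 2)"
    using sol unfolding left a
    by (simp add: d alt_free.scale_right_diff_distrib alt_free.scale_left_diff_distrib alt_free.scale_left_distrib
        alt_free.scale_minus_left alt_free.scale_minus_right algebra_simps)
  also have "\<dots> = 0" using sol by simp
  finally show ?thesis by (simp add: abs_eq_zero_iff)
qed

text \<open>There are no relations below degree 3, so the claim is \<open>f = 0\<close>: the product
  of the probe element and \<open>x\<close> in the two orders is linearly independent.\<close>

theorem probe_detects_low_degree:
  fixes f :: "(nat, 'f::field_char_0) npoly"
  assumes f: "multilinear_in n f" and n: "n < 3" and z: "\<And>k. probe_eval \<epsilon> k f = 0"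
  shows "f = 0"
proof -
  consider "n = 0" | "n = 1" | "n = 2" using n by linarith
  then show ?thesis
  proof cases
    case 1
    then have "Poly_Mapping.keys f = {}" using f letters_nonempty by (fastforce simp: multilinear_in_def)
    then show ?thesis by simp
  next
    case 2
    have "Poly_Mapping.keys f \<subseteq> {Letter 0}"
    proof
      fix w assume "w \<in> Poly_Mapping.keys f"
      then have w: "distinct (letters w)" "set (letters w) = {0}" using f 2 by (auto simp: multilinear_in_def)
      then have "length (letters w) = 1" by (metis card.empty card_insert_disjoint distinct_card empty_iff finite.emptyI One_nat_def)
      then show "w \<in> {Letter 0}" using length_letters_1 w by fastforce
    qed
    from probe_eval_expand[OF _ this, of \<epsilon> 0] z[of 0] have "scale5 (Poly_Mapping.lookup f (Letter 0)) (by_elt \<epsilon>) = 0"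
      by (simp add: koszul_sign_letters probe_def)
    then have "Poly_Mapping.lookup f (Letter 0) = 0"
      by (simp add: by_elt_def zero_prod_def split: if_splits)
    then show ?thesis using \<open>Poly_Mapping.keys f \<subseteq> {Letter 0}\<close>
      by (intro poly_mapping_eqI) (auto simp: in_keys_iff)
  next
    case 3
    then have k: "Poly_Mapping.keys f \<subseteq> words2" using multilinear_words2 f by blast
    have "finite words2" by (simp add: words2_def)
    from probe_eval_expand[OF this k, of \<epsilon> 0] z[of 0]
    have "Poly_Mapping.lookup f (Juxt (Letter 0) (Letter 1)) = 0 \<and> Poly_Mapping.lookup f (Juxt (Letter 1) (Letter 0)) = 0"
      by (cases \<epsilon>)
        (simp_all add: words2_def koszul_sign_letters koszul_factor_def probe_def probe_parity_def by_elt_def bx_def zero_prod_def)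
    then show ?thesis using k
      by (intro poly_mapping_eqI) (auto simp: in_keys_iff words2_def)
  qed
qed

section \<open>The two generating superalgebras\<close>

text \<open>A probe uses only two elements of the model, so it is realized as soon as two suitable
  generators, \<open>y\<close> of parity \<open>\<epsilon>\<close> and an odd \<open>x\<close>, are
  available.\<close>

lemma probe_eval_from_free:
  fixes f :: "(nat, 'f::field_char_0) npoly" and g :: "nat + nat \<Rightarrow> 'f tuple5"
  assumes f: "super_satisfies (free_alt r s :: ('f, _) superalgebra) f"
    and g: "\<And>x. g x \<in> bimod_homog (gen_parity x)"
    and y: "y \<in> Inl ` {..<r} \<union> Inr ` {..<s}" "g y = by_elt \<epsilon>" "gen_parity y = \<epsilon>"
    and x: "x \<in> Inl ` {..<r} \<union> Inr ` {..<s}" "g x = bx" "gen_parity x = 1"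
  shows "probe_eval \<epsilon> k f = 0"
proof -
  let ?h = "\<lambda>i. if i = k then y else x"
  have "eval_superization bimod_algebra (\<lambda>i. gen_parity (?h i)) (\<lambda>i. g (?h i)) f = \<zero>\<^bsub>bimod_algebra\<^esub>"
    by (rule free_alt_universal[OF bimod_in_super_class _ f]) (use g x y in auto)
  moreover have "(\<lambda>i. gen_parity (?h i)) = probe_parity \<epsilon> k" "(\<lambda>i. g (?h i)) = probe \<epsilon> k"
    using x y by (auto simp: probe_parity_def probe_def)
  ultimately show ?thesis by simp
qed

lemma probes_detect:
  fixes f :: "(nat, 'f::field_char_0) npoly"
  assumes f: "multilinear f" and z: "\<And>k. probe_eval \<epsilon> k f = 0"
    and s: "multilinear_in 3 f \<Longrightarrow> (\<Sum>w\<in>words3. Poly_Mapping.lookup f w) = 0"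
  shows "f \<in> alt_ideal"
proof -
  obtain n where n: "multilinear_in n f" using f multilinear_iff by blast
  consider "n < 3" | "n = 3" | "n \<ge> 4" by linarith
  then show ?thesis
  proof cases
    case 1
    then show ?thesis using probe_detects_low_degree[OF n _ z] alt_zero by simp
  next
    case 2
    then show ?thesis using probe_detects_degree_3[OF _ z] n s by blast
  next
    case 3
    then show ?thesis using probe_detects_high_degree[OF n _ z] by blast
  qed
qed

lemma tri_eval_expand:
  fixes f :: "(nat, 'f::field_char_0) npoly"
  assumes "multilinear_in 3 f"
  shows "eval_superization (tri_algebra d) \<pi> \<rho> f = (\<Sum>w\<in>words3.
    scale6 (koszul_sign \<pi> w * Poly_Mapping.lookup f w) (eval_nword (tri_algebra d) \<rho> w))"
  unfolding tri_algebra_def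
  by (rule eval_superization_type_super[OF tri_is_superalgebra[unfolded tri_algebra_def] _ multilinear_words3[OF assms]])
    (simp add: words3_def)

lemma tri_sel [simp]:
  "carrier (tri_algebra d) = UNIV" "monoid.mult (tri_algebra d) = tri_mult"
  "ring.zero (tri_algebra d) = 0" "add (tri_algebra d) = (+)"
  "module.smult (tri_algebra d) = scale6" "homog (tri_algebra d) = tri_homog d"
  by (simp_all add: tri_algebra_def)

lemma sum_scale6_corner: "(\<Sum>w\<in>K. scale6 (c w) (0, 0, 1, 0, 0, 0)) = (0, 0, \<Sum>w\<in>K. c w, 0, 0, 0)"
  by (induction K rule: infinite_finite_induct) (auto simp: zero_prod_def)

text \<open>The even generator serves as the probed element and the odd one as \<open>x\<close>. In
  degree 3 the coefficient sum is obtained from the even generator alone, by substituting one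
  triangular matrix for all variables.\<close>

theorem rank_supervariety_1_1:
  "rank_supervariety alt_metabelian 1 1 = (super_class alt_metabelian :: ('f::field_char_0, 'a) superalgebra set)"
proof (rule rank_supervariety_eqI)
  fix f :: "(nat, 'f) npoly"
  assume f: "multilinear f" and F: "super_satisfies (free_alt 1 1 :: ('f, _) superalgebra) f"
  show "f \<in> alt_ideal"
  proof (rule probes_detect[OF f])
    show "probe_eval 0 k f = 0" for k
    proof (rule probe_eval_from_free[OF F, where g="case_sum (\<lambda>_. by_elt 0) (\<lambda>_. bx)" and y="Inl 0" and x="Inr 0"])
      show "(case x of Inl _ \<Rightarrow> by_elt 0 | Inr _ \<Rightarrow> bx) \<in> bimod_homog (gen_parity x)" for x :: "nat + nat"
        by (cases x) (simp_all add: gen_parity_def bx_homog by_homog)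
    qed (auto simp: gen_parity_def)
    assume f3: "multilinear_in 3 f"
    \<comment> \<open>The sum of the matrix units 12, 23, 34. Every bracketing of three copies is
      the unit 14, so the value of \<open>f\<close> there is its coefficient sum.\<close>
    let ?t = "(1, 0, 0, 1, 0, 1) :: 'f tuple6"
    have "eval_superization (tri_algebra (\<lambda>_. 0)) (\<lambda>i. gen_parity (Inl 0)) (\<lambda>i. case_sum (\<lambda>_. ?t) (\<lambda>_. 0) (Inl 0 :: nat + nat)) f
        = \<zero>\<^bsub>tri_algebra (\<lambda>_. 0) :: ('f, _) superalgebra\<^esub>"
    proof (rule free_alt_universal[OF tri_in_super_class _ F])
      show "(case x of Inl _ \<Rightarrow> ?t | Inr _ \<Rightarrow> 0) \<in> homog (tri_algebra (\<lambda>_. 0)) (gen_parity x)" for x :: "nat + nat"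
        by (cases x) (simp_all add: gen_parity_def tri_homog_def zero_prod_def)
    qed auto
    moreover have "koszul_sign (\<lambda>_. 0) w = (1 :: 'f)" for w
      unfolding koszul_sign_def by simp
    moreover have "eval_nword (tri_algebra (\<lambda>_. 0)) (\<lambda>_. ?t) w = (0, 0, 1, 0, 0, 0)" if "w \<in> words3" for w
      using that by (auto simp: words3_def rword_def lword_def)
    ultimately have "(\<Sum>w\<in>words3. scale6 (Poly_Mapping.lookup f w) (0, 0, 1, 0, 0, 0)) = 0"
      unfolding tri_eval_expand[OF f3] by (simp add: gen_parity_def)
    then show "(\<Sum>w\<in>words3. Poly_Mapping.lookup f w) = 0"
      unfolding sum_scale6_corner by (simp add: zero_prod_def)
  qed
qed simp

text \<open>The alternating grading of the four indices, under which the units 12, 23 and 34 are all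
  odd.\<close>

definition vertex_parity :: "nat \<Rightarrow> bit" where "vertex_parity n = of_nat n"

definition edge :: "nat \<Rightarrow> 'f::field_char_0 tuple6" where
  "edge i = (if i = 0 then (1, 0, 0, 0, 0, 0) else if i = 1 then (0, 0, 0, 1, 0, 0)
     else if i = 2 then (0, 0, 0, 0, 0, 1) else 0)"

lemma edge_products:
  "tri_mult (tri_mult (edge p) (edge q)) (edge r) = (if p = 0 \<and> q = 1 \<and> r = 2 then (0, 0, 1, 0, 0, 0) else 0)"
  "tri_mult (edge p) (tri_mult (edge q) (edge r)) = (if p = 0 \<and> q = 1 \<and> r = 2 then (0, 0, 1, 0, 0, 0) else 0)"
  unfolding edge_def zero_prod_def
  by (cases "p = 0"; cases "p = 1"; cases "p = 2"; simp)+

text \<open>The variables \<open>i\<close>, \<open>j\<close>, \<open>k\<close> are sent to the units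
  12, 23, 34. Only the order \<open>i\<close>, \<open>j\<close>, \<open>k\<close> traces a path from
  1 to 4, so just the two bracketings of that word contribute, and they carry the same Koszul
  sign.\<close>

lemma edge_coefficients:
  fixes f :: "(nat, 'f::field_char_0) npoly"
  assumes f3: "multilinear_in 3 f" and ijk: "(i, j, k) \<in> {(0, 1, 2), (0, 2, 1), (1, 0, 2), (1, 2, 0), (2, 0, 1), (2, 1, 0)}"
    and F: "super_satisfies (free_alt 0 3 :: ('f, _) superalgebra) f"
  shows "Poly_Mapping.lookup f (rword i j k) + Poly_Mapping.lookup f (lword i j k) = 0"
proof -
  define pos :: "nat \<Rightarrow> nat" where "pos n = (if n = i then 0 else if n = j then 1 else 2)" for n
  let ?g = "case_sum (\<lambda>_. 0) edge :: nat + nat \<Rightarrow> 'f tuple6"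
  have "eval_superization (tri_algebra vertex_parity) (\<lambda>n. gen_parity (Inr (pos n))) (\<lambda>n. ?g (Inr (pos n))) f
      = \<zero>\<^bsub>tri_algebra vertex_parity :: ('f, _) superalgebra\<^esub>"
  proof (rule free_alt_universal[OF tri_in_super_class _ F])
    show "?g x \<in> homog (tri_algebra vertex_parity) (gen_parity x)" for x
    proof (cases x)
      case (Inr n)
      then show ?thesis
        by (simp add: gen_parity_def tri_homog_def zero_prod_def edge_def vertex_parity_def of_nat_bit)
    qed (simp add: gen_parity_def tri_homog_def zero_prod_def)
  qed (auto simp: pos_def)
  then have z: "(\<Sum>w\<in>words3. scale6 (koszul_sign (\<lambda>_. 1) w * Poly_Mapping.lookup f w)
      (eval_nword (tri_algebra vertex_parity) (\<lambda>n. edge (pos n)) w)) = 0"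
    unfolding tri_eval_expand[OF f3] by (simp add: gen_parity_def)
  let ?R = "rword i j k" and ?L = "lword i j k"
  let ?c = "\<lambda>w. koszul_sign (\<lambda>_. 1) w * Poly_Mapping.lookup f w"
  have ev: "eval_nword (tri_algebra vertex_parity) (\<lambda>n. edge (pos n)) w =
      (if w = ?R \<or> w = ?L then (0, 0, 1, 0, 0, 0) else 0 :: 'f tuple6)" if "w \<in> words3" for w
  proof -
    have "\<exists>p\<in>{(0, 1, 2), (0, 2, 1), (1, 0, 2), (1, 2, 0), (2, 0, 1), (2, 1, 0)}.
        w = rword (fst p) (fst (snd p)) (snd (snd p)) \<or> w = lword (fst p) (fst (snd p)) (snd (snd p))"
      using that unfolding words3_def by auto
    then obtain a b c where abc: "w = rword a b c \<or> w = lword a b c"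
      "(a, b, c) \<in> {(0, 1, 2), (0, 2, 1), (1, 0, 2), (1, 2, 0), (2, 0, 1), (2, 1, 0)}"
      by (metis prod.collapse)
    have "pos a = 0 \<and> pos b = 1 \<and> pos c = 2 \<longleftrightarrow> a = i \<and> b = j \<and> c = k"
      using abc(2) ijk unfolding insert_iff empty_iff prod.inject
      by (elim disjE FalseE conjE; hypsubst; simp add: pos_def)
    then show ?thesis using abc(1)
      by (elim disjE) (simp_all add: rword_def lword_def edge_products)
  qed
  have "scale6 (?c w) (eval_nword (tri_algebra vertex_parity) (\<lambda>n. edge (pos n)) w) =
      scale6 (if w \<in> {?R, ?L} then ?c w else 0) (0, 0, 1, 0, 0, 0)" if "w \<in> words3" for w
    unfolding ev[OF that] by (simp add: zero_prod_def)
  then have "(\<Sum>w\<in>words3. scale6 (if w \<in> {?R, ?L} then ?c w else 0) (0, 0, 1, 0, 0, 0)) = 0"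
    using z by simp
  then have "(\<Sum>w\<in>words3. if w \<in> {?R, ?L} then ?c w else 0) = 0"
    unfolding sum_scale6_corner by (simp add: zero_prod_def)
  moreover have "finite words3" by (simp add: words3_def)
  moreover have "words3 \<inter> {?R, ?L} = {?R, ?L}"
    using ijk unfolding words3_def by (simp only: insert_iff empty_iff prod.inject) (elim disjE FalseE conjE; hypsubst; blast)
  ultimately have "(\<Sum>w\<in>{?R, ?L}. ?c w) = 0" by (simp only: sum.inter_restrict[symmetric])
  moreover have "?R \<noteq> ?L" by (simp add: rword_def lword_def)
  moreover have "koszul_sign (\<lambda>_. 1) ?L = (koszul_sign (\<lambda>_. 1) ?R :: 'f)"
    by (simp add: koszul_sign_letters rword_def lword_def)
  ultimately have "koszul_sign (\<lambda>_. 1) ?R * (Poly_Mapping.lookup f ?R + Poly_Mapping.lookup f ?L) = 0"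
    by (simp add: distrib_left)
  then show ?thesis by simp
qed

text \<open>Two odd generators suffice for the odd probes. The third enters only in degree 3, where
  all three are sent to consecutive matrix units to obtain the coefficient sum.\<close>

theorem rank_supervariety_0_3:
  "rank_supervariety alt_metabelian 0 3 = (super_class alt_metabelian :: ('f::field_char_0, 'a) superalgebra set)"
proof (rule rank_supervariety_eqI)
  fix f :: "(nat, 'f) npoly"
  assume f: "multilinear f" and F: "super_satisfies (free_alt 0 3 :: ('f, _) superalgebra) f"
  show "f \<in> alt_ideal"
  proof (rule probes_detect[OF f])
    show "probe_eval 1 k f = 0" for k
    proof (rule probe_eval_from_free[OF F, where g="case_sum (\<lambda>_. 0) (\<lambda>j. if j = 1 then by_elt 1 else bx)"
          and y="Inr 1" and x="Inr 0"])
      show "(case x of Inl _ \<Rightarrow> 0 | Inr j \<Rightarrow> if j = 1 then by_elt 1 else bx) \<in> bimod_homog (gen_parity x)" for x :: "nat + nat"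
        by (cases x) (simp_all add: gen_parity_def bx_homog by_homog, simp add: bimod_homog_def zero_prod_def)
    qed (auto simp: gen_parity_def)
    assume f3: "multilinear_in 3 f"
    note c = edge_coefficients[OF f3 _ F]
    have inj: "rword i j k = rword i' j' k' \<longleftrightarrow> i = i' \<and> j = j' \<and> k = k'"
      "lword i j k = lword i' j' k' \<longleftrightarrow> i = i' \<and> j = j' \<and> k = k'"
      "rword i j k \<noteq> lword i' j' k'" "lword i j k \<noteq> rword i' j' k'" for i j k i' j' k'
      by (auto simp: rword_def lword_def)
    let ?S = "\<lambda>i j k. Poly_Mapping.lookup f (rword i j k) + Poly_Mapping.lookup f (lword i j k)"
    have "(\<Sum>w\<in>words3. Poly_Mapping.lookup f w) = ?S 0 1 2 + ?S 0 2 1 + ?S 1 0 2 + ?S 1 2 0 + ?S 2 0 1 + ?S 2 1 0"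
      by (simp add: words3_def inj add_ac)
    also have "\<dots> = 0" by (simp only: c insert_iff simp_thms add_0)
    finally show "(\<Sum>w\<in>words3. Poly_Mapping.lookup f w) = 0" .
  qed
qed simp

section \<open>Transport of models\<close>

text \<open>The models live on tuples of scalars, while the classes being compared live on the type
  \<open>'a\<close>; a copy along an injection satisfies the same superidentities.\<close>

definition transport :: "('v \<Rightarrow> 'a) \<Rightarrow> ('f, 'v) superalgebra \<Rightarrow> ('f, 'a) superalgebra" where
  "transport J A = \<lparr>carrier = J ` carrier A, monoid.mult = (\<lambda>x y. J (the_inv J x \<otimes>\<^bsub>A\<^esub> the_inv J y)),
     monoid.one = J \<zero>\<^bsub>A\<^esub>, ring.zero = J \<zero>\<^bsub>A\<^esub>, add = (\<lambda>x y. J (the_inv J x \<oplus>\<^bsub>A\<^esub> the_inv J y)),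
     module.smult = (\<lambda>c x. J (c \<odot>\<^bsub>A\<^esub> the_inv J x)), homog = (\<lambda>i. J ` homog A i)\<rparr>"

lemma transport_sel [simp]:
  "carrier (transport J A) = J ` carrier A" "ring.zero (transport J A) = J \<zero>\<^bsub>A\<^esub>"
  "homog (transport J A) i = J ` homog A i"
  by (simp_all add: transport_def)

lemma transport_hom: "inj J \<Longrightarrow> alg_hom A (transport J A) J"
  by (simp add: alg_hom_def transport_def the_inv_f_f)

lemma transport_is_superalgebra:
  fixes A :: "('f::field, 'v) superalgebra"
  assumes "inj J" "is_superalgebra A" shows "is_superalgebra (transport J A)"
proof (rule is_superalgebra_image[OF assms(2) transport_hom[OF assms(1)]])
  have "homog A 0 \<inter> homog A 1 = {\<zero>\<^bsub>A\<^esub>}"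
    using assms(2) by (simp add: is_superalgebra_def is_superalgebra_axioms_def)
  then show "homog (transport J A) 0 \<inter> homog (transport J A) 1 \<subseteq> {\<zero>\<^bsub>transport J A\<^esub>}"
    using assms(1) by (simp flip: image_Int)
qed simp_all

lemma transport_satisfies_iff:
  fixes A :: "('f::field, 'v) superalgebra"
  assumes J: "inj J" and A: "is_superalgebra A"
  shows "super_satisfies (transport J A) f \<longleftrightarrow> super_satisfies A f"
proof -
  have ev: "J (eval_superization A \<pi> \<rho> f) = eval_superization (transport J A) \<pi> (\<lambda>x. J (\<rho> x)) f"
    if "\<And>x. \<rho> x \<in> homog A (\<pi> x)" for \<pi> \<rho>
    by (rule alg_hom_eval_superization[OF transport_hom[OF J] A transport_is_superalgebra[OF J A] that])
  show ?thesis
  proof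
    assume T: "super_satisfies (transport J A) f"
    show "super_satisfies A f" unfolding super_satisfies_def
    proof (intro allI impI)
      fix \<pi> :: "nat \<Rightarrow> bit" and \<rho> assume \<rho>: "\<forall>x. \<rho> x \<in> homog A (\<pi> x)"
      have "eval_superization (transport J A) \<pi> (\<lambda>x. J (\<rho> x)) f = \<zero>\<^bsub>transport J A\<^esub>"
        by (rule T[unfolded super_satisfies_def, rule_format]) (use \<rho> in simp)
      then show "eval_superization A \<pi> \<rho> f = \<zero>\<^bsub>A\<^esub>" using ev[of \<rho> \<pi>] \<rho> J by (simp add: inj_eq)
    qed
  next
    assume S: "super_satisfies A f"
    show "super_satisfies (transport J A) f" unfolding super_satisfies_def
    proof (intro allI impI)
      fix \<pi> :: "nat \<Rightarrow> bit" and \<rho> assume \<rho>: "\<forall>x. \<rho> x \<in> homog (transport J A) (\<pi> x)"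
      then have "\<exists>a. a \<in> homog A (\<pi> x) \<and> \<rho> x = J a" for x by auto
      then obtain \<rho>' where r: "\<And>x. \<rho>' x \<in> homog A (\<pi> x)" "\<rho> = (\<lambda>x. J (\<rho>' x))" by metis
      have "eval_superization A \<pi> \<rho>' f = \<zero>\<^bsub>A\<^esub>"
        by (rule S[unfolded super_satisfies_def, rule_format]) (rule r(1))
      then show "eval_superization (transport J A) \<pi> \<rho> f = \<zero>\<^bsub>transport J A\<^esub>"
        using ev[of \<rho>' \<pi>] r by simp
    qed
  qed
qed

lemma transport_in_super_class:
  fixes A :: "('f::field_char_0, 'v) superalgebra"
  assumes J: "inj J" and A: "A \<in> super_class alt_metabelian"
  shows "transport J A \<in> super_class alt_metabelian"
proof -
  have "is_superalgebra A" using A by (simp add: super_class_def)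
  then show ?thesis
    using A transport_is_superalgebra[OF J] transport_satisfies_iff[OF J]
    unfolding super_class_alt_metabelian_iff by blast
qed

lemma rank_supervariety_neqI:
  fixes A :: "('f::field_char_0, 'v) superalgebra" and J :: "'v \<Rightarrow> 'a"
  assumes "(r, s) \<noteq> (0, 0)" and J: "inj J" and A: "A \<in> super_class alt_metabelian"
    and f: "multilinear f" "super_satisfies (free_alt r s :: ('f, _) superalgebra) f" "\<not> super_satisfies A f"
  shows "rank_supervariety alt_metabelian r s \<noteq> (super_class alt_metabelian :: ('f, 'a) superalgebra set)"
proof -
  have sA: "is_superalgebra A" using A by (simp add: super_class_def)
  have "\<not> super_satisfies (transport J A) f" using f(3) transport_satisfies_iff[OF J sA] by simp
  then have "transport J A \<notin> rank_supervariety alt_metabelian r s"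
    using assms(1) f(1,2) by (auto simp: rank_supervariety_def supervariety_generated_by_def)
  then show ?thesis using transport_in_super_class[OF J A] by blast
qed

text \<open>A field of characteristic 0 is infinite, hence in bijection with its square, and tuples
  can be encoded by nested pairing.\<close>

lemma tuple_injections:
  fixes \<iota> :: "'f::field_char_0 \<Rightarrow> 'a"
  assumes "inj \<iota>"
  obtains J5 :: "'f tuple5 \<Rightarrow> 'a" and J6 :: "'f tuple6 \<Rightarrow> 'a" where "inj J5" "inj J6"
proof -
  obtain p :: "'f \<times> 'f \<Rightarrow> 'f" where "bij_betw p (UNIV \<times> UNIV) UNIV"
    using card_of_ordIso[THEN iffD2, OF card_of_Times_same_infinite[OF infinite_UNIV_char_0[where 'a='f]]] by blast
  then have p: "p x = p y \<longleftrightarrow> x = y" for x y by (simp add: bij_betw_def inj_eq)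
  have "inj (\<lambda>(a, b, c, d, e). \<iota> (p (a, p (b, p (c, p (d, e))))))"
    using assms p by (auto intro!: injI dest!: injD)
  moreover have "inj (\<lambda>(a, b, c, d, e, f). \<iota> (p (a, p (b, p (c, p (d, p (e, f)))))))"
    using assms p by (auto intro!: injI dest!: injD)
  ultimately show ?thesis by (rule that)
qed

section \<open>Identities of free superalgebras on too few generators\<close>

context
  fixes r s :: nat
begin

interpretation F: is_superalgebra "free_superalgebra r s :: ('f::field_char_0, _) superalgebra"
  by (rule is_superalgebra_free)

interpretation I: graded_ideal "free_alt_ideal r s" "free_superalgebra r s :: ('f::field_char_0, _) superalgebra"
  by (rule free_alt_ideal_graded)

lemma free_alt_ideal_closed:
  fixes x y :: "(nat + nat, 'f::field_char_0) npoly"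
  assumes "x \<in> free_alt_ideal r s"
  shows "y \<in> free_alt_ideal r s \<Longrightarrow> x + y \<in> free_alt_ideal r s" "nscale c x \<in> free_alt_ideal r s"
    "- x \<in> free_alt_ideal r s" "y \<in> free_carrier r s \<Longrightarrow> x \<star> y \<in> free_alt_ideal r s"
    "y \<in> free_carrier r s \<Longrightarrow> y \<star> x \<in> free_alt_ideal r s"
proof -
  show sc: "nscale c x \<in> free_alt_ideal r s" for c using I.ideal_scale[OF assms] by simp
  show "- x \<in> free_alt_ideal r s" using sc[of "-1"] by (simp add: nscale_minus_one)
  show "y \<in> free_alt_ideal r s \<Longrightarrow> x + y \<in> free_alt_ideal r s" using I.ideal_add[OF assms] by simp
  show "y \<in> free_carrier r s \<Longrightarrow> x \<star> y \<in> free_alt_ideal r s" using I.ideal_mult_right[OF _ assms] by simp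
  show "y \<in> free_carrier r s \<Longrightarrow> y \<star> x \<in> free_alt_ideal r s" using I.ideal_mult_left[OF _ assms] by simp
qed

lemma free_alt_ideal_zero: "0 \<in> (free_alt_ideal r s :: (nat + nat, 'f::field_char_0) npoly set)"
  using I.I.zero_closed by simp

lemma free_alt_ideal_eval:
  fixes f :: "(nat, 'f::field_char_0) npoly"
  assumes "f \<in> alt_ideal" "multilinear f" "\<And>x. \<rho> x \<in> homog (free_superalgebra r s :: ('f, _) superalgebra) (\<pi> x)"
  shows "eval_npoly (free_superalgebra r s) \<rho> (sign_twist \<pi> f) \<in> free_alt_ideal r s"
proof -
  have "super_satisfies (free_alt r s :: ('f, _) superalgebra) f"
    by (rule super_class_alt_ideal[OF free_alt_in_super_class assms(1,2)])
  then show ?thesis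
    using assms(3) unfolding free_alt_quotient super_quotient_satisfies_iff[OF free_alt_ideal_graded] eval_superization_eq
    by blast
qed

lemma free_alt_satisfiesI:
  fixes f :: "(nat, 'f::field_char_0) npoly"
  assumes "\<And>\<pi> \<rho>. (\<And>x. \<rho> x \<in> homog (free_superalgebra r s :: ('f, _) superalgebra) (\<pi> x)) \<Longrightarrow>
    eval_npoly (free_superalgebra r s) \<rho> (sign_twist \<pi> f) \<in> free_alt_ideal r s"
  shows "super_satisfies (free_alt r s :: ('f, _) superalgebra) f"
  using assms unfolding free_alt_quotient super_quotient_satisfies_iff[OF free_alt_ideal_graded] eval_superization_eq
  by blast

lemma free_homog_induct [consumes 1, case_names zero add scale word]:
  fixes p :: "(nat + nat, 'f::field_char_0) npoly"
  assumes "p \<in> homog (free_superalgebra r s :: ('f, _) superalgebra) i" and "Q 0"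
    and "\<And>x y. Q x \<Longrightarrow> Q y \<Longrightarrow> Q (x + y)" and "\<And>c x. Q x \<Longrightarrow> Q (nscale c x)"
    and "\<And>w. Poly_Mapping.single w 1 \<in> homog (free_superalgebra r s :: ('f, _) superalgebra) i \<Longrightarrow> Q (Poly_Mapping.single w 1)"
  shows "Q p"
proof -
  have "Q (\<Sum>w\<in>K. Poly_Mapping.single w (c w))"
    if "finite K" "\<And>w. w \<in> K \<Longrightarrow> Poly_Mapping.single w 1 \<in> homog (free_superalgebra r s :: ('f, _) superalgebra) i" for K c
    using that
  proof (induction K)
    case (insert w K)
    have "Q (nscale (c w) (Poly_Mapping.single w 1))" by (intro assms(4,5)) (use insert in auto)
    then show ?case using insert assms(3) by simp
  qed (simp add: assms(2))
  moreover have "Poly_Mapping.single w 1 \<in> homog (free_superalgebra r s :: ('f, _) superalgebra) i" if "w \<in> Poly_Mapping.keys p" for w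
    using assms(1) that by (auto simp: homog_free_superalgebra free_carrier_def)
  ultimately show ?thesis by (subst npoly_expand) simp
qed

end

lemma single_word_carrier:
  "Poly_Mapping.single w (1 :: 'f::field_char_0) \<in> free_carrier r s \<longleftrightarrow> set (letters w) \<subseteq> Inl ` {..<r} \<union> Inr ` {..<s}"
  by (simp add: free_carrier_def)

section \<open>Even generators only: nilpotency of right multiplications\<close>

lemma homog_even_generators:
  "homog (free_superalgebra r 0 :: ('f::field_char_0, _) superalgebra) 0 = free_carrier r 0"
  "homog (free_superalgebra r 0 :: ('f, _) superalgebra) 1 = {0}"
proof -
  have "nword_parity w = 0" if "set (letters w) \<subseteq> Inl ` {..<r}" for w
    using that by (induction w) (auto simp: gen_parity_def)
  then have par: "\<forall>w\<in>Poly_Mapping.keys p. nword_parity w = 0" if "p \<in> free_carrier r 0" for p :: "(nat + nat, 'f) npoly"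
    using that unfolding free_carrier_def by simp
  then show "homog (free_superalgebra r 0 :: ('f, _) superalgebra) 0 = free_carrier r 0"
    unfolding homog_free_superalgebra by blast
  have "p = 0" if "p \<in> free_carrier r 0" "\<forall>w\<in>Poly_Mapping.keys p. nword_parity w = 1" for p :: "(nat + nat, 'f) npoly"
  proof -
    have "Poly_Mapping.keys p = {}" using par[OF that(1)] that(2) by force
    then show ?thesis by simp
  qed
  moreover have "0 \<in> (free_carrier r 0 :: (nat + nat, 'f) npoly set)" by (simp add: free_carrier_def)
  ultimately show "homog (free_superalgebra r 0 :: ('f, _) superalgebra) 1 = {0}"
    unfolding homog_free_superalgebra by auto
qed

lemma homog_even_subset:
  "homog (free_superalgebra r 0 :: ('f::field_char_0, _) superalgebra) i \<subseteq> free_carrier r 0"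
  by (auto simp: homog_free_superalgebra)

definition rprod :: "(nat + nat, 'f::field_char_0) npoly \<Rightarrow> (nat + nat, 'f) npoly list \<Rightarrow> (nat + nat, 'f) npoly" where
  "rprod a xs = foldl (\<star>) a xs"

lemma rprod_simps [simp]:
  "rprod a [] = a" "rprod a (x # xs) = rprod (a \<star> x) xs" "rprod a (xs @ ys) = rprod (rprod a xs) ys"
  by (simp_all add: rprod_def)

lemma rprod_linear:
  "rprod (a + b) xs = rprod a xs + rprod b xs" "rprod (nscale c a) xs = nscale c (rprod a xs)" "rprod 0 xs = 0"
  by (induction xs arbitrary: a b) (simp_all add: npoly_mult_add_left npoly_mult_scale_left)

context
  fixes r :: nat
begin

abbreviation (input) FC :: "(nat + nat, 'f::field_char_0) npoly set" where "FC \<equiv> free_carrier r 0"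
abbreviation (input) FI :: "(nat + nat, 'f::field_char_0) npoly set" where "FI \<equiv> free_alt_ideal r 0"

lemma rprod_ideal: "a \<in> FI \<Longrightarrow> set xs \<subseteq> FC \<Longrightarrow> rprod a xs \<in> FI"
  by (induction xs arbitrary: a) (auto intro: free_alt_ideal_closed)

lemma even_identities:
  fixes a b c d :: "(nat + nat, 'f::field_char_0) npoly"
  assumes "a \<in> FC" "b \<in> FC" "c \<in> FC" "d \<in> FC"
  shows "(a \<star> b) \<star> (c \<star> d) \<in> FI"
    and "(a \<star> b) \<star> c - a \<star> (b \<star> c) + ((a \<star> c) \<star> b - a \<star> (c \<star> b)) \<in> FI"
proof -
  interpret F: is_superalgebra "free_superalgebra r 0 :: ('f, _) superalgebra" by (rule is_superalgebra_free)
  define \<rho> where "\<rho> i = (if i = 0 then a else if i = 1 then b else if i = 2 then c else d)" for i :: nat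
  define \<pi> where "\<pi> i = (0 :: bit)" for i :: nat
  have \<rho>: "\<rho> 0 = a" "\<rho> 1 = b" "\<rho> (Suc 0) = b" "\<rho> 2 = c" "\<rho> 3 = d" "\<pi> i = 0" for i
    by (simp_all add: \<rho>_def \<pi>_def)
  have h: "\<rho> i \<in> homog (free_superalgebra r 0 :: ('f, _) superalgebra) (\<pi> i)" for i
    using assms by (simp add: \<rho>_def \<pi>_def homog_even_generators)
  have ml: "multilinear (metab :: (nat, 'f) npoly)" "multilinear (lin_alt_right :: (nat, 'f) npoly)"
    using multilinear_linearizations multilinear_iff by blast+
  have minus: "\<ominus>\<^bsub>free_superalgebra r 0\<^esub> x = - x" if "x \<in> FC" for x :: "(nat + nat, 'f) npoly"
    using F.scale_minus_one[of x] that by (simp add: nscale_minus_one)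
  show "(a \<star> b) \<star> (c \<star> d) \<in> FI"
    using free_alt_ideal_eval[where \<rho> = \<rho> and \<pi> = \<pi>, OF linearizations_in_alt_ideal(3) ml(1) h]
      F.eval_superization_lin(3)[where \<rho> = \<rho> and \<pi> = \<pi>, OF h] by (simp add: eval_superization_eq \<rho>)
  show "(a \<star> b) \<star> c - a \<star> (b \<star> c) + ((a \<star> c) \<star> b - a \<star> (c \<star> b)) \<in> FI"
    using free_alt_ideal_eval[where \<rho> = \<rho> and \<pi> = \<pi>, OF linearizations_in_alt_ideal(2) ml(2) h]
      F.eval_superization_lin(2)[where \<rho> = \<rho> and \<pi> = \<pi>, OF h] assms
    by (simp add: eval_superization_eq \<rho> F.assoc_def a_minus_def minus free_carrier_mult)
qed

text \<open>The anticommutation \<open>RR_skew\<close>, carried out modulo the ideal of the free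
  superalgebra: right alternativity corrected by two instances of metabelianity.\<close>

lemma even_skew:
  fixes p q x b :: "(nat + nat, 'f::field_char_0) npoly"
  assumes "p \<in> FC" "q \<in> FC" "x \<in> FC" "b \<in> FC"
  shows "((p \<star> q) \<star> x) \<star> b + ((p \<star> q) \<star> b) \<star> x \<in> FI"
proof -
  have pq: "p \<star> q \<in> FC" using assms by (simp add: free_carrier_mult)
  note free_alt_ideal_closed(1)[OF free_alt_ideal_closed(1)[OF even_identities(2)[OF pq assms(3,4) pq]
      even_identities(1)[OF assms]] even_identities(1)[OF assms(1,2,4,3)]]
  then show ?thesis by (simp add: algebra_simps)
qed

text \<open>Skewness moves the first \<open>x\<close> through the intermediate factors until it
  meets the second one. There the skew relation says that twice the element is in the ideal, and 2
  is invertible.\<close>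

lemma rprod_repeated:
  fixes w x :: "(nat + nat, 'f::field_char_0) npoly"
  assumes "p \<in> FC" "q \<in> FC" "x \<in> FC" "set bs \<subseteq> FC"
  shows "rprod (p \<star> q) (x # bs @ [x]) \<in> FI"
  using assms(1,2,4)
proof (induction bs arbitrary: p q)
  case Nil
  have "nscale (1/2) (((p \<star> q) \<star> x) \<star> x + ((p \<star> q) \<star> x) \<star> x) = ((p \<star> q) \<star> x) \<star> x"
    by (rule poly_mapping_eqI) (simp add: lookup_add)
  then show ?case using free_alt_ideal_closed(2)[OF even_skew[OF Nil(1,2) assms(3,3)], of "1/2"] by simp
next
  case (Cons b bs)
  have b: "b \<in> FC" "set bs \<subseteq> FC" using Cons.prems by auto
  have "((p \<star> q) \<star> x) \<star> b + ((p \<star> q) \<star> b) \<star> x \<in> FI"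
    by (rule even_skew[OF Cons.prems(1,2) assms(3) b(1)])
  then have "rprod (((p \<star> q) \<star> x) \<star> b + ((p \<star> q) \<star> b) \<star> x) (bs @ [x]) \<in> FI"
    by (rule rprod_ideal) (use b assms(3) in auto)
  moreover have "- rprod ((p \<star> q) \<star> b) (x # bs @ [x]) \<in> FI"
    using Cons.prems b by (intro free_alt_ideal_closed(3) Cons.IH free_carrier_mult) auto
  ultimately have "rprod (((p \<star> q) \<star> x) \<star> b + ((p \<star> q) \<star> b) \<star> x) (bs @ [x]) + - rprod ((p \<star> q) \<star> b) (x # bs @ [x]) \<in> FI"
    by (rule free_alt_ideal_closed(1))
  then show ?case by (simp add: rprod_linear npoly_mult_add_left)
qed

lemma rprod_product:
  fixes p q :: "(nat + nat, 'f::field_char_0) npoly"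
  assumes "p \<in> FC" "q \<in> FC" "set xs \<subseteq> FC"
  obtains p' q' where "p' \<in> FC" "q' \<in> FC" "rprod (p \<star> q) xs = p' \<star> q'"
  using assms
proof (induction xs arbitrary: p q thesis)
  case (Cons x xs)
  show ?case by (rule Cons.IH[of "p \<star> q" x]) (use Cons.prems in \<open>auto intro: free_carrier_mult\<close>)
qed auto

text \<open>If some factor is a product, metabelianity kills the whole expression. Otherwise more
  than \<open>r\<close> factors are chosen among \<open>r\<close> generators, so one of them
  repeats.\<close>

lemma rprod_words:
  fixes ys :: "(nat + nat, 'f::field_char_0) npoly list"
  assumes pq: "p \<in> FC" "q \<in> FC" and ys: "set ys \<subseteq> {Poly_Mapping.single w 1 |w. set (letters w) \<subseteq> Inl ` {..<r}}"
    and len: "length ys > r"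
  shows "rprod (p \<star> q) ys \<in> FI"
proof -
  have car: "set ys \<subseteq> FC" using ys by (auto simp: single_word_carrier)
  show ?thesis
  proof (cases "\<exists>u v. Poly_Mapping.single (Juxt u v) 1 \<in> set ys")
    case True
    then obtain u v where uv: "Poly_Mapping.single (Juxt u v) 1 \<in> set ys" by blast
    then obtain as bs where s: "ys = as @ Poly_Mapping.single (Juxt u v) 1 # bs" by (meson split_list)
    have "Poly_Mapping.single (Juxt u v) (1::'f) \<in> FC" using uv car by blast
    then have uvc: "Poly_Mapping.single u (1::'f) \<in> FC" "Poly_Mapping.single v (1::'f) \<in> FC"
      by (simp_all add: single_word_carrier)
    obtain p' q' where "p' \<in> FC" "q' \<in> FC" "rprod (p \<star> q) as = p' \<star> q'"
      using rprod_product[OF pq, of as] car s by auto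
    moreover have "Poly_Mapping.single (Juxt u v) (1::'f) = Poly_Mapping.single u 1 \<star> Poly_Mapping.single v 1"
      by (simp add: npoly_mult_single)
    ultimately have "rprod (p \<star> q) (as @ [Poly_Mapping.single (Juxt u v) 1]) \<in> FI"
      using uvc by (simp add: even_identities(1))
    then have "rprod (rprod (p \<star> q) (as @ [Poly_Mapping.single (Juxt u v) 1])) bs \<in> FI"
      by (rule rprod_ideal) (use car s in auto)
    then show ?thesis using s by simp
  next
    case False
    have "set ys \<subseteq> (\<lambda>i. Poly_Mapping.single (Letter (Inl i)) 1) ` {..<r}"
    proof
      fix y assume y: "y \<in> set ys"
      then obtain w where w: "y = Poly_Mapping.single w 1" "set (letters w) \<subseteq> Inl ` {..<r}" using ys by auto
      then show "y \<in> (\<lambda>i. Poly_Mapping.single (Letter (Inl i)) 1) ` {..<r}" using False y by (cases w) auto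
    qed
    then have "card (set ys) \<le> r" by (metis card_image_le card_lessThan card_mono finite_imageI finite_lessThan le_trans)
    then have "\<not> distinct ys" using len by (metis distinct_card not_le)
    then obtain xs zs us y where s: "ys = xs @ [y] @ zs @ [y] @ us" using not_distinct_decomp by blast
    obtain p' q' where "p' \<in> FC" "q' \<in> FC" "rprod (p \<star> q) xs = p' \<star> q'"
      using rprod_product[OF pq, of xs] car s by auto
    moreover from this have "rprod (p' \<star> q') (y # zs @ [y]) \<in> FI"
      by (intro rprod_repeated) (use car s in auto)
    then have "rprod (rprod (p' \<star> q') (y # zs @ [y])) us \<in> FI" by (rule rprod_ideal) (use car s in auto)
    ultimately show ?thesis using s by simp
  qed
qed

lemma rprod_nilpotent:
  fixes xs :: "(nat + nat, 'f::field_char_0) npoly list"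
  assumes pq: "p \<in> FC" "q \<in> FC" and xs: "set xs \<subseteq> FC" and len: "length xs > r"
  shows "rprod (p \<star> q) xs \<in> FI"
proof -
  let ?W = "{Poly_Mapping.single w 1 |w. set (letters w) \<subseteq> Inl ` {..<r}} :: (nat + nat, 'f) npoly set"
  \<comment> \<open>The list \<open>ys\<close> holds the factors already reduced to single words and
    \<open>xs\<close> those still arbitrary; linearity moves one factor at a time from
    \<open>xs\<close> to \<open>ys\<close>.\<close>
  have "rprod (p \<star> q) (ys @ xs) \<in> FI" if "set ys \<subseteq> ?W" "set xs \<subseteq> FC" "length (ys @ xs) > r" for ys xs
    using that
  proof (induction xs arbitrary: ys)
    case Nil
    then show ?case using rprod_words[OF pq] by simp
  next
    case (Cons x xs)
    have "x \<in> homog (free_superalgebra r 0 :: ('f, _) superalgebra) 0"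
      using Cons.prems by (simp add: homog_even_generators)
    then have "rprod (rprod (p \<star> q) ys \<star> x) xs \<in> FI"
    proof (induction x rule: free_homog_induct)
      case (word w)
      then have "set (letters w) \<subseteq> Inl ` {..<r}"
        by (simp add: homog_even_generators single_word_carrier)
      then have "rprod (p \<star> q) ((ys @ [Poly_Mapping.single w 1]) @ xs) \<in> FI"
        using Cons.prems by (intro Cons.IH) auto
      then show ?case by simp
    qed (simp_all add: npoly_mult_add_right npoly_mult_scale_right rprod_linear free_alt_ideal_zero free_alt_ideal_closed)
    then show ?case by simp
  qed
  from this[of "[]" xs] show ?thesis using assms by simp
qed

text \<open>There are \<open>r + 3\<close> variables: two form the initial product and the other
  \<open>r + 1\<close> exceed the number of generators by one.\<close>

definition left_normed :: "(nat, 'f::field_char_0) npoly" where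
  "left_normed = Poly_Mapping.single (app_word (Letter 0) [1..<r + 3]) 1"

lemma multilinear_left_normed: "multilinear (left_normed :: (nat, 'f::field_char_0) npoly)"
  unfolding multilinear_iff left_normed_def
  by (rule exI[of _ "r + 3"], rule multilinear_in_single) (auto simp: letters_app_word)

lemma free_alt_satisfies_left_normed:
  "super_satisfies (free_alt r 0 :: ('f::field_char_0, _) superalgebra) left_normed"
proof (rule free_alt_satisfiesI)
  fix \<pi> :: "nat \<Rightarrow> bit" and \<rho> :: "nat \<Rightarrow> (nat + nat, 'f) npoly"
  assume \<rho>: "\<And>x. \<rho> x \<in> homog (free_superalgebra r 0 :: ('f, _) superalgebra) (\<pi> x)"
  interpret F: is_superalgebra "free_superalgebra r 0 :: ('f, _) superalgebra" by (rule is_superalgebra_free)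
  have c: "\<rho> x \<in> FC" for x using \<rho> homog_even_subset by blast
  have ev: "eval_nword (free_superalgebra r 0) \<rho> (app_word w zs) = rprod (eval_nword (free_superalgebra r 0) \<rho> w) (map \<rho> zs)" for w zs
    unfolding app_word_def by (induction zs arbitrary: w) auto
  have "[1..<r + 3] = 1 # [2..<r + 3]" by (simp add: upt_conv_Cons numeral_2_eq_2)
  then have "eval_nword (free_superalgebra r 0) \<rho> (app_word (Letter 0) [1..<r + 3]) =
      rprod (\<rho> 0 \<star> \<rho> 1) (map \<rho> [2..<r + 3])"
    unfolding ev by simp
  also have "\<dots> \<in> FI" by (rule rprod_nilpotent) (use c in auto)
  finally have "nscale c (eval_nword (free_superalgebra r 0) \<rho> (app_word (Letter 0) [1..<r + 3])) \<in> FI" for c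
    by (rule free_alt_ideal_closed)
  then show "eval_npoly (free_superalgebra r 0) \<rho> (sign_twist \<pi> left_normed) \<in> FI"
    using c by (simp add: left_normed_def F.eval_npoly_single image_subset_iff)
qed

text \<open>Right multiplication by \<open>x\<close> is injective on the bimodule, so starting from
  a bimodule element no number of such factors reaches zero.\<close>

lemma bimod_not_left_normed: "\<not> super_satisfies bimod_algebra (left_normed :: (nat, 'f::field_char_0) npoly)"
proof
  assume "super_satisfies bimod_algebra (left_normed :: (nat, 'f) npoly)"
  then have "probe_eval 0 0 (left_normed :: (nat, 'f) npoly) = \<zero>\<^bsub>bimod_algebra\<^esub>"
    by (rule super_satisfies_def[THEN iffD1, rule_format]) (simp add: probe_homog)
  then have "scale5 (koszul_sign (probe_parity 0 0) (app_word (Letter 0) [1..<r + 3]))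
      ((rx ^^ length [1..<r + 3]) (by_elt 0)) = (0 :: 'f tuple5)"
    unfolding left_normed_def probe_eval_single
    by (subst (asm) eval_app_word) (auto simp: probe_def)
  moreover have "scale5 c v = 0 \<Longrightarrow> c \<noteq> 0 \<Longrightarrow> v = 0" for c :: 'f and v
    by (cases v) (simp add: zero_prod_def)
  ultimately have "(rx ^^ length [1..<r + 3]) (by_elt 0) = (0 :: 'f tuple5)"
    using koszul_sign_nonzero by blast
  then have "(1 :: 'f, 0 :: 'f, 0 :: 'f, 0 :: 'f) = 0"
    by (intro rx_funpow_injective) (simp only: by_elt_def refl if_True)
  then show False by (simp add: zero_prod_def)
qed

end

section \<open>At most two odd generators: the symmetrized cube\<close>

definition cube :: "(nat, 'f::field_char_0) npoly" where
  "cube = Poly_Mapping.single (rword 0 1 2) 1 + Poly_Mapping.single (rword 0 2 1) 1 +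
     Poly_Mapping.single (rword 1 0 2) 1 + Poly_Mapping.single (rword 1 2 0) 1 +
     Poly_Mapping.single (rword 2 0 1) 1 + Poly_Mapping.single (rword 2 1 0) 1"

lemma multilinear_cube: "multilinear_in 3 cube"
  unfolding cube_def by (intro multilinear_in_add multilinear_in_single) (auto simp: rword_def)

text \<open>The superization of \<^const>\<open>cube\<close>, with the parities of the arguments as parameters.\<close>

definition super_cube :: "bit \<Rightarrow> bit \<Rightarrow> bit \<Rightarrow> ('x, 'f::field_char_0) npoly \<Rightarrow> ('x, 'f) npoly \<Rightarrow> ('x, 'f) npoly \<Rightarrow> ('x, 'f) npoly" where
  "super_cube i j k a b c = (a \<star> b) \<star> c + nscale (super_sign j k) ((a \<star> c) \<star> b) +
     nscale (super_sign i j) ((b \<star> a) \<star> c) + nscale (super_sign i j * super_sign i k) ((b \<star> c) \<star> a) +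
     nscale (super_sign i k * super_sign j k) ((c \<star> a) \<star> b) +
     nscale (super_sign i j * super_sign i k * super_sign j k) ((c \<star> b) \<star> a)"

lemma super_cube_linear:
  "super_cube i j k (a + a') b c = super_cube i j k a b c + super_cube i j k a' b c"
  "super_cube i j k a (b + b') c = super_cube i j k a b c + super_cube i j k a b' c"
  "super_cube i j k a b (c + c') = super_cube i j k a b c + super_cube i j k a b c'"
  "super_cube i j k (nscale d a) b c = nscale d (super_cube i j k a b c)"
  "super_cube i j k a (nscale d b) c = nscale d (super_cube i j k a b c)"
  "super_cube i j k a b (nscale d c) = nscale d (super_cube i j k a b c)"
  "super_cube i j k 0 b c = 0" "super_cube i j k a 0 c = 0" "super_cube i j k a b 0 = 0"
  unfolding super_cube_def
  by (simp_all add: npoly_mult_add_left npoly_mult_add_right npoly_mult_scale_left npoly_mult_scale_right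
      nscale_add mult.commute mult.left_commute algebra_simps)

lemma super_sign_add: "super_sign (i + j) k = super_sign i k * super_sign j k"
    "super_sign k (i + j) = super_sign k i * super_sign k j"
  by (cases i; cases j; cases k; simp add: super_sign_def)+

lemma koszul_factor_less: "x < y \<Longrightarrow> koszul_factor \<pi> x y = 1"
    "y < x \<Longrightarrow> koszul_factor \<pi> x y = super_sign (\<pi> y) (\<pi> x)"
  by (auto simp: koszul_factor_def super_sign_def)

context
  fixes s :: nat
begin

interpretation F: is_superalgebra "free_superalgebra 0 s :: ('f::field_char_0, _) superalgebra"
  by (rule is_superalgebra_free)

lemma eval_cube:
  fixes \<rho> :: "nat \<Rightarrow> (nat + nat, 'f::field_char_0) npoly"
  assumes "\<And>x. \<rho> x \<in> free_carrier 0 s"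
  shows "eval_npoly (free_superalgebra 0 s) \<rho> (sign_twist \<pi> cube) = super_cube (\<pi> 0) (\<pi> 1) (\<pi> 2) (\<rho> 0) (\<rho> 1) (\<rho> 2)"
  using assms unfolding cube_def sign_twist_add sign_twist_single super_cube_def
  by (simp add: F.eval_npoly_add image_subset_iff koszul_sign_letters rword_def koszul_factor_less mult_ac)

definition cube_in_word :: "nat nword \<Rightarrow> nat nword \<Rightarrow> nat nword \<Rightarrow> (nat, 'f::field_char_0) npoly" where
  "cube_in_word a b c = Poly_Mapping.single (Juxt (Juxt a b) c) 1 + Poly_Mapping.single (Juxt (Juxt a c) b) 1 +
     Poly_Mapping.single (Juxt (Juxt b a) c) 1 + Poly_Mapping.single (Juxt (Juxt b c) a) 1 +
     Poly_Mapping.single (Juxt (Juxt c a) b) 1 + Poly_Mapping.single (Juxt (Juxt c b) a) 1"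

lemma abs_cube_in_word:
  "abs_alt_free (cube_in_word a b c) = polar_cube (word_class a) (word_class b) (word_class c)"
  by (simp add: cube_in_word_def abs_add abs_single polar_cube_def)

lemma cube_in_word_alt_ideal:
  "cube_in_word (Juxt u v) b c \<in> alt_ideal" "cube_in_word a (Juxt u v) c \<in> alt_ideal" "cube_in_word a b (Juxt u v) \<in> alt_ideal"
  by (simp_all add: abs_cube_in_word polar_cube_square sq_mult flip: abs_eq_zero_iff)

text \<open>Superizes the four-variable identities that say the polar cube vanishes when one
  argument is a product. Since \<open>super_sign\<close> is multiplicative in each parity, the
  product behaves like one argument of the summed parity.\<close>

lemma super_cube_product:
  fixes a b c d :: "(nat + nat, 'f::field_char_0) npoly"
  assumes h: "a \<in> homog (free_superalgebra 0 s :: ('f, _) superalgebra) i" "b \<in> homog (free_superalgebra 0 s :: ('f, _) superalgebra) j"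
    "c \<in> homog (free_superalgebra 0 s :: ('f, _) superalgebra) k" "d \<in> homog (free_superalgebra 0 s :: ('f, _) superalgebra) l"
  shows "super_cube (i + j) k l (a \<star> b) c d \<in> free_alt_ideal 0 s"
    and "super_cube i (j + k) l a (b \<star> c) d \<in> free_alt_ideal 0 s"
    and "super_cube i j (k + l) a b (c \<star> d) \<in> free_alt_ideal 0 s"
proof -
  define \<rho> where "\<rho> n = (if n = 0 then a else if n = 1 then b else if n = 2 then c else d)" for n :: nat
  define \<pi> where "\<pi> n = (if n = 0 then i else if n = 1 then j else if n = 2 then k else l)" for n :: nat
  have vals: "\<rho> 0 = a" "\<rho> 1 = b" "\<rho> (Suc 0) = b" "\<rho> 2 = c" "\<rho> 3 = d" "\<pi> 0 = i" "\<pi> 1 = j" "\<pi> (Suc 0) = j" "\<pi> 2 = k" "\<pi> 3 = l"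
    by (simp_all add: \<rho>_def \<pi>_def)
  have h: "\<rho> n \<in> homog (free_superalgebra 0 s :: ('f, _) superalgebra) (\<pi> n)" for n
    using h by (simp add: \<rho>_def \<pi>_def)
  then have c: "\<rho> n \<in> free_carrier 0 s" for n by (auto simp: homog_free_superalgebra)
  then have range: "range \<rho> \<subseteq> free_carrier 0 s" by blast
  let ?L = "Letter :: nat \<Rightarrow> _"
  have set4: "{..<4::nat} = {0, 1, 2, 3}" by auto
  have ml: "multilinear (cube_in_word (Juxt (?L 0) (?L 1)) (?L 2) (?L 3) :: (nat, 'f) npoly)"
    "multilinear (cube_in_word (?L 0) (Juxt (?L 1) (?L 2)) (?L 3) :: (nat, 'f) npoly)"
    "multilinear (cube_in_word (?L 0) (?L 1) (Juxt (?L 2) (?L 3)) :: (nat, 'f) npoly)"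
    unfolding multilinear_iff cube_in_word_def
    by (rule exI[of _ 4], intro multilinear_in_add multilinear_in_single; force simp: set4)+
  note ev = F.eval_npoly_add F.eval_npoly_single koszul_sign_letters koszul_factor_less mult_ac
  have "eval_npoly (free_superalgebra 0 s) \<rho> (sign_twist \<pi> (cube_in_word (Juxt (?L 0) (?L 1)) (?L 2) (?L 3)))
      = super_cube (i + j) k l (a \<star> b) c d"
    unfolding cube_in_word_def sign_twist_add sign_twist_single super_cube_def super_sign_add using range by (simp add: ev vals)
  then show "super_cube (i + j) k l (a \<star> b) c d \<in> free_alt_ideal 0 s"
    using free_alt_ideal_eval[where \<rho> = \<rho> and \<pi> = \<pi>, OF cube_in_word_alt_ideal(1) ml(1) h] by simp
  have "eval_npoly (free_superalgebra 0 s) \<rho> (sign_twist \<pi> (cube_in_word (?L 0) (Juxt (?L 1) (?L 2)) (?L 3)))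
      = super_cube i (j + k) l a (b \<star> c) d"
    unfolding cube_in_word_def sign_twist_add sign_twist_single super_cube_def super_sign_add using range by (simp add: ev vals)
  then show "super_cube i (j + k) l a (b \<star> c) d \<in> free_alt_ideal 0 s"
    using free_alt_ideal_eval[where \<rho> = \<rho> and \<pi> = \<pi>, OF cube_in_word_alt_ideal(2) ml(2) h] by simp
  have "eval_npoly (free_superalgebra 0 s) \<rho> (sign_twist \<pi> (cube_in_word (?L 0) (?L 1) (Juxt (?L 2) (?L 3))))
      = super_cube i j (k + l) a b (c \<star> d)"
    unfolding cube_in_word_def sign_twist_add sign_twist_single super_cube_def super_sign_add using range by (simp add: ev vals)
  then show "super_cube i j (k + l) a b (c \<star> d) \<in> free_alt_ideal 0 s"
    using free_alt_ideal_eval[where \<rho> = \<rho> and \<pi> = \<pi>, OF cube_in_word_alt_ideal(3) ml(3) h] by simp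
qed

lemma single_homog_iff:
  "Poly_Mapping.single w 1 \<in> homog (free_superalgebra 0 s :: ('f::field_char_0, _) superalgebra) i \<longleftrightarrow>
    set (letters w) \<subseteq> Inr ` {..<s} \<and> nword_parity w = i"
  by (simp add: homog_free_superalgebra free_carrier_def)

text \<open>If one argument is not a letter, \<open>super_cube_product\<close> applies. Three
  letters are odd generators, two of which coincide as there are at most two; the superized cube is
  alternating in odd arguments, so it is zero.\<close>

lemma super_cube_words:
  assumes s: "s \<le> 2"
    and h: "Poly_Mapping.single u 1 \<in> homog (free_superalgebra 0 s :: ('f::field_char_0, _) superalgebra) i"
    "Poly_Mapping.single v 1 \<in> homog (free_superalgebra 0 s :: ('f, _) superalgebra) j"
    "Poly_Mapping.single w 1 \<in> homog (free_superalgebra 0 s :: ('f, _) superalgebra) k"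
  shows "super_cube i j k (Poly_Mapping.single u 1) (Poly_Mapping.single v 1) (Poly_Mapping.single w (1 :: 'f)) \<in> free_alt_ideal 0 s"
proof -
  have prod: "Poly_Mapping.single (Juxt p q) (1::'f) = Poly_Mapping.single p 1 \<star> Poly_Mapping.single q 1" for p q :: "(nat + nat) nword"
    by (simp add: npoly_mult_single)
  have part: "Poly_Mapping.single p 1 \<in> homog (free_superalgebra 0 s :: ('f, _) superalgebra) (nword_parity p)"
    "Poly_Mapping.single q 1 \<in> homog (free_superalgebra 0 s :: ('f, _) superalgebra) (nword_parity q)"
    "nword_parity p + nword_parity q = l"
    if "Poly_Mapping.single (Juxt p q) 1 \<in> homog (free_superalgebra 0 s :: ('f, _) superalgebra) l" for p q l
    using that unfolding single_homog_iff by auto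
  consider p q where "u = Juxt p q" | p q where "v = Juxt p q" | p q where "w = Juxt p q"
    | x y z where "u = Letter x" "v = Letter y" "w = Letter z" by (metis nword.exhaust)
  then show ?thesis
  proof cases
    case 1
    then show ?thesis unfolding 1 prod using super_cube_product(1)[OF part(1,2)[OF h(1)[unfolded 1]] h(2,3)] part(3)[OF h(1)[unfolded 1]] by simp
  next
    case 2
    then show ?thesis unfolding 2 prod using super_cube_product(2)[OF h(1) part(1,2)[OF h(2)[unfolded 2]] h(3)] part(3)[OF h(2)[unfolded 2]] by simp
  next
    case 3
    then show ?thesis unfolding 3 prod using super_cube_product(3)[OF h(1,2) part(1,2)[OF h(3)[unfolded 3]]] part(3)[OF h(3)[unfolded 3]] by simp
  next
    case 4
    then have xyz: "x \<in> Inr ` {..<s}" "y \<in> Inr ` {..<s}" "z \<in> Inr ` {..<s}" "gen_parity x = i" "gen_parity y = j" "gen_parity z = k"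
      using h unfolding single_homog_iff by auto
    then have par: "i = 1" "j = 1" "k = 1" by (auto simp: gen_parity_def)
    have "x = y \<or> y = z \<or> x = z" using xyz s by auto
    then have "super_cube i j k (Poly_Mapping.single u 1) (Poly_Mapping.single v 1) (Poly_Mapping.single w (1 :: 'f)) = 0"
      using 4 by (auto simp: par super_cube_def nscale_minus_one)
    then show ?thesis by (simp add: free_alt_ideal_zero)
  qed
qed

lemma free_alt_satisfies_cube:
  assumes s: "s \<le> 2"
  shows "super_satisfies (free_alt 0 s :: ('f::field_char_0, _) superalgebra) cube"
proof (rule free_alt_satisfiesI)
  fix \<pi> :: "nat \<Rightarrow> bit" and \<rho> :: "nat \<Rightarrow> (nat + nat, 'f) npoly"
  assume \<rho>: "\<And>x. \<rho> x \<in> homog (free_superalgebra 0 s :: ('f, _) superalgebra) (\<pi> x)"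
  then have car: "\<rho> x \<in> free_carrier 0 s" for x by (auto simp: homog_free_superalgebra)
  note cl = super_cube_linear free_alt_ideal_zero free_alt_ideal_closed
  have "super_cube i j k a b c \<in> free_alt_ideal 0 s"
    if "a \<in> homog (free_superalgebra 0 s :: ('f, _) superalgebra) i" "b \<in> homog (free_superalgebra 0 s :: ('f, _) superalgebra) j"
      "c \<in> homog (free_superalgebra 0 s :: ('f, _) superalgebra) k" for i j k a b c
    using that(1)
  proof (induction a rule: free_homog_induct)
    case u: (word u)
    show ?case using that(2)
    proof (induction b rule: free_homog_induct)
      case v: (word v)
      show ?case using that(3)
      proof (induction c rule: free_homog_induct)
        case (word w)
        show ?case by (rule super_cube_words[OF s u v word])
      qed (simp_all add: cl)
    qed (simp_all add: cl)
  qed (simp_all add: cl)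
  then show "eval_npoly (free_superalgebra 0 s) \<rho> (sign_twist \<pi> cube) \<in> free_alt_ideal 0 s"
    unfolding eval_cube[OF car] using \<rho> by blast
qed

end

text \<open>At the even matrix with units 12, 23, 34 each of the six terms contributes the unit 14,
  and 6 is nonzero in characteristic 0.\<close>

lemma tri_not_cube: "\<not> super_satisfies (tri_algebra (\<lambda>_. 0)) (cube :: (nat, 'f::field_char_0) npoly)"
proof
  assume s: "super_satisfies (tri_algebra (\<lambda>_. 0)) (cube :: (nat, 'f) npoly)"
  let ?t = "(1, 0, 0, 1, 0, 1) :: 'f tuple6"
  have "eval_superization (tri_algebra (\<lambda>_. 0)) (\<lambda>_. 0) (\<lambda>_. ?t) cube = \<zero>\<^bsub>tri_algebra (\<lambda>_. 0) :: ('f, _) superalgebra\<^esub>"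
    by (rule s[unfolded super_satisfies_def, rule_format]) (simp add: tri_homog_def)
  moreover have "koszul_sign (\<lambda>_. 0) w = (1 :: 'f)" for w
    unfolding koszul_sign_def by simp
  moreover have "eval_nword (tri_algebra (\<lambda>_. 0)) (\<lambda>_. ?t) w = (0, 0, 1, 0, 0, 0)" if "w \<in> words3" for w
    using that by (auto simp: words3_def rword_def lword_def)
  ultimately have "(\<Sum>w\<in>words3. scale6 (Poly_Mapping.lookup cube w) (0, 0, 1, 0, 0, 0)) = (0 :: 'f tuple6)"
    unfolding tri_eval_expand[OF multilinear_cube] by simp
  then have "(\<Sum>w\<in>words3. Poly_Mapping.lookup cube w) = (0 :: 'f)"
    unfolding sum_scale6_corner by (simp add: zero_prod_def)
  moreover have "(\<Sum>w\<in>words3. Poly_Mapping.lookup cube w) = (6 :: 'f)"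
    by (simp add: words3_def cube_def rword_def lword_def lookup_add lookup_single)
  ultimately show False by simp
qed

section \<open>The basic spectrum\<close>

text \<open>The rank \<open>(0, 0)\<close> is refuted by any nonzero member of the class, even
  generators alone by the left-normed word on \<open>bimod_algebra\<close>, and at most two odd
  generators by the cube on triangular matrices.\<close>

lemma rank_supervariety_neq:
  fixes \<iota> :: "'f::field_char_0 \<Rightarrow> 'a"
  assumes \<iota>: "inj \<iota>" and rs: "s = 0 \<or> r = 0 \<and> s \<le> 2"
  shows "rank_supervariety alt_metabelian r s \<noteq> (super_class alt_metabelian :: ('f, 'a) superalgebra set)"
proof -
  obtain J5 :: "'f tuple5 \<Rightarrow> 'a" and J6 :: "'f tuple6 \<Rightarrow> 'a" where J: "inj J5" "inj J6"
    using tuple_injections[OF \<iota>] .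
  consider "r = 0" "s = 0" | "r > 0" "s = 0" | "r = 0" "s > 0" "s \<le> 2" using rs by auto
  then show ?thesis
  proof cases
    case 1
    have "carrier (transport J5 bimod_algebra :: ('f, 'a) superalgebra) \<noteq> {\<zero>\<^bsub>transport J5 bimod_algebra\<^esub>}"
    proof
      assume *: "carrier (transport J5 bimod_algebra :: ('f, 'a) superalgebra) = {\<zero>\<^bsub>transport J5 bimod_algebra\<^esub>}"
      have "J5 bx \<in> carrier (transport J5 bimod_algebra :: ('f, 'a) superalgebra)" by simp
      then have "J5 bx = J5 0" unfolding * by simp
      then show False using J(1) by (simp add: inj_eq bx_def zero_prod_def)
    qed
    then have "(transport J5 bimod_algebra :: ('f, 'a) superalgebra) \<notin> rank_supervariety alt_metabelian r s"
      using 1 by (simp add: rank_supervariety_def)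
    then show ?thesis using transport_in_super_class[OF J(1) bimod_in_super_class] by blast
  next
    case 2
    show ?thesis unfolding 2(2)
      by (rule rank_supervariety_neqI[OF _ J(1) bimod_in_super_class multilinear_left_normed
            free_alt_satisfies_left_normed bimod_not_left_normed]) (use 2 in simp)
  next
    case 3
    have ml: "multilinear (cube :: (nat, 'f) npoly)" using multilinear_cube multilinear_iff by blast
    show ?thesis unfolding 3(1)
      by (rule rank_supervariety_neqI[OF _ J(2) tri_in_super_class ml
            free_alt_satisfies_cube[OF 3(3)] tri_not_cube]) (use 3 in simp)
  qed
qed

theorem corollary2p1:
  fixes \<iota> :: "'f::field_char_0 \<Rightarrow> 'a"
  assumes "inj \<iota>"
  shows "basic_spectrum TYPE('a) (alt_metabelian :: (nat, 'f) npoly set) = {(1, 1), (0, 3)}"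
proof -
  let ?eq = "\<lambda>r s. rank_supervariety alt_metabelian r s = (super_class alt_metabelian :: ('f, 'a) superalgebra set)"
  note eq = rank_supervariety_1_1[where 'f='f and 'a='a] rank_supervariety_0_3[where 'f='f and 'a='a]
  have neq: "\<not> ?eq r s" if "s = 0 \<or> r = 0 \<and> s \<le> 2" for r s
    using rank_supervariety_neq[OF assms that] .
  have "basic_superrank TYPE('a) (alt_metabelian :: (nat, 'f) npoly set) r s \<longleftrightarrow> (r, s) = (1, 1) \<or> (r, s) = (0, 3)" for r s
  proof
    assume b: "basic_superrank TYPE('a) (alt_metabelian :: (nat, 'f) npoly set) r s"
    then have e: "?eq r s" and min: "\<And>r' s'. (r', s') \<noteq> (r, s) \<Longrightarrow> r' \<le> r \<Longrightarrow> s' \<le> s \<Longrightarrow> \<not> ?eq r' s'"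
      unfolding basic_superrank_def by blast+
    \<comment> \<open>Every pair outside the excluded region lies above \<open>(1, 1)\<close> or
      \<open>(0, 3)\<close>, so minimality forces equality with one of them.\<close>
    have "\<not> (s = 0 \<or> r = 0 \<and> s \<le> 2)" using neq e by blast
    then consider "1 \<le> r" "1 \<le> s" | "r = 0" "3 \<le> s" by linarith
    then show "(r, s) = (1, 1) \<or> (r, s) = (0, 3)"
    proof cases
      case 1
      then show ?thesis using min[of 1 1] eq(1) by auto
    next
      case 2
      then show ?thesis using min[of 0 3] eq(2) by auto
    qed
  next
    assume rs: "(r, s) = (1, 1) \<or> (r, s) = (0, 3)"
    have "\<not> ?eq r' s'" if "(r', s') \<noteq> (r, s)" "r' \<le> r" "s' \<le> s" for r' s'
      by (rule neq) (use rs that in auto)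
    then show "basic_superrank TYPE('a) (alt_metabelian :: (nat, 'f) npoly set) r s"
      unfolding basic_superrank_def using rs eq by blast
  qed
  then show ?thesis by (auto simp: basic_spectrum_def)
qed

end
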